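(* Let $(n,p,e)$ be a nonnegative solution to $$\partial_t n=\nabla\cdot(\nabla n+2n\nabla V)+k(e-\rho(x)np),\quad \partial_t p=\nabla\cdot(\nabla p+2p\nabla V)+k(e-\rho(x)np),\quad \partial_t e=\nabla\cdot(\nabla e+2e\nabla V)$$ on $\mathbb R^d$, belonging to $L^\infty(0,\infty;L^1(\mathbb R^d))\cap L^\infty((0,\infty)\times\mathbb R^d)$, and let $e$ satisfy $\underline e\,e^*(x)\le e(t,x)\le\bar e\,e^*(x)$ for all $x\in\mathbb R^d$, $t>0$, with constants $0<\underline e\le\bar e<\infty$. Then there exists a constant $K>0$ such that $$\mathcal H(n,p,e)\le K\,\mathcal P(n,p,e)$$ (for the solution at every time $t>0$).
   Context: Setting: $d\le4$; $V\in C^2(\mathbb R^d)$ is an $L^\infty$-perturbation of a uniformly convex function, normalized by $\int_{\mathbb R^d}e^{-2V}\,dx=1$ (here $e^{-2V}=\exp(-2V)$); $\rho(x)=\exp(2V(x))$; the reaction coefficient $k$ satisfies $0<\underline k\le k\le\bar k$ for constants $\underline k,\bar k$. The conserved quantities are $\int_{\mathbb R^d}(n-p)\,dx=\int_{\mathbb R^d}(n_0-p_0)\,dx=\mathbf C_0$ and $\int_{\mathbb R^d}e\,dx=\int_{\mathbb R^d}e_0\,dx=1$, where $(n_0,p_0,e_0)$ are the nonnegative initial data. $c>0$ is a fixed constant; $C_n,C_p>0$ are determined by $C_nC_p=1$ and $C_n-C_p=\mathbf C_0$. Notation: $\lambda_B(\nu)=\nu\ln\nu-\nu+1$; $e^*(x)=\exp(-2V(x))$;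 $w_n(x,e)=C_n\sqrt e\exp(-V(x))$, $w_p(x,e)=C_p\sqrt e\exp(-V(x))$; $N=n+p+c\sqrt e\sqrt{e^*}$. The relative entropy is $$\mathcal H(n,p,e)=\int_{\mathbb R^d}w_n\,\lambda_B\Big(\frac n{w_n}\Big)dx+\int_{\mathbb R^d}w_p\,\lambda_B\Big(\frac p{w_p}\Big)dx+\frac{c+C_n+C_p}2\int_{\mathbb R^d}\big(\sqrt e-\sqrt{e^*}\big)^2dx$$ and the entropy production is $$\mathcal P(n,p,e)=\int_{\mathbb R^d}\Big(n\Big|\nabla\ln\frac n{w_n}\Big|^2+p\Big|\nabla\ln\frac p{w_p}\Big|^2\Big)dx+\int_{\mathbb R^d}\frac N4\Big|\nabla\ln\frac e{e^*}\Big|^2dx+\int_{\mathbb R^d}k\,e\Big(\frac{np}{w_nw_p}-1\Big)\ln\frac{np}{w_nw_p}\,dx .$$ *)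

theory Defs
  imports "HOL-Analysis.Analysis"
begin

subsection \<open>Classical and weak derivatives\<close>

definition grad :: "('a::euclidean_space \<Rightarrow> real) \<Rightarrow> 'a \<Rightarrow> 'a" where
  "grad f x = (THE D. GDERIV f x :> D)"

definition C1 :: "('a::euclidean_space \<Rightarrow> real) \<Rightarrow> bool" where
  "C1 f \<longleftrightarrow> (\<forall>x. f differentiable (at x)) \<and> continuous_on UNIV (grad f)"

definition C2 :: "('a::euclidean_space \<Rightarrow> real) \<Rightarrow> bool" where
  "C2 f \<longleftrightarrow> C1 f \<and> (\<forall>b\<in>Basis. C1 (\<lambda>x. grad f x \<bullet> b))"

definition laplacian :: "('a::euclidean_space \<Rightarrow> real) \<Rightarrow> 'a \<Rightarrow> real" where
  "laplacian f x = (\<Sum>b\<in>Basis. grad (\<lambda>y. grad f y \<bullet> b) x \<bullet> b)"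

(* C^2 rather than smooth test functions: for the second-order distributional equation and the
   weak gradients below, with locally integrable data, the two choices are equivalent by
   mollification. *)
definition test_function :: "('a::euclidean_space \<Rightarrow> real) \<Rightarrow> bool" where
  "test_function \<phi> \<longleftrightarrow> C2 \<phi> \<and> compact (closure {x. \<phi> x \<noteq> 0})"

definition locally_integrable :: "('a::euclidean_space \<Rightarrow> 'b::euclidean_space) \<Rightarrow> bool" where
  "locally_integrable f \<longleftrightarrow> (\<forall>S. compact S \<longrightarrow> set_integrable lborel S f)"

definition weak_gradient :: "('a::euclidean_space \<Rightarrow> real) \<Rightarrow> ('a \<Rightarrow> 'a) \<Rightarrow> bool" where
  "weak_gradient u g \<longleftrightarrow> locally_integrable u \<and> locally_integrable g \<and>
     (\<forall>\<phi>. test_function \<phi> \<longrightarrow>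
        (LINT x|lborel. u x *\<^sub>R grad \<phi> x) = - (LINT x|lborel. \<phi> x *\<^sub>R g x))"

(* The integral of m |grad u|^2 for the weak gradient of u. Weak gradients are unique almost
   everywhere, so the infimum ranges over at most one value; it is infinity if u has no weak
   gradient, the usual extension of such functionals outside their domain. *)
definition dirichlet_integral ::
  "('a::euclidean_space \<Rightarrow> real) \<Rightarrow> ('a \<Rightarrow> real) \<Rightarrow> ennreal" where
  "dirichlet_integral m u =
     (INF g\<in>{g. weak_gradient u g}. \<integral>\<^sup>+x. ennreal (m x * (norm (g x))\<^sup>2) \<partial>lborel)"

subsection \<open>The potential\<close>

(* Uniform convexity with respect to the quadratic modulus, i.e. D^2 U >= \<kappa> Id with \<kappa> > 0
   when U is of class C^2. *)
definition uniformly_convex :: "('a::euclidean_space \<Rightarrow> real) \<Rightarrow> bool" where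
  "uniformly_convex U \<longleftrightarrow>
     (\<exists>\<kappa>>0. convex_on UNIV (\<lambda>x. U x - \<kappa> / 2 * (norm x)\<^sup>2))"

(* V and U are continuous, so the essential bound on V - U is a bound everywhere. *)
definition bounded_perturbation_of_uniformly_convex ::
  "('a::euclidean_space \<Rightarrow> real) \<Rightarrow> bool" where
  "bounded_perturbation_of_uniformly_convex V \<longleftrightarrow>
     (\<exists>U. uniformly_convex U \<and> (\<exists>B. \<forall>x. \<bar>V x - U x\<bar> \<le> B))"

definition rho :: "('a \<Rightarrow> real) \<Rightarrow> 'a \<Rightarrow> real" where
  "rho V x = exp (2 * V x)"

definition e_star :: "('a \<Rightarrow> real) \<Rightarrow> 'a \<Rightarrow> real" where
  "e_star V x = exp (- 2 * V x)"

subsection \<open>Solutions\<close>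

definition measurable_pos_time :: "(real \<Rightarrow> 'a::euclidean_space \<Rightarrow> real) \<Rightarrow> bool" where
  "measurable_pos_time u \<longleftrightarrow>
     (\<lambda>z. u (fst z) (snd z)) \<in> borel_measurable (restrict_space borel ({0<..} \<times> UNIV))"

definition Linfty_L1 :: "(real \<Rightarrow> 'a::euclidean_space \<Rightarrow> real) \<Rightarrow> bool" where
  "Linfty_L1 u \<longleftrightarrow>
     (\<exists>M. \<forall>t>0. integrable lborel (u t) \<and> (LINT x|lborel. \<bar>u t x\<bar>) \<le> M)"

definition Linfty :: "(real \<Rightarrow> 'a::euclidean_space \<Rightarrow> real) \<Rightarrow> bool" where
  "Linfty u \<longleftrightarrow> (\<exists>M. \<forall>t>0. AE x in lborel. \<bar>u t x\<bar> \<le> M)"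

(* Distributional form, integrated in time, of u_t = div (grad u + 2 u grad V) + f, u(0) = u0.
   Both spatial derivatives in the divergence term are moved to the test function. Imposing the
   identity at every t > 0 selects the weakly continuous representative of the solution, which
   gives u t a meaning at every time. *)
definition drift_diffusion_solution ::
  "('a::euclidean_space \<Rightarrow> real) \<Rightarrow> ('a \<Rightarrow> real) \<Rightarrow> (real \<Rightarrow> 'a \<Rightarrow> real) \<Rightarrow>
     (real \<Rightarrow> 'a \<Rightarrow> real) \<Rightarrow> bool" where
  "drift_diffusion_solution V u0 f u \<longleftrightarrow>
     (\<forall>\<phi> t. test_function \<phi> \<longrightarrow> 0 < t \<longrightarrow>
        (LINT x|lborel. u t x * \<phi> x) =
          (LINT x|lborel. u0 x * \<phi> x) +
          (LINT s:{0<..t}|lborel. (LINT x|lborel.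
             u s x * (laplacian \<phi> x - 2 * (grad V x \<bullet> grad \<phi> x)) + f s x * \<phi> x)))"

definition reaction ::
  "('a \<Rightarrow> real) \<Rightarrow> (real \<Rightarrow> 'a \<Rightarrow> real) \<Rightarrow> (real \<Rightarrow> 'a \<Rightarrow> real) \<Rightarrow> (real \<Rightarrow> 'a \<Rightarrow> real) \<Rightarrow>
     (real \<Rightarrow> 'a \<Rightarrow> real) \<Rightarrow> real \<Rightarrow> 'a \<Rightarrow> real" where
  "reaction V k n p e t x = k t x * (e t x - rho V x * n t x * p t x)"

definition solution ::
  "('a::euclidean_space \<Rightarrow> real) \<Rightarrow> (real \<Rightarrow> 'a \<Rightarrow> real) \<Rightarrow>
     ('a \<Rightarrow> real) \<Rightarrow> ('a \<Rightarrow> real) \<Rightarrow> ('a \<Rightarrow> real) \<Rightarrow>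
     (real \<Rightarrow> 'a \<Rightarrow> real) \<Rightarrow> (real \<Rightarrow> 'a \<Rightarrow> real) \<Rightarrow> (real \<Rightarrow> 'a \<Rightarrow> real) \<Rightarrow> bool" where
  "solution V k n0 p0 e0 n p e \<longleftrightarrow>
     measurable_pos_time n \<and> measurable_pos_time p \<and> measurable_pos_time e \<and>
     Linfty_L1 n \<and> Linfty_L1 p \<and> Linfty_L1 e \<and> Linfty n \<and> Linfty p \<and> Linfty e \<and>
     drift_diffusion_solution V n0 (reaction V k n p e) n \<and>
     drift_diffusion_solution V p0 (reaction V k n p e) p \<and>
     drift_diffusion_solution V e0 (\<lambda>t x. 0) e"

subsection \<open>Relative entropy and entropy production\<close>

(* ln 0 = 0 in the library, so lambda_B 0 = 1, in agreement with the limit at 0. *)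
definition lambda_B :: "real \<Rightarrow> real" where
  "lambda_B \<nu> = \<nu> * ln \<nu> - \<nu> + 1"

(* w_n and w_p, for C = C_n and C = C_p. *)
definition w :: "('a \<Rightarrow> real) \<Rightarrow> real \<Rightarrow> ('a \<Rightarrow> real) \<Rightarrow> 'a \<Rightarrow> real" where
  "w V C e x = C * sqrt (e x) * exp (- V x)"

definition rel_entropy ::
  "('a::euclidean_space \<Rightarrow> real) \<Rightarrow> real \<Rightarrow> real \<Rightarrow> real \<Rightarrow>
     ('a \<Rightarrow> real) \<Rightarrow> ('a \<Rightarrow> real) \<Rightarrow> ('a \<Rightarrow> real) \<Rightarrow> ennreal" where
  "rel_entropy V c Cn Cp n p e =
     (\<integral>\<^sup>+x. ennreal (w V Cn e x * lambda_B (n x / w V Cn e x)) \<partial>lborel) +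
     (\<integral>\<^sup>+x. ennreal (w V Cp e x * lambda_B (p x / w V Cp e x)) \<partial>lborel) +
     ennreal ((c + Cn + Cp) / 2) *
       (\<integral>\<^sup>+x. ennreal ((sqrt (e x) - sqrt (e_star V x))\<^sup>2) \<partial>lborel)"

(* (r - 1) ln r for r >= 0, with its limit infinity at r = 0. *)
definition reaction_dissipation :: "real \<Rightarrow> ennreal" where
  "reaction_dissipation r = (if r = 0 then \<infinity> else ennreal ((r - 1) * ln r))"

(* Where n or p vanishes, the library value ln 0 = 0 in the first two terms is immaterial: if n p
   vanishes on a set of positive measure then the last term is infinite. *)
definition entropy_production ::
  "('a::euclidean_space \<Rightarrow> real) \<Rightarrow> real \<Rightarrow> real \<Rightarrow> real \<Rightarrow> ('a \<Rightarrow> real) \<Rightarrow>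
     ('a \<Rightarrow> real) \<Rightarrow> ('a \<Rightarrow> real) \<Rightarrow> ('a \<Rightarrow> real) \<Rightarrow> ennreal" where
  "entropy_production V c Cn Cp k n p e =
     dirichlet_integral n (\<lambda>x. ln (n x / w V Cn e x)) +
     dirichlet_integral p (\<lambda>x. ln (p x / w V Cp e x)) +
     dirichlet_integral (\<lambda>x. (n x + p x + c * sqrt (e x) * sqrt (e_star V x)) / 4)
       (\<lambda>x. ln (e x / e_star V x)) +
     (\<integral>\<^sup>+x. ennreal (k x * e x) *
        reaction_dissipation (n x * p x / (w V Cn e x * w V Cp e x)) \<partial>lborel)"

end

theory Submission
  imports Defs "HOL-Analysis.Analysis"
begin

text \<open>
  Put \<open>\<mu> = exp (- 2 V) dx\<close>, \<open>\<sigma> = sqrt (e / e*)\<close>, \<open>\<alpha> = sqrt (n / w_n)\<close>, \<open>\<beta> = sqrt (p / w_p)\<close>. The production controls the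
  Dirichlet integrals of \<open>\<alpha>\<close>, \<open>\<beta>\<close>, \<open>\<sigma>\<close> with respect to \<open>\<mu>\<close> and, through \<open>(r - 1) ln r \<ge> 2 (sqrt r - 1)\<^sup>2\<close>, the
  \<open>L\<^sup>2\<close> norm of \<open>\<alpha> \<beta> - 1\<close>. A Poincare inequality for \<open>\<mu>\<close> brings the three functions close to their means;
  the reaction term and the two conservation laws then force the means close to \<open>1\<close>.

  For the entropy, \<open>\<lambda>_B(x\<^sup>2) \<le> 5 (x - 1)\<^sup>2 (1 + max 0 (ln x\<^sup>2))\<close>, and the \<open>L\<^sup>\<infinity>\<close> bound on \<open>n\<close> gives \<open>ln \<alpha>\<^sup>2 \<le> const + 2 V\<close>.
  So no logarithmic Sobolev inequality is needed, only the moment inequality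
  \<open>\<integral> f\<^sup>2 U d\<mu> \<le> const (\<integral> f\<^sup>2 d\<mu> + \<integral> |\<nabla>f|\<^sup>2 d\<mu>)\<close> for a uniformly convex \<open>U\<close>, which follows by integrating by parts against
  the vector field \<open>x\<close>. The same inequality reduces the Poincare inequality for \<open>\<mu>\<close> to the one on a large ball, and both
  survive bounded perturbations of \<open>U\<close>. A weak gradient enters only through difference quotients along segments,
  where mollification justifies the chain rule.
\<close>

subsection \<open>Integration and approximation\<close>

text \<open>The obstacle is that the production speaks of weak gradients of logarithms
  \<open>u\<close>, while the estimates concern \<open>exp (u / 2)\<close>. The derivative of this
  function is unbounded and \<open>u\<close> is only locally integrable, so no weak gradient of
  \<open>exp (u / 2)\<close> is constructed. On almost every segment, however, \<open>u\<close> is a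
  limit of C^1 functions that are uniformly bounded there, and the chain rule survives the limit.
  Each functional inequality is therefore read off from differences of \<open>F (u x)\<close> over a
  family of segments: all pairs of points of a ball for the Poincare inequality, the segments from
  \<open>x / (1 + \<tau>)\<close> to \<open>x\<close> for the moment inequality. Both inequalities
  end by absorbing part of the left side, so finiteness is established before any subtraction; this
  is why the work starts on balls and with extended nonnegative integrals. The final constant has to
  serve every time. It is assembled from the potential, \<open>c\<close>, \<open>Cn\<close>,
  \<open>Cp\<close> and bounds that hold uniformly in time, before a particular time is
  fixed.\<close>

lemma nn_integral_lborel_affine:
  fixes f :: "'a::euclidean_space \<Rightarrow> ennreal"
  assumes [measurable]: "f \<in> borel_measurable borel" and "c \<noteq> 0"
  shows "(\<integral>\<^sup>+x. f x \<partial>lborel) = \<bar>c\<bar> ^ DIM('a) * (\<integral>\<^sup>+x. f (t + c *\<^sub>R x) \<partial>lborel)"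
  by (subst lborel_affine[OF \<open>c \<noteq> 0\<close>, of t])
     (simp add: nn_integral_density nn_integral_distr nn_integral_cmult ennreal_power)

lemma nn_integral_lborel_translate:
  fixes f :: "'a::euclidean_space \<Rightarrow> ennreal"
  assumes "f \<in> borel_measurable borel"
  shows "(\<integral>\<^sup>+x. f (t + x) \<partial>lborel) = (\<integral>\<^sup>+x. f x \<partial>lborel)"
  using nn_integral_lborel_affine[OF assms, of 1 t] by simp

lemma locally_integrable_indicator:
  "locally_integrable f \<Longrightarrow> compact S \<Longrightarrow> integrable lborel (\<lambda>x. indicator S x *\<^sub>R f x)"
  unfolding locally_integrable_def set_integrable_def by blast

text \<open>Local integrability yields measurability of the cut-offs to compact sets only;
  \<open>f\<close> is their pointwise limit over growing balls.\<close>

lemma locally_integrable_measurable: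
  fixes f :: "'a::euclidean_space \<Rightarrow> 'b::euclidean_space"
  assumes "locally_integrable f"
  shows "f \<in> borel_measurable borel"
proof (rule borel_measurable_LIMSEQ_metric)
  show "(\<lambda>x. indicator (cball 0 (real n)) x *\<^sub>R f x) \<in> borel_measurable borel" for n
  proof -
    have "integrable lborel (\<lambda>x. indicator (cball 0 (real n)) x *\<^sub>R f x)"
      using assms compact_cball unfolding locally_integrable_def set_integrable_def by blast
    from borel_measurable_integrable[OF this] show ?thesis by simp
  qed
  fix x :: 'a
  obtain m where m: "norm x \<le> real m"
    using real_arch_simple by blast
  have "eventually (\<lambda>n. indicator (cball 0 (real n)) x *\<^sub>R f x = f x) sequentially"
    using eventually_ge_at_top[of m]
    by eventually_elim (use m in \<open>auto simp: indicator_def\<close>)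
  then show "(\<lambda>n. indicator (cball 0 (real n)) x *\<^sub>R f x) \<longlonglongrightarrow> f x"
    by (rule tendsto_eventually)
qed

lemma locally_integrable_nn_integral:
  fixes f :: "'a::euclidean_space \<Rightarrow> 'b::euclidean_space"
  assumes "locally_integrable f" "compact S"
  shows "(\<integral>\<^sup>+x\<in>S. ennreal (norm (f x)) \<partial>lborel) < \<infinity>"
proof -
  have "integrable lborel (\<lambda>x. indicator S x *\<^sub>R f x)"
    using assms unfolding locally_integrable_def set_integrable_def by blast
  then have "(\<integral>\<^sup>+x. ennreal (norm (indicator S x *\<^sub>R f x)) \<partial>lborel) < \<infinity>"
    unfolding integrable_iff_bounded by blast
  also have "(\<integral>\<^sup>+x. ennreal (norm (indicator S x *\<^sub>R f x)) \<partial>lborel)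
      = (\<integral>\<^sup>+x\<in>S. ennreal (norm (f x)) \<partial>lborel)"
    by (intro nn_integral_cong) (auto simp: indicator_def)
  finally show ?thesis .
qed

text \<open>The gauge integral supplies the approximation: integrability on every box implies
  \<open>measurable_on\<close>, which means being a limit of continuous functions off a negligible
  set. The nearest-point projection onto \<open>cball 0 k\<close> restores the bound without losing
  continuity, so that dominated convergence applies later.\<close>

lemma bounded_borel_AE_limit_continuous:
  fixes f :: "'a::euclidean_space \<Rightarrow> 'b::euclidean_space"
  assumes f[measurable]: "f \<in> borel_measurable borel" and bnd: "\<And>x. norm (f x) \<le> k"
  shows "\<exists>g. (\<forall>n::nat. continuous_on UNIV (g n)) \<and> (\<forall>n x. norm (g n x) \<le> k) \<and>
    (AE x in lborel. (\<lambda>n. g n x) \<longlonglongrightarrow> f x)"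
proof -
  have "k \<ge> 0" using bnd[of 0] norm_ge_zero order_trans by blast
  have "f integrable_on cbox a b" for a b
  proof -
    have "set_integrable lborel (cbox a b) f"
      unfolding set_integrable_def
      by (rule integrableI_bounded_set_indicator[where B=k]) (auto simp: bnd emeasure_lborel_cbox_eq)
    then show ?thesis
      by (rule set_borel_integral_eq_integral)
  qed
  then have "f measurable_on UNIV"
    by (rule integrable_subintervals_imp_measurable)
  then obtain N g where N: "negligible N" and g: "\<And>n. continuous_on UNIV (g n)"
      "\<And>x. x \<notin> N \<Longrightarrow> (\<lambda>n. g n x) \<longlonglongrightarrow> f x"
    unfolding measurable_on_def by auto
  define h where "h = (\<lambda>n x. closest_point (cball 0 k) (g n x))"
  have cont: "continuous_on UNIV (closest_point (cball (0::'b) k))"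
    by (rule continuous_on_closest_point) (use \<open>k \<ge> 0\<close> in auto)
  have "continuous_on UNIV (h n)" for n
    unfolding h_def using continuous_on_compose2[OF cont g(1)] by auto
  moreover have "norm (h n x) \<le> k" for n x
    using closest_point_in_set[of "cball 0 k" "g n x"] \<open>k \<ge> 0\<close> unfolding h_def by auto
  moreover have "AE x in lborel. (\<lambda>n. h n x) \<longlonglongrightarrow> f x"
  proof -
    have "AE x in lebesgue. x \<notin> N"
      using N by (auto simp: negligible_iff_null_sets intro: AE_not_in)
    then have "AE x in lborel. x \<notin> N"
      by (simp add: AE_completion_iff)
    then show ?thesis
    proof eventually_elim
      case (elim x)
      have "isCont (closest_point (cball (0::'b) k)) (f x)"
        using cont continuous_on_eq_continuous_at by blast
      from isCont_tendsto_compose[OF this g(2)[OF elim]]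
      show ?case using bnd[of x] by (simp add: h_def closest_point_self)
    qed
  qed
  ultimately show ?thesis by blast
qed

text \<open>Two dominated limits: truncation in height, dominated by \<open>norm (f x)\<close>, then
  continuous approximation of one truncation, dominated by its height because \<open>S\<close> has
  finite measure.\<close>

lemma continuous_L1_approx:
  fixes f :: "'a::euclidean_space \<Rightarrow> 'b::euclidean_space"
  assumes f[measurable]: "f \<in> borel_measurable borel"
    and S[measurable]: "S \<in> sets borel" and S_fin: "emeasure lborel S < \<infinity>"
    and fin: "(\<integral>\<^sup>+x\<in>S. ennreal (norm (f x)) \<partial>lborel) < \<infinity>" and "\<epsilon> > 0"
  shows "\<exists>v. continuous_on UNIV v \<and> (\<integral>\<^sup>+x\<in>S. ennreal (norm (f x - v x)) \<partial>lborel) \<le> ennreal \<epsilon>"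
proof -
  define M where "M = restrict_space lborel S"
  have M_int: "(\<integral>\<^sup>+x. h x \<partial>M) = (\<integral>\<^sup>+x\<in>S. h x \<partial>lborel)" for h :: "'a \<Rightarrow> ennreal"
    unfolding M_def by (rule nn_integral_restrict_space) simp
  have M_meas: "h \<in> borel_measurable M" if "h \<in> borel_measurable borel" for h :: "'a \<Rightarrow> 'c::topological_space"
    unfolding M_def using that by (intro measurable_restrict_space1) simp
  have M_AE: "AE x in M. Q x" if "AE x in lborel. Q x" for Q
    unfolding M_def using that by (subst AE_restrict_space_iff) auto
  define T where "T = (\<lambda>k::nat. \<lambda>x. if norm (f x) \<le> real k then f x else 0)"
  have T[measurable]: "T k \<in> borel_measurable borel" for k unfolding T_def by measurable
  have "(\<lambda>k. \<integral>\<^sup>+x. ennreal (norm (f x - T k x)) \<partial>M) \<longlonglongrightarrow> 0"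
  proof (rule nn_integral_dominated_convergence_norm[where w = "\<lambda>x. norm (f x)"])
    show "AE x in M. (\<lambda>k. T k x) \<longlonglongrightarrow> f x"
    proof (rule AE_I2)
      fix x
      obtain m where m: "norm (f x) \<le> real m" using real_arch_simple by blast
      have "eventually (\<lambda>k. T k x = f x) sequentially"
        using eventually_ge_at_top[of m] by eventually_elim (use m in \<open>auto simp: T_def\<close>)
      then show "(\<lambda>k. T k x) \<longlonglongrightarrow> f x" by (rule tendsto_eventually)
    qed
  qed (use fin in \<open>auto intro!: M_meas simp: M_int T_def\<close>)
  moreover have "0 < ennreal (\<epsilon> / 2)" using \<open>\<epsilon> > 0\<close> by simp
  ultimately have "eventually (\<lambda>k. (\<integral>\<^sup>+x. ennreal (norm (f x - T k x)) \<partial>M) < ennreal (\<epsilon> / 2)) sequentially"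
    by (rule order_tendstoD(2))
  then obtain k where k: "(\<integral>\<^sup>+x. ennreal (norm (f x - T k x)) \<partial>M) < ennreal (\<epsilon> / 2)"
    using eventually_happens by force
  have "norm (T k x) \<le> real k" for x unfolding T_def by auto
  from bounded_borel_AE_limit_continuous[OF T this]
  obtain g where g: "\<And>n::nat. continuous_on UNIV (g n)" "\<And>n x. norm (g n x) \<le> real k"
    "AE x in lborel. (\<lambda>n. g n x) \<longlonglongrightarrow> T k x" by blast
  have g_meas[measurable]: "g n \<in> borel_measurable borel" for n
    using g(1) by (rule borel_measurable_continuous_onI)
  have "(\<lambda>n. \<integral>\<^sup>+x. ennreal (norm (T k x - g n x)) \<partial>M) \<longlonglongrightarrow> 0"
  proof (rule nn_integral_dominated_convergence_norm[where w = "\<lambda>x. real k"])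
    show "(\<integral>\<^sup>+x. ennreal (real k) \<partial>M) < \<infinity>"
      using S_fin by (simp only: M_int) (simp add: nn_integral_cmult_indicator ennreal_mult_less_top)
  qed (use g in \<open>auto intro!: M_meas M_AE\<close>)
  moreover have "0 < ennreal (\<epsilon> / 2)" using \<open>\<epsilon> > 0\<close> by simp
  ultimately have "eventually (\<lambda>n. (\<integral>\<^sup>+x. ennreal (norm (T k x - g n x)) \<partial>M) < ennreal (\<epsilon> / 2)) sequentially"
    by (rule order_tendstoD(2))
  then obtain n where n: "(\<integral>\<^sup>+x. ennreal (norm (T k x - g n x)) \<partial>M) < ennreal (\<epsilon> / 2)"
    using eventually_happens by force
  have "(\<integral>\<^sup>+x. ennreal (norm (f x - g n x)) \<partial>M)
      \<le> (\<integral>\<^sup>+x. ennreal (norm (f x - T k x)) + ennreal (norm (T k x - g n x)) \<partial>M)"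
    by (intro nn_integral_mono)
      (simp flip: ennreal_plus dist_norm add: dist_triangle)
  also have "\<dots> = (\<integral>\<^sup>+x. ennreal (norm (f x - T k x)) \<partial>M) + (\<integral>\<^sup>+x. ennreal (norm (T k x - g n x)) \<partial>M)"
    by (intro nn_integral_add M_meas) measurable
  also have "\<dots> \<le> ennreal (\<epsilon> / 2) + ennreal (\<epsilon> / 2)"
    using k n by (intro add_mono) auto
  also have "\<dots> = ennreal \<epsilon>"
    using \<open>\<epsilon> > 0\<close> by (simp flip: ennreal_plus)
  finally show ?thesis using g(1) by (auto simp: M_int)
qed

subsection \<open>Mollification of weakly differentiable functions\<close>

text \<open>The exponent \<open>3\<close> is the least that makes the bump function \<open>C\<^sup>2\<close>, as test functions must be.\<close>

definition bump :: "real \<Rightarrow> 'a::euclidean_space \<Rightarrow> real" where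
  "bump r z = max 0 (1 - r * (z \<bullet> z)) ^ 3"

definition bump_grad :: "real \<Rightarrow> 'a::euclidean_space \<Rightarrow> 'a" where
  "bump_grad r z = (- 6 * r * max 0 (1 - r * (z \<bullet> z)) ^ 2) *\<^sub>R z"

section \<open>Derivatives, support and size of the bump function\<close>

lemma DERIV_max_0_power:
  "((\<lambda>t::real. max 0 t ^ Suc (Suc k)) has_real_derivative (real (Suc (Suc k)) * max 0 t ^ Suc k)) (at t)"
proof -
  consider "t > 0" | "t < 0" | "t = 0" by linarith
  then show ?thesis
  proof cases
    case 1
    have "((\<lambda>t::real. t ^ Suc (Suc k)) has_real_derivative (real (Suc (Suc k)) * t ^ Suc k)) (at t)"
      using DERIV_pow[of "Suc (Suc k)" t UNIV] by (simp only: diff_Suc_Suc diff_zero diff_Suc_1)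
    then have "((\<lambda>t::real. max 0 t ^ Suc (Suc k)) has_real_derivative (real (Suc (Suc k)) * t ^ Suc k)) (at t)"
      by (rule has_field_derivative_transform_within_open[where S = "{0<..}"]) (use 1 in auto)
    then show ?thesis using 1 by simp
  next
    case 2
    have "((\<lambda>t::real. 0) has_real_derivative 0) (at t)" by simp
    then have "((\<lambda>t::real. max 0 t ^ Suc (Suc k)) has_real_derivative 0) (at t)"
      by (rule has_field_derivative_transform_within_open[where S = "{..<0}"]) (use 2 in auto)
    then show ?thesis using 2 by simp
  next
    case 3
    \<comment> \<open>At the kink the difference quotient is of order \<open>h ^ Suc k\<close>, so
      the exponent has to be at least 2; hence its form \<open>Suc (Suc k)\<close>.\<close>
    have "((\<lambda>h::real. max 0 h ^ Suc (Suc k) / h) \<longlongrightarrow> 0) (at 0)"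
    proof (rule Lim_null_comparison[where g = "\<lambda>h. \<bar>h\<bar> ^ Suc k"])
      show "\<forall>\<^sub>F h in at 0. norm (max 0 h ^ Suc (Suc k) / h) \<le> \<bar>h::real\<bar> ^ Suc k"
      proof (intro always_eventually allI)
        fix h :: real
        have "norm (max 0 h ^ Suc (Suc k) / h) = (if h \<le> 0 then 0 else h ^ Suc k)"
          by (auto simp: max_def)
        also have "\<dots> \<le> \<bar>h\<bar> ^ Suc k"
          using zero_le_power_abs[of h "Suc k"] by (auto simp del: power_Suc zero_le_power_abs)
        finally show "norm (max 0 h ^ Suc (Suc k) / h) \<le> \<bar>h\<bar> ^ Suc k" .
      qed
      show "((\<lambda>h::real. \<bar>h\<bar> ^ Suc k) \<longlongrightarrow> 0) (at 0)"
        by (rule tendsto_eq_intros refl | simp)+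
    qed
    then show ?thesis unfolding 3 DERIV_def by simp
  qed
qed

lemma GDERIV_max_0_power:
  assumes "GDERIV f x :> D"
  shows "GDERIV (\<lambda>y. max 0 (f y) ^ Suc (Suc k)) x :> (real (Suc (Suc k)) * max 0 (f x) ^ Suc k) *\<^sub>R D"
  by (rule GDERIV_DERIV_compose[OF assms DERIV_max_0_power])

lemma GDERIV_quadratic:
  "GDERIV (\<lambda>y. 1 - r * ((y - c) \<bullet> (y - c))) x :> (- 2 * r) *\<^sub>R (x - c)"
proof -
  have "((\<lambda>y. 1 - r * ((y - c) \<bullet> (y - c))) has_derivative
      (\<lambda>h. - (r * ((x - c) \<bullet> h + h \<bullet> (x - c))))) (at x)"
    by (auto intro!: derivative_eq_intros)
  also have "(\<lambda>h. - (r * ((x - c) \<bullet> h + h \<bullet> (x - c)))) = (\<lambda>h. h \<bullet> (- 2 * r) *\<^sub>R (x - c))"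
    by (simp only: inner_commute[of "x - c"]) (simp add: fun_eq_iff)
  finally show ?thesis unfolding gderiv_def .
qed

lemma GDERIV_bump: "GDERIV (\<lambda>y. bump r (y - c)) x :> bump_grad r (x - c)"
  using GDERIV_max_0_power[OF GDERIV_quadratic[of r c x], of 1]
  unfolding bump_def bump_grad_def by (simp add: numeral_3_eq_3 numeral_2_eq_2 mult_ac)

lemma grad_eqI: "GDERIV f x :> D \<Longrightarrow> grad f x = D"
  unfolding grad_def
proof (rule the_equality)
  fix D' assume "GDERIV f x :> D" "GDERIV f x :> D'"
  then have "(\<lambda>h. h \<bullet> D) = (\<lambda>h. h \<bullet> D')"
    unfolding gderiv_def by (rule has_derivative_unique)
  then show "D' = D" by (metis inner_commute vector_eq_ldot)
qed

lemma C1I: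
  assumes "\<And>x. GDERIV f x :> D x" "continuous_on UNIV D"
  shows "C1 f"
proof -
  have "grad f = D" using grad_eqI[OF assms(1)] by blast
  then show ?thesis using assms unfolding C1_def gderiv_def differentiable_def by auto
qed

text \<open>These translates are the only test functions that are ever inserted into the definition
  of \<open>weak_gradient\<close>. A component of the gradient is a squared positive part times a
  linear function, so it can be differentiated once more.\<close>

lemma test_function_bump:
  assumes "r > 0"
  shows "test_function (\<lambda>y. bump r (y - c))"
proof -
  have grad: "grad (\<lambda>y. bump r (y - c)) = (\<lambda>x. bump_grad r (x - c))"
    using grad_eqI[OF GDERIV_bump] by blast
  have C1: "C1 (\<lambda>y. bump r (y - c))"
  proof (rule C1I)
    show "GDERIV (\<lambda>y. bump r (y - c)) x :> bump_grad r (x - c)" for x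
      by (rule GDERIV_bump)
    show "continuous_on UNIV (\<lambda>x. bump_grad r (x - c))"
      unfolding bump_grad_def by (intro continuous_intros)
  qed
  have C2: "C1 (\<lambda>x. bump_grad r (x - c) \<bullet> b)" for b
  proof (rule C1I)
    show "GDERIV (\<lambda>x. bump_grad r (x - c) \<bullet> b) x :>
        (24 * r\<^sup>2 * max 0 (1 - r * ((x - c) \<bullet> (x - c))) * ((x - c) \<bullet> b)) *\<^sub>R (x - c)
        + (- 6 * r * max 0 (1 - r * ((x - c) \<bullet> (x - c))) ^ 2) *\<^sub>R b" for x
    proof -
      have 1: "GDERIV (\<lambda>y. max 0 (1 - r * ((y - c) \<bullet> (y - c))) ^ 2) x :>
          (2 * max 0 (1 - r * ((x - c) \<bullet> (x - c)))) *\<^sub>R (- 2 * r) *\<^sub>R (x - c)"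
        using GDERIV_max_0_power[OF GDERIV_quadratic[of r c x], of 0] by (simp add: numeral_eq_Suc)
      have 2: "GDERIV (\<lambda>y. - 6 * r * ((y - c) \<bullet> b)) x :> (- 6 * r) *\<^sub>R b"
        unfolding gderiv_def by (auto intro!: derivative_eq_intros)
      have "GDERIV (\<lambda>y. max 0 (1 - r * ((y - c) \<bullet> (y - c))) ^ 2 * (- 6 * r * ((y - c) \<bullet> b))) x :>
          max 0 (1 - r * ((x - c) \<bullet> (x - c))) ^ 2 *\<^sub>R (- 6 * r) *\<^sub>R b
          + (- 6 * r * ((x - c) \<bullet> b)) *\<^sub>R (2 * max 0 (1 - r * ((x - c) \<bullet> (x - c)))) *\<^sub>R (- 2 * r) *\<^sub>R (x - c)"
        by (rule GDERIV_mult[OF 1 2])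
      moreover have "(\<lambda>y. max 0 (1 - r * ((y - c) \<bullet> (y - c))) ^ 2 * (- 6 * r * ((y - c) \<bullet> b)))
          = (\<lambda>x. bump_grad r (x - c) \<bullet> b)"
        by (auto simp: bump_grad_def)
      moreover have "m ^ 2 *\<^sub>R (- 6 * r) *\<^sub>R b + (- 6 * r * i) *\<^sub>R (2 * m) *\<^sub>R (- 2 * r) *\<^sub>R z
          = (24 * r\<^sup>2 * m * i) *\<^sub>R z + (- 6 * r * m ^ 2) *\<^sub>R b" for m i :: real and z :: 'a
        by (simp add: power2_eq_square mult_ac)
      ultimately show ?thesis by (simp only:)
    qed
    show "continuous_on UNIV (\<lambda>x. (24 * r\<^sup>2 * max 0 (1 - r * ((x - c) \<bullet> (x - c))) * ((x - c) \<bullet> b)) *\<^sub>R (x - c)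
        + (- 6 * r * max 0 (1 - r * ((x - c) \<bullet> (x - c))) ^ 2) *\<^sub>R b)"
      by (intro continuous_intros)
  qed
  have "{x. bump r (x - c) \<noteq> 0} \<subseteq> cball c (sqrt (1 / r))"
  proof
    fix x assume "x \<in> {x. bump r (x - c) \<noteq> 0}"
    then have "r * ((x - c) \<bullet> (x - c)) < 1" by (auto simp: bump_def max_def split: if_splits)
    then have "(norm (x - c))\<^sup>2 \<le> 1 / r"
      using \<open>r > 0\<close> by (simp add: field_simps power2_norm_eq_inner)
    then show "x \<in> cball c (sqrt (1 / r))"
      using real_le_rsqrt by (auto simp: dist_norm norm_minus_commute)
  qed
  then have "compact (closure {x. bump r (x - c) \<noteq> 0})"
    by (meson bounded_cball bounded_subset compact_closure)
  then show ?thesis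
    unfolding test_function_def C2_def grad using C1 C2 by blast
qed

lemma bump_nonneg: "0 \<le> bump r z"
  unfolding bump_def by simp

lemma bump_le_1: "r \<ge> 0 \<Longrightarrow> bump r z \<le> 1"
  unfolding bump_def by (intro power_le_one) auto

lemma bump_minus_commute: "bump r (x - y) = bump r (y - x)"
  unfolding bump_def by (metis inner_minus_left inner_minus_right minus_diff_eq minus_minus)

lemma bump_grad_minus_commute: "bump_grad r (x - y) = - bump_grad r (y - x)"
proof -
  have "(x - y) \<bullet> (x - y) = (y - x) \<bullet> (y - x)"
    by (metis inner_minus_left inner_minus_right minus_diff_eq minus_minus)
  moreover have "x - y = - (y - x)" by simp
  ultimately show ?thesis unfolding bump_grad_def by (metis scaleR_minus_right)
qed

lemma continuous_on_bump: "continuous_on UNIV (bump r)"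
  unfolding bump_def by (intro continuous_intros)

lemma continuous_on_bump_grad: "continuous_on UNIV (bump_grad r)"
  unfolding bump_grad_def by (intro continuous_intros)

lemma borel_measurable_bump[measurable]: "bump r \<in> borel_measurable borel"
  using continuous_on_bump by (rule borel_measurable_continuous_onI)

lemma borel_measurable_bump_grad[measurable]: "bump_grad r \<in> borel_measurable borel"
  using continuous_on_bump_grad by (rule borel_measurable_continuous_onI)

lemma bump_support:
  assumes "r > 0" "sqrt (1 / r) \<le> norm z"
  shows "bump r z = 0" "bump_grad r z = 0"
proof -
  have "1 / r \<le> (norm z)\<^sup>2"
    using assms(2) by (rule sqrt_le_D)
  then have "1 - r * (z \<bullet> z) \<le> 0"
    using \<open>r > 0\<close> by (simp add: field_simps power2_norm_eq_inner)
  then show "bump r z = 0" "bump_grad r z = 0"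
    unfolding bump_def bump_grad_def by (simp_all add: max_def)
qed

lemma norm_bump_grad_le:
  assumes "r > 0"
  shows "norm (bump_grad r z) \<le> 6 * r * sqrt (1 / r)"
proof (cases "sqrt (1 / r) \<le> norm z")
  case True
  then show ?thesis using bump_support[OF \<open>r > 0\<close> True] \<open>r > 0\<close> by simp
next
  case False
  have "max 0 (1 - r * (z \<bullet> z)) ^ 2 \<le> 1"
    using \<open>r > 0\<close> by (intro power_le_one) auto
  then have "max 0 (1 - r * (z \<bullet> z)) ^ 2 * norm z \<le> 1 * sqrt (1 / r)"
    using False by (intro mult_mono) simp_all
  then have "6 * r * (max 0 (1 - r * (z \<bullet> z)) ^ 2 * norm z) \<le> 6 * r * sqrt (1 / r)"
    using \<open>r > 0\<close> by simp
  then show ?thesis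
    using \<open>r > 0\<close> unfolding bump_grad_def by (simp add: abs_mult mult.assoc)
qed

text \<open>The mean value inequality. The constant bounds all difference quotients of the bump,
  which is the domination needed to differentiate under the integral.\<close>

lemma bump_lipschitz:
  assumes "r > 0"
  shows "\<bar>bump r a - bump r b\<bar> \<le> 6 * r * sqrt (1 / r) * norm (a - b)"
proof -
  have "norm (bump r a - bump r b) \<le> (6 * r * sqrt (1 / r)) * norm (a - b)"
  proof (rule differentiable_bound[of UNIV])
    show "(bump r has_derivative (\<lambda>h. h \<bullet> bump_grad r x)) (at x within UNIV)" for x :: 'a
      using GDERIV_bump[of r 0 x] unfolding gderiv_def by simp
    show "onorm (\<lambda>h. h \<bullet> bump_grad r x) \<le> 6 * r * sqrt (1 / r)" for x :: 'a
    proof (rule onorm_le)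
      fix h
      have "norm (h \<bullet> bump_grad r x) \<le> norm h * norm (bump_grad r x)"
        by (simp add: Cauchy_Schwarz_ineq2)
      also have "\<dots> \<le> norm h * (6 * r * sqrt (1 / r))"
        by (intro mult_left_mono norm_bump_grad_le assms) simp
      finally show "norm (h \<bullet> bump_grad r x) \<le> 6 * r * sqrt (1 / r) * norm h"
        by (simp add: mult_ac)
    qed
  qed auto
  then show ?thesis by simp
qed

lemma integrable_bounded_compact_support:
  fixes f :: "'a::euclidean_space \<Rightarrow> 'b::euclidean_space" and h :: "'a \<Rightarrow> 'c::euclidean_space"
  assumes f: "locally_integrable f" and S: "compact S"
    and [measurable]: "h \<in> borel_measurable borel"
    and h: "\<And>y. norm (h y) \<le> B * norm (f y)" "\<And>y. y \<notin> S \<Longrightarrow> h y = 0"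
  shows "integrable lborel h"
proof (rule Bochner_Integration.integrable_bound)
  have "integrable lborel (\<lambda>y. indicator S y *\<^sub>R f y)"
    using f S unfolding locally_integrable_def set_integrable_def by blast
  then show "integrable lborel (\<lambda>y. B *\<^sub>R indicator S y *\<^sub>R f y)"
    by (rule integrable_scaleR_right)
  have "norm (h y) \<le> norm (B *\<^sub>R indicator S y *\<^sub>R f y)" for y
  proof (cases "y \<in> S")
    case True
    have "B * norm (f y) \<le> \<bar>B\<bar> * norm (f y)"
      by (intro mult_right_mono) auto
    then show ?thesis using h(1)[of y] True by simp
  qed (use h(2) in auto)
  then show "AE y in lborel. norm (h y) \<le> norm (B *\<^sub>R indicator S y *\<^sub>R f y)"
    by simp
qed simp

text \<open>A three-epsilon argument: \<open>f\<close> is replaced by a continuous \<open>v\<close>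
  on a slightly larger ball, where \<open>v\<close> is uniformly continuous. The approximation error
  occurs twice, once translated.\<close>

lemma L1_translation_continuous:
  fixes f :: "'a::euclidean_space \<Rightarrow> 'b::euclidean_space"
  assumes f: "locally_integrable f" and "\<epsilon> > 0"
  shows "\<exists>\<delta>>0. \<forall>z. norm z < \<delta> \<longrightarrow>
    (\<integral>\<^sup>+x\<in>cball 0 R. ennreal (norm (f (z + x) - f x)) \<partial>lborel) \<le> ennreal \<epsilon>"
proof -
  have [measurable]: "f \<in> borel_measurable borel"
    using f by (rule locally_integrable_measurable)
  let ?S = "cball (0::'a) (R + 1)"
  have "\<exists>v. continuous_on UNIV v \<and> (\<integral>\<^sup>+x\<in>?S. ennreal (norm (f x - v x)) \<partial>lborel) \<le> ennreal (\<epsilon> / 3)"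
    using \<open>\<epsilon> > 0\<close> by (intro continuous_L1_approx locally_integrable_nn_integral f emeasure_compact_finite) auto
  then obtain v where v: "continuous_on UNIV v"
      "(\<integral>\<^sup>+x\<in>?S. ennreal (norm (f x - v x)) \<partial>lborel) \<le> ennreal (\<epsilon> / 3)" by blast
  have [measurable]: "v \<in> borel_measurable borel"
    using v(1) by (rule borel_measurable_continuous_onI)
  define m where "m = measure lborel (cball (0::'a) R)"
  have m: "emeasure lborel (cball (0::'a) R) = ennreal m"
    unfolding m_def using emeasure_compact_finite[of "cball (0::'a) R"]
    by (intro emeasure_eq_ennreal_measure) auto
  have "m \<ge> 0" unfolding m_def by simp
  \<comment> \<open>Chosen so that \<open>\<eta>\<close> times the volume \<open>m\<close> of the
    ball is at most a third of \<open>\<epsilon>\<close>; the \<open>+ 1\<close> covers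
    \<open>m = 0\<close>.\<close>
  define \<eta> where "\<eta> = \<epsilon> / (3 * (m + 1))"
  have "\<eta> > 0" using \<open>\<epsilon> > 0\<close> \<open>m \<ge> 0\<close> by (simp add: \<eta>_def)
  have \<eta>m: "\<eta> * m \<le> \<epsilon> / 3"
  proof -
    have "\<eta> * m \<le> \<eta> * (m + 1)" using \<open>\<eta> > 0\<close> by (intro mult_left_mono) auto
    also have "\<dots> = \<epsilon> / 3" using \<open>m \<ge> 0\<close> by (simp add: \<eta>_def field_simps)
    finally show ?thesis .
  qed
  have "uniformly_continuous_on ?S v"
    by (intro compact_uniformly_continuous continuous_on_subset[OF v(1)]) auto
  then obtain d where d: "d > 0" "\<And>x y. x \<in> ?S \<Longrightarrow> y \<in> ?S \<Longrightarrow> dist y x < d \<Longrightarrow> dist (v y) (v x) < \<eta>"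
    using \<open>\<eta> > 0\<close> unfolding uniformly_continuous_on_def by metis
  \<comment> \<open>The cap 1 keeps \<open>z + x\<close> in the ball of radius \<open>R + 1\<close>,
    where \<open>v\<close> approximates \<open>f\<close>.\<close>
  define \<delta> where "\<delta> = min d 1"
  have "(\<integral>\<^sup>+x\<in>cball 0 R. ennreal (norm (f (z + x) - f x)) \<partial>lborel) \<le> ennreal \<epsilon>" if z: "norm z < \<delta>" for z
  proof -
    define F where "F = (\<lambda>x. ennreal (norm (f x - v x)) * indicator ?S x)"
    have [measurable]: "?S \<in> sets borel" by simp
    have [measurable]: "F \<in> borel_measurable borel" unfolding F_def by measurable
    have F_int: "(\<integral>\<^sup>+x. F x \<partial>lborel) \<le> ennreal (\<epsilon> / 3)"
      using v(2) unfolding F_def by simp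
    have "(\<integral>\<^sup>+x\<in>cball 0 R. ennreal (norm (f (z + x) - f x)) \<partial>lborel)
        \<le> (\<integral>\<^sup>+x. (F (z + x) + F x) + ennreal \<eta> * indicator (cball 0 R) x \<partial>lborel)"
    proof (intro nn_integral_mono)
      fix x
      show "ennreal (norm (f (z + x) - f x)) * indicator (cball 0 R) x
          \<le> (F (z + x) + F x) + ennreal \<eta> * indicator (cball 0 R) x"
      proof (cases "x \<in> cball 0 R")
        case True
        have in1: "x \<in> ?S" using True by auto
        have in2: "z + x \<in> ?S"
          using True z norm_triangle_ineq[of z x] unfolding \<delta>_def by auto
        have "dist (v (z + x)) (v x) < \<eta>"
          using d(2)[OF in1 in2] z unfolding \<delta>_def by (simp add: dist_norm)
        moreover have "norm (f (z + x) - f x) \<le> norm (f (z + x) - v (z + x)) + norm (f x - v x) + dist (v (z + x)) (v x)"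
          unfolding dist_norm by norm
        ultimately have "norm (f (z + x) - f x) \<le> norm (f (z + x) - v (z + x)) + norm (f x - v x) + \<eta>"
          by linarith
        then have "ennreal (norm (f (z + x) - f x))
            \<le> ennreal (norm (f (z + x) - v (z + x)) + norm (f x - v x) + \<eta>)"
          by (rule ennreal_leI)
        also have "\<dots> = ennreal (norm (f (z + x) - v (z + x))) + ennreal (norm (f x - v x)) + ennreal \<eta>"
          using \<open>\<eta> > 0\<close> by (simp flip: ennreal_plus)
        finally show ?thesis using True in1 in2 by (simp add: F_def)
      qed auto
    qed
    also have "\<dots> = (\<integral>\<^sup>+x. F (z + x) \<partial>lborel) + (\<integral>\<^sup>+x. F x \<partial>lborel) + ennreal \<eta> * emeasure lborel (cball (0::'a) R)"
      by (subst nn_integral_add; (subst nn_integral_add)?; (subst nn_integral_cmult_indicator)?) (measurable, simp_all)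
    also have "(\<integral>\<^sup>+x. F (z + x) \<partial>lborel) = (\<integral>\<^sup>+x. F x \<partial>lborel)"
      by (rule nn_integral_lborel_translate) simp
    also have "(\<integral>\<^sup>+x. F x \<partial>lborel) + (\<integral>\<^sup>+x. F x \<partial>lborel) + ennreal \<eta> * emeasure lborel (cball (0::'a) R)
        \<le> ennreal (\<epsilon> / 3) + ennreal (\<epsilon> / 3) + ennreal (\<epsilon> / 3)"
      unfolding m using \<eta>m \<open>\<eta> > 0\<close> \<open>m \<ge> 0\<close>
      by (intro add_mono F_int) (simp flip: ennreal_mult add: ennreal_leI)
    also have "\<dots> = ennreal \<epsilon>"
      using \<open>\<epsilon> > 0\<close> by (simp flip: ennreal_plus)
    finally show ?thesis .
  qed
  moreover have "\<delta> > 0" using d(1) by (simp add: \<delta>_def)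
  ultimately show ?thesis by blast
qed

text \<open>The dummy type argument names the space of integration, which \<open>r\<close> does not
  determine.\<close>

definition bump_mass :: "'a::euclidean_space itself \<Rightarrow> real \<Rightarrow> real" where
  "bump_mass _ r = (LINT z::'a|lborel. bump r z)"

text \<open>The bump has radius \<open>sqrt (1 / r)\<close>, so the mollification sharpens as
  \<open>r\<close> tends to infinity. The division makes the kernel a probability density.\<close>

definition mollify :: "real \<Rightarrow> ('a::euclidean_space \<Rightarrow> 'b::euclidean_space) \<Rightarrow> 'a \<Rightarrow> 'b" where
  "mollify r f x = (1 / bump_mass TYPE('a) r) *\<^sub>R (LINT y|lborel. bump r (y - x) *\<^sub>R f y)"

lemma locally_integrable_const: "locally_integrable (\<lambda>x. c)"
  unfolding locally_integrable_def
  using borel_integrable_compact[OF _ continuous_on_const]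
  by (auto simp: set_integrable_def)

lemma integrable_bump_mult:
  fixes f :: "'a::euclidean_space \<Rightarrow> 'b::euclidean_space"
  assumes "r > 0" "locally_integrable f"
  shows "integrable lborel (\<lambda>y. bump r (y - x) *\<^sub>R f y)"
proof (rule integrable_bounded_compact_support[OF assms(2)])
  have [measurable]: "f \<in> borel_measurable borel"
    using assms(2) by (rule locally_integrable_measurable)
  show "(\<lambda>y. bump r (y - x) *\<^sub>R f y) \<in> borel_measurable borel" by measurable
  show "norm (bump r (y - x) *\<^sub>R f y) \<le> 1 * norm (f y)" for y
    using bump_nonneg[of r "y - x"] bump_le_1[of r "y - x"] \<open>r > 0\<close> mult_right_mono by fastforce
  show "bump r (y - x) *\<^sub>R f y = 0" if "y \<notin> cball x (sqrt (1 / r))" for y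
    using bump_support(1)[OF \<open>r > 0\<close>, of "y - x"] that by (simp add: dist_norm norm_minus_commute)
qed simp

text \<open>A vanishing integral would make the bump zero almost everywhere, but it is positive on a
  nonempty open ball, which is not negligible.\<close>

lemma bump_mass_pos:
  assumes "r > 0"
  shows "bump_mass TYPE('a::euclidean_space) r > 0"
    "(\<integral>\<^sup>+z. ennreal (bump r (z::'a)) \<partial>lborel) = ennreal (bump_mass TYPE('a) r)"
proof -
  have int: "integrable lborel (bump r :: 'a \<Rightarrow> real)"
    using integrable_bump_mult[OF assms locally_integrable_const[of "1::real"], of 0] by simp
  show eq: "(\<integral>\<^sup>+z. ennreal (bump r (z::'a)) \<partial>lborel) = ennreal (bump_mass TYPE('a) r)"
    unfolding bump_mass_def using int bump_nonneg by (intro nn_integral_eq_integral) auto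
  have ne: "bump_mass TYPE('a) r \<noteq> 0"
  proof
    assume "bump_mass TYPE('a) r = 0"
    then have ae: "AE z in lborel. bump r (z::'a) = 0"
      using integral_nonneg_eq_0_iff_AE[OF int] bump_nonneg unfolding bump_mass_def by auto
    have pos: "bump r z > 0" if "z \<in> ball (0::'a) (sqrt (1 / r))" for z
    proof -
      have "(norm z)\<^sup>2 < 1 / r"
        using that assms real_less_rsqrt real_sqrt_less_iff by (metis dist_0_norm mem_ball norm_ge_zero real_sqrt_abs real_sqrt_unique abs_of_nonneg)
      then show ?thesis
        using assms unfolding bump_def by (simp add: field_simps power2_norm_eq_inner)
    qed
    from ae have "AE z in lborel. z \<notin> ball (0::'a) (sqrt (1 / r))"
    proof eventually_elim
      case (elim z)
      then show ?case using pos[of z] by force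
    qed
    then have "ball (0::'a) (sqrt (1 / r)) \<in> null_sets lborel"
      by (simp add: AE_iff_null_sets del: mem_ball)
    then have "negligible (ball (0::'a) (sqrt (1 / r)))"
      unfolding negligible_iff_null_sets by (rule null_sets_completionI)
    then have "ball (0::'a) (sqrt (1 / r)) = {}"
      using open_not_negligible[OF open_ball] by blast
    then show False using assms by simp
  qed
  moreover have "bump_mass TYPE('a) r \<ge> 0"
    unfolding bump_mass_def using bump_nonneg by (intro integral_nonneg_AE) auto
  ultimately show "bump_mass TYPE('a) r > 0" by simp
qed

text \<open>The error at \<open>x\<close> is an average over \<open>z\<close> of the translation
  errors \<open>f (z + x) - f x\<close>. Exchanging the integrals leaves, for each \<open>z\<close>
  in the support of the kernel, an \<open>L^1\<close> modulus of continuity; the support shrinks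
  into the ball of radius \<open>\<delta>\<close> once \<open>r\<close> is at least
  \<open>1 / \<delta>^2\<close>.\<close>

lemma mollify_L1:
  fixes f :: "'a::euclidean_space \<Rightarrow> 'b::euclidean_space"
  assumes f: "locally_integrable f" and "\<epsilon> > 0"
  shows "\<forall>\<^sub>F r in at_top. (\<integral>\<^sup>+x\<in>cball 0 R. ennreal (norm (f x - mollify r f x)) \<partial>lborel) \<le> ennreal \<epsilon>"
proof -
  have [measurable]: "f \<in> borel_measurable borel" "cball (0::'a) R \<in> sets borel"
    using f by (auto intro: locally_integrable_measurable)
  obtain \<delta> where "\<delta> > 0" and \<delta>: "\<And>z. norm z < \<delta> \<Longrightarrow>
      (\<integral>\<^sup>+x\<in>cball 0 R. ennreal (norm (f (z + x) - f x)) \<partial>lborel) \<le> ennreal \<epsilon>"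
    using L1_translation_continuous[OF f \<open>\<epsilon> > 0\<close>] by blast
  have "(\<integral>\<^sup>+x\<in>cball 0 R. ennreal (norm (f x - mollify r f x)) \<partial>lborel) \<le> ennreal \<epsilon>"
    if r: "r \<ge> 1 / \<delta>\<^sup>2" for r
  proof -
    have "r > 0" using r \<open>\<delta> > 0\<close> by (meson less_le_trans zero_less_divide_1_iff zero_less_power)
    have "1 / r \<le> \<delta>\<^sup>2" using r \<open>r > 0\<close> \<open>\<delta> > 0\<close> by (simp add: field_simps)
    then have supp: "sqrt (1 / r) \<le> \<delta>" using \<open>\<delta> > 0\<close> by (intro real_le_lsqrt) (use \<open>r > 0\<close> in auto)
    define m where "m = bump_mass TYPE('a) r"
    have "m > 0" and m: "(\<integral>\<^sup>+z. ennreal (bump r (z::'a)) \<partial>lborel) = ennreal m"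
      using bump_mass_pos[OF \<open>r > 0\<close>, where 'a = 'a] by (auto simp: m_def)
    have pw: "ennreal (norm (f x - mollify r f x))
        \<le> ennreal (1 / m) * (\<integral>\<^sup>+z. ennreal (bump r z * norm (f (z + x) - f x)) \<partial>lborel)" for x
    proof -
      have i1: "integrable lborel (\<lambda>y. bump r (y - x) *\<^sub>R f y)"
        by (rule integrable_bump_mult[OF \<open>r > 0\<close> f])
      have i2: "integrable lborel (\<lambda>y. bump r (y - x) *\<^sub>R f x)"
        by (rule integrable_bump_mult[OF \<open>r > 0\<close> locally_integrable_const])
      have i3: "integrable lborel (\<lambda>y. bump r (y - x))"
        using integrable_bump_mult[OF \<open>r > 0\<close> locally_integrable_const[of "1::real"], of x] by simp
      have "(LINT y|lborel. bump r (y - x)) = m"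
      proof -
        have "ennreal (LINT y|lborel. bump r (y - x)) = (\<integral>\<^sup>+y. ennreal (bump r (y - x)) \<partial>lborel)"
          using i3 bump_nonneg by (intro nn_integral_eq_integral[symmetric]) auto
        also have "\<dots> = (\<integral>\<^sup>+y. ennreal (bump r ((x + y) - x)) \<partial>lborel)"
          by (rule nn_integral_lborel_translate[symmetric]) measurable
        also have "\<dots> = ennreal m" using m by simp
        finally show ?thesis
          using \<open>m > 0\<close> by (subst (asm) ennreal_inj) (auto intro!: integral_nonneg_AE simp: bump_nonneg)
      qed
      then have "m *\<^sub>R f x = (LINT y|lborel. bump r (y - x) *\<^sub>R f x)"
        using i3 by simp
      then have "f x = (1 / m) *\<^sub>R (LINT y|lborel. bump r (y - x) *\<^sub>R f x)"
        using \<open>m > 0\<close> by (metis divide_self_if less_irrefl real_scaleR_def scaleR_one scaleR_scaleR times_divide_eq_left mult_1)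
      then have "mollify r f x - f x = (1 / m) *\<^sub>R (LINT y|lborel. bump r (y - x) *\<^sub>R f y - bump r (y - x) *\<^sub>R f x)"
        unfolding mollify_def m_def[symmetric] Bochner_Integration.integral_diff[OF i1 i2] by (simp add: scaleR_diff_right)
      also have "\<dots> = (1 / m) *\<^sub>R (LINT y|lborel. bump r (y - x) *\<^sub>R (f y - f x))"
        by (simp add: scaleR_diff_right)
      finally have "norm (f x - mollify r f x) = (1 / m) * norm (LINT y|lborel. bump r (y - x) *\<^sub>R (f y - f x))"
        using \<open>m > 0\<close> by (subst norm_minus_commute) simp
      then have "ennreal (norm (f x - mollify r f x))
          = ennreal (1 / m) * ennreal (norm (LINT y|lborel. bump r (y - x) *\<^sub>R (f y - f x)))"
        using \<open>m > 0\<close> by (simp flip: ennreal_mult)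
      also have "\<dots> \<le> ennreal (1 / m) * (\<integral>\<^sup>+y. ennreal (norm (bump r (y - x) *\<^sub>R (f y - f x))) \<partial>lborel)"
      proof (intro mult_left_mono integral_norm_bound_ennreal)
        show "integrable lborel (\<lambda>y. bump r (y - x) *\<^sub>R (f y - f x))"
          using Bochner_Integration.integrable_diff[OF i1 i2] by (simp add: scaleR_diff_right)
      qed simp
      also have "(\<integral>\<^sup>+y. ennreal (norm (bump r (y - x) *\<^sub>R (f y - f x))) \<partial>lborel)
          = (\<integral>\<^sup>+z. ennreal (norm (bump r ((x + z) - x) *\<^sub>R (f (x + z) - f x))) \<partial>lborel)"
        by (rule nn_integral_lborel_translate[symmetric]) measurable
      also have "\<dots> = (\<integral>\<^sup>+z. ennreal (bump r z * norm (f (z + x) - f x)) \<partial>lborel)"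
        by (simp add: add.commute bump_nonneg)
      finally show ?thesis .
    qed
    have "(\<integral>\<^sup>+x\<in>cball 0 R. ennreal (norm (f x - mollify r f x)) \<partial>lborel)
        \<le> (\<integral>\<^sup>+x. (\<integral>\<^sup>+z. ennreal (1 / m) * (ennreal (bump r z) * (ennreal (norm (f (z + x) - f x)) * indicator (cball 0 R) x)) \<partial>lborel) \<partial>lborel)"
    proof (rule nn_integral_mono)
      fix x
      show "ennreal (norm (f x - mollify r f x)) * indicator (cball 0 R) x
          \<le> (\<integral>\<^sup>+z. ennreal (1 / m) * (ennreal (bump r z) * (ennreal (norm (f (z + x) - f x)) * indicator (cball 0 R) x)) \<partial>lborel)"
        using pw[of x] by (auto simp: indicator_def nn_integral_cmult ennreal_mult bump_nonneg)
    qed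
    also have "\<dots> = (\<integral>\<^sup>+z. (\<integral>\<^sup>+x. ennreal (1 / m) * (ennreal (bump r z) * (ennreal (norm (f (z + x) - f x)) * indicator (cball 0 R) x)) \<partial>lborel) \<partial>lborel)"
      by (rule lborel_pair.Fubini') measurable
    also have "\<dots> \<le> (\<integral>\<^sup>+z. ennreal (1 / m) * (ennreal (bump r (z::'a)) * ennreal \<epsilon>) \<partial>lborel)"
    proof (rule nn_integral_mono)
      fix z :: 'a
      show "(\<integral>\<^sup>+x. ennreal (1 / m) * (ennreal (bump r z) * (ennreal (norm (f (z + x) - f x)) * indicator (cball 0 R) x)) \<partial>lborel)
          \<le> ennreal (1 / m) * (ennreal (bump r z) * ennreal \<epsilon>)"
      proof (cases "norm z < \<delta>")
        case True
        then show ?thesis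
          using \<delta>[OF True] by (simp add: nn_integral_cmult mult_left_mono)
      next
        case False
        then have "bump r z = 0" using bump_support(1)[OF \<open>r > 0\<close>, of z] supp by simp
        then show ?thesis by simp
      qed
    qed
    also have "\<dots> = ennreal (1 / m) * (ennreal m * ennreal \<epsilon>)"
      by (simp add: nn_integral_cmult nn_integral_multc m)
    also have "\<dots> = ennreal \<epsilon>"
      using \<open>m > 0\<close> \<open>\<epsilon> > 0\<close> by (simp flip: ennreal_mult)
    finally show ?thesis .
  qed
  then show ?thesis
    by (rule eventually_mono[OF eventually_ge_at_top[of "1 / \<delta>\<^sup>2"]])
qed


text \<open>Differentiation under the integral. The remainder quotients \<open>q i\<close> tend to
  zero pointwise, are bounded by twice the Lipschitz constant of the bump and vanish outside one
  ball, so dominated convergence applies with a multiple of \<open>u\<close> on that ball as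
  majorant. The minus sign comes from differentiating in the centre of the bump.\<close>

lemma GDERIV_bump_convolution:
  fixes u :: "'a::euclidean_space \<Rightarrow> real"
  assumes u: "locally_integrable u" and "r > 0"
  shows "GDERIV (\<lambda>x. LINT y|lborel. bump r (y - x) *\<^sub>R u y) x :> - (LINT y|lborel. u y *\<^sub>R bump_grad r (y - x))"
proof -
  have [measurable]: "u \<in> borel_measurable borel"
    using u by (rule locally_integrable_measurable)
  define C where "C = 6 * r * sqrt (1 / r)"
  have "C \<ge> 0" using \<open>r > 0\<close> by (simp add: C_def)
  define v where "v = (\<lambda>x. LINT y|lborel. bump r (y - x) *\<^sub>R u y)"
  define L where "L = (\<lambda>x. LINT y|lborel. u y *\<^sub>R bump_grad r (y - x))"
  have int_L: "integrable lborel (\<lambda>y. u y *\<^sub>R bump_grad r (y - x))"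
  proof (rule integrable_bounded_compact_support[OF u, of "cball x (sqrt (1 / r))" _ C])
    show "norm (u y *\<^sub>R bump_grad r (y - x)) \<le> C * norm (u y)" for y
      using norm_bump_grad_le[OF \<open>r > 0\<close>, of "y - x"] by (simp add: C_def mult.commute mult_left_mono)
    show "u y *\<^sub>R bump_grad r (y - x) = 0" if "y \<notin> cball x (sqrt (1 / r))" for y
      using bump_support(2)[OF \<open>r > 0\<close>, of "y - x"] that by (simp add: dist_norm norm_minus_commute)
  qed auto
  have "((\<lambda>z. norm ((v z - v x) - (z - x) \<bullet> - L x) / norm (z - x)) \<longlongrightarrow> 0) (at x)"
    unfolding tendsto_at_iff_sequentially comp_def
  proof safe
    fix X :: "nat \<Rightarrow> 'a" assume X: "\<forall>i. X i \<in> UNIV - {x}" "X \<longlonglongrightarrow> x"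
    define q where "q = (\<lambda>i y. (bump r (y - X i) - bump r (y - x) + (X i - x) \<bullet> bump_grad r (y - x)) / norm (X i - x))"
    obtain B where B: "\<And>i. norm (X i) \<le> B"
      using convergent_imp_bounded[OF X(2)] unfolding bounded_iff by auto
    have "norm x \<le> B"
      using Lim_bounded[OF tendsto_norm[OF X(2)], of 0 B] B by auto
    define S where "S = cball (0::'a) (B + sqrt (1 / r))"
    have q_bound: "\<bar>q i y\<bar> \<le> 2 * C" for i y
    proof -
      have n: "norm (X i - x) > 0" using X(1) by auto
      have "\<bar>bump r (y - X i) - bump r (y - x)\<bar> \<le> C * norm ((y - X i) - (y - x))"
        unfolding C_def by (rule bump_lipschitz[OF \<open>r > 0\<close>])
      moreover have "norm ((y - X i) - (y - x)) = norm (X i - x)"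
        by (simp add: norm_minus_commute)
      moreover have "\<bar>(X i - x) \<bullet> bump_grad r (y - x)\<bar> \<le> norm (X i - x) * norm (bump_grad r (y - x))"
        by (rule Cauchy_Schwarz_ineq2)
      moreover have "norm (X i - x) * norm (bump_grad r (y - x)) \<le> norm (X i - x) * C"
        unfolding C_def by (intro mult_left_mono norm_bump_grad_le \<open>r > 0\<close>) simp
      ultimately have "\<bar>bump r (y - X i) - bump r (y - x) + (X i - x) \<bullet> bump_grad r (y - x)\<bar> \<le> 2 * C * norm (X i - x)"
        by (simp add: mult.commute)
      then show ?thesis unfolding q_def using n by (simp add: field_simps)
    qed
    have q_supp: "q i y = 0" if "y \<notin> S" for i y
    proof -
      have ny: "norm y > B + sqrt (1 / r)" using that by (simp add: S_def)
      have "sqrt (1 / r) \<le> norm (y - X i)" "sqrt (1 / r) \<le> norm (y - x)"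
        using ny B[of i] \<open>norm x \<le> B\<close> norm_triangle_ineq2[of y "X i"] norm_triangle_ineq2[of y x] by linarith+
      then show ?thesis unfolding q_def by (simp add: bump_support[OF \<open>r > 0\<close>])
    qed
    have q_lim: "(\<lambda>i. q i y) \<longlonglongrightarrow> 0" for y
    proof -
      have "((\<lambda>z. bump r (z - y)) has_derivative (\<lambda>h. h \<bullet> bump_grad r (x - y))) (at x)"
        using GDERIV_bump[of r y x] unfolding gderiv_def .
      then have "((\<lambda>z. norm (bump r (z - y) - bump r (x - y) - (z - x) \<bullet> bump_grad r (x - y)) / norm (z - x)) \<longlongrightarrow> 0) (at x)"
        unfolding has_derivative_iff_norm by blast
      then have "(\<lambda>i. norm (bump r (X i - y) - bump r (x - y) - (X i - x) \<bullet> bump_grad r (x - y)) / norm (X i - x)) \<longlonglongrightarrow> 0"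
        unfolding tendsto_at_iff_sequentially comp_def using X by blast
      then have "(\<lambda>i. \<bar>q i y\<bar>) \<longlonglongrightarrow> 0"
        unfolding q_def by (simp add: bump_minus_commute[of r _ y] bump_grad_minus_commute[of r x y])
      then show ?thesis by (rule tendsto_rabs_zero_cancel)
    qed
    have [measurable]: "q i \<in> borel_measurable borel" for i
      unfolding q_def by measurable
    have eq: "((v (X i) - v x) - (X i - x) \<bullet> - L x) / norm (X i - x) = (LINT y|lborel. q i y * u y)" for i
    proof -
      have i1: "integrable lborel (\<lambda>y. bump r (y - X i) * u y)" "integrable lborel (\<lambda>y. bump r (y - x) * u y)"
        using integrable_bump_mult[OF \<open>r > 0\<close> u] by simp_all
      have i2: "integrable lborel (\<lambda>y. (X i - x) \<bullet> (u y *\<^sub>R bump_grad r (y - x)))"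
        by (rule integrable_inner_right) (rule int_L)
      have "(X i - x) \<bullet> L x = (LINT y|lborel. (X i - x) \<bullet> (u y *\<^sub>R bump_grad r (y - x)))"
        unfolding L_def by (rule integral_inner_right[symmetric]) (rule int_L)
      then have "(v (X i) - v x) - (X i - x) \<bullet> - L x = (LINT y|lborel. bump r (y - X i) * u y - bump r (y - x) * u y
          + (X i - x) \<bullet> (u y *\<^sub>R bump_grad r (y - x)))"
        unfolding v_def using i1 i2 by simp
      then have "((v (X i) - v x) - (X i - x) \<bullet> - L x) / norm (X i - x) = (LINT y|lborel. (bump r (y - X i) * u y - bump r (y - x) * u y
          + (X i - x) \<bullet> (u y *\<^sub>R bump_grad r (y - x))) / norm (X i - x))"
        by simp
      also have "\<dots> = (LINT y|lborel. q i y * u y)"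
      proof (rule Bochner_Integration.integral_cong[OF refl])
        fix y
        have "(a * s - b * s + s * d) / m = (a - b + d) / m * s" for a b d s m :: real
          by (simp add: algebra_simps add_divide_distrib diff_divide_distrib)
        then show "(bump r (y - X i) * u y - bump r (y - x) * u y
            + (X i - x) \<bullet> (u y *\<^sub>R bump_grad r (y - x))) / norm (X i - x) = q i y * u y"
          unfolding q_def inner_scaleR_right by blast
      qed
      finally show ?thesis .
    qed
    have "(\<lambda>i. LINT y|lborel. q i y * u y) \<longlonglongrightarrow> (LINT y::'a|lborel. 0)"
    proof (rule integral_dominated_convergence[where w = "\<lambda>y. 2 * C * \<bar>indicator S y * u y\<bar>"])
      have "integrable lborel (\<lambda>y. indicator S y *\<^sub>R u y)"
        unfolding S_def by (rule locally_integrable_indicator[OF u compact_cball])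
      then show "integrable lborel (\<lambda>y. 2 * C * \<bar>indicator S y * u y\<bar>)"
        by simp
      show "AE y in lborel. (\<lambda>i. q i y * u y) \<longlonglongrightarrow> 0"
        by (intro AE_I2 tendsto_mult_left_zero q_lim)
      show "AE y in lborel. norm (q i y * u y) \<le> 2 * C * \<bar>indicator S y * u y\<bar>" for i
      proof (rule AE_I2)
        fix y
        show "norm (q i y * u y) \<le> 2 * C * \<bar>indicator S y * u y\<bar>"
        proof (cases "y \<in> S")
          case True
          then show ?thesis using mult_right_mono[OF q_bound[of i y], of "\<bar>u y\<bar>"] by (simp add: abs_mult)
        qed (simp add: q_supp)
      qed
    qed auto
    then have "(\<lambda>i. ((v (X i) - v x) - (X i - x) \<bullet> - L x) / norm (X i - x)) \<longlonglongrightarrow> 0"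
      unfolding eq by simp
    from tendsto_norm_zero[OF this]
    show "(\<lambda>i. norm ((v (X i) - v x) - (X i - x) \<bullet> - L x) / norm (X i - x)) \<longlonglongrightarrow> 0"
      by (simp only: real_norm_def abs_divide abs_norm_cancel)
  qed
  then have "(v has_derivative (\<lambda>h. h \<bullet> - L x)) (at x)"
    unfolding has_derivative_iff_norm using bounded_linear_inner_left by blast
  then show ?thesis
    unfolding gderiv_def v_def L_def .
qed

lemma continuous_on_bump_convolution:
  fixes f :: "'a::euclidean_space \<Rightarrow> 'b::euclidean_space"
  assumes f: "locally_integrable f" and "r > 0"
  shows "continuous_on UNIV (\<lambda>x. LINT y|lborel. bump r (y - x) *\<^sub>R f y)"
proof -
  have [measurable]: "f \<in> borel_measurable borel"
    using f by (rule locally_integrable_measurable)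
  have "(\<lambda>i. LINT y|lborel. bump r (y - X i) *\<^sub>R f y) \<longlonglongrightarrow> (LINT y|lborel. bump r (y - x) *\<^sub>R f y)"
    if X: "X \<longlonglongrightarrow> x" for X :: "nat \<Rightarrow> 'a" and x
  proof -
    obtain B where B: "\<And>i. norm (X i) \<le> B"
      using convergent_imp_bounded[OF X] unfolding bounded_iff by auto
    define S where "S = cball (0::'a) (B + sqrt (1 / r))"
    show ?thesis
    proof (rule integral_dominated_convergence[where w = "\<lambda>y. norm (indicator S y *\<^sub>R f y)"])
      have "integrable lborel (\<lambda>y. indicator S y *\<^sub>R f y)"
        unfolding S_def by (rule locally_integrable_indicator[OF f compact_cball])
      then show "integrable lborel (\<lambda>y. norm (indicator S y *\<^sub>R f y))"
        by (rule integrable_norm)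
      have "isCont (bump r) (y - x)" for y
        using continuous_on_bump continuous_on_eq_continuous_at by blast
      then have "(\<lambda>i. bump r (y - X i)) \<longlonglongrightarrow> bump r (y - x)" for y
        by (rule isCont_tendsto_compose) (intro tendsto_intros X)
      then show "AE y in lborel. (\<lambda>i. bump r (y - X i) *\<^sub>R f y) \<longlonglongrightarrow> bump r (y - x) *\<^sub>R f y"
        by (intro AE_I2 tendsto_intros)
      show "AE y in lborel. norm (bump r (y - X i) *\<^sub>R f y) \<le> norm (indicator S y *\<^sub>R f y)" for i
      proof (rule AE_I2)
        fix y
        show "norm (bump r (y - X i) *\<^sub>R f y) \<le> norm (indicator S y *\<^sub>R f y)"
        proof (cases "y \<in> S")
          case True
          then show ?thesis
            using bump_le_1[of r "y - X i"] bump_nonneg[of r "y - X i"] \<open>r > 0\<close>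
            by (simp add: mult_left_le_one_le)
        next
          case False
          then have "sqrt (1 / r) \<le> norm (y - X i)"
            using B[of i] norm_triangle_ineq2[of y "X i"] by (simp add: S_def)
          then show ?thesis by (simp add: bump_support(1)[OF \<open>r > 0\<close>])
        qed
      qed
    qed measurable
  qed
  then show ?thesis
    unfolding continuous_on_sequentially comp_def by blast
qed

text \<open>Mollification commutes with the weak gradient: the derivative falls on the bump, and
  testing \<open>weak_gradient\<close> with this bump turns the result into the mollification of
  \<open>g\<close>. One \<open>r\<close> serves both errors.\<close>

lemma weak_gradient_C1_approx:
  fixes u :: "'a::euclidean_space \<Rightarrow> real"
  assumes ug: "weak_gradient u g" and "\<epsilon> > 0"
  shows "\<exists>v G. (\<forall>x. GDERIV v x :> G x) \<and> continuous_on UNIV G \<and>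
    (\<integral>\<^sup>+x\<in>cball 0 R. ennreal (norm (u x - v x)) \<partial>lborel) \<le> ennreal \<epsilon> \<and>
    (\<integral>\<^sup>+x\<in>cball 0 R. ennreal (norm (g x - G x)) \<partial>lborel) \<le> ennreal \<epsilon>"
proof -
  have u: "locally_integrable u" and g: "locally_integrable g"
    and weak: "\<And>\<phi>. test_function \<phi> \<Longrightarrow>
        (LINT x|lborel. u x *\<^sub>R grad \<phi> x) = - (LINT x|lborel. \<phi> x *\<^sub>R g x)"
    using ug unfolding weak_gradient_def by auto
  obtain r where r: "r > 0"
      "(\<integral>\<^sup>+x\<in>cball 0 R. ennreal (norm (u x - mollify r u x)) \<partial>lborel) \<le> ennreal \<epsilon>"
      "(\<integral>\<^sup>+x\<in>cball 0 R. ennreal (norm (g x - mollify r g x)) \<partial>lborel) \<le> ennreal \<epsilon>"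
    using eventually_happens[OF eventually_conj[OF eventually_gt_at_top[of 0]
        eventually_conj[OF mollify_L1[OF u \<open>\<epsilon> > 0\<close>, of R] mollify_L1[OF g \<open>\<epsilon> > 0\<close>, of R]]]]
    by auto
  have "GDERIV (mollify r u) x :> mollify r g x" for x
  proof -
    have "grad (\<lambda>y. bump r (y - x)) = (\<lambda>y. bump_grad r (y - x))"
      using grad_eqI[OF GDERIV_bump] by blast
    then have "- (LINT y|lborel. u y *\<^sub>R bump_grad r (y - x)) = (LINT y|lborel. bump r (y - x) *\<^sub>R g y)"
      using weak[OF test_function_bump[OF r(1), of x]] by simp
    then have D: "GDERIV (\<lambda>x. LINT y|lborel. bump r (y - x) *\<^sub>R u y) x :> (LINT y|lborel. bump r (y - x) *\<^sub>R g y)"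
      using GDERIV_bump_convolution[OF u r(1), of x] by simp
    then have "((\<lambda>x. (1 / bump_mass TYPE('a) r) *\<^sub>R (LINT y|lborel. bump r (y - x) *\<^sub>R u y)) has_derivative
        (\<lambda>h. (1 / bump_mass TYPE('a) r) *\<^sub>R (h \<bullet> (LINT y|lborel. bump r (y - x) *\<^sub>R g y)))) (at x)"
      unfolding gderiv_def by (rule has_derivative_scaleR_right)
    then show ?thesis
      unfolding gderiv_def mollify_def by simp
  qed
  moreover have "continuous_on UNIV (mollify r g)"
    unfolding mollify_def by (intro continuous_on_scaleR continuous_on_const continuous_on_bump_convolution g r(1))
  ultimately show ?thesis using r(2,3) by blast
qed

subsection \<open>The chain rule along segments\<close>

text \<open>Geometric bounds make the sum of the \<open>h j\<close> integrable, hence finite almost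
  everywhere, so its terms tend to zero. Convergence almost everywhere is thus obtained without
  passing to a subsequence.\<close>

lemma AE_tendsto_0_if_summable_integral:
  fixes h :: "nat \<Rightarrow> 'w \<Rightarrow> ennreal"
  assumes [measurable]: "\<And>j. h j \<in> borel_measurable M"
    and bound: "\<And>j. (\<integral>\<^sup>+x. h j x \<partial>M) \<le> ennreal (C * (1 / 2) ^ j)" and "C \<ge> 0"
  shows "AE x in M. (\<lambda>j. h j x) \<longlonglongrightarrow> 0"
proof -
  have "(\<integral>\<^sup>+x. (\<Sum>j. h j x) \<partial>M) = (\<Sum>j. \<integral>\<^sup>+x. h j x \<partial>M)"
    by (rule nn_integral_suminf) simp
  also have "\<dots> \<le> (\<Sum>j. ennreal (C * (1 / 2) ^ j))"
    using bound by (rule suminf_le) auto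
  also have "\<dots> < \<infinity>"
  proof -
    have "summable (\<lambda>j. C * (1 / 2 :: real) ^ j)"
      by (intro summable_mult summable_geometric) simp
    then show ?thesis
      using \<open>C \<ge> 0\<close> by (subst suminf_ennreal2) auto
  qed
  finally have "(\<integral>\<^sup>+x. (\<Sum>j. h j x) \<partial>M) \<noteq> \<infinity>" by simp
  then have "AE x in M. (\<Sum>j. h j x) \<noteq> \<infinity>"
    by (intro nn_integral_PInf_AE) auto
  then show ?thesis
  proof eventually_elim
    case (elim x)
    define c where "c = (\<lambda>j. enn2real (h j x))"
    have "h j x \<noteq> top" for j
    proof
      assume "h j x = top"
      then have "top \<le> (\<Sum>j. h j x)"
        using sum_le_suminf[of "\<lambda>j. h j x" "{j}"] by simp
      then show False using elim by (simp add: top_unique)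
    qed
    then have h: "h j x = ennreal (c j)" for j
      unfolding c_def by (simp add: less_top)
    have "summable c"
      using elim unfolding h by (intro summable_suminf_not_top) (auto simp: c_def)
    then have "(\<lambda>j. ennreal (c j)) \<longlonglongrightarrow> ennreal 0"
      by (intro tendsto_ennrealI summable_LIMSEQ_zero)
    then show ?case unfolding h by simp
  qed
qed

text \<open>Jensen's inequality from the nonnegativity of a variance; if the square is not
  integrable, the right side is infinite.\<close>

lemma (in finite_measure) square_integral_le_nn_integral_square:
  fixes h :: "'a \<Rightarrow> real"
  assumes h: "integrable M h" and M: "measure M (space M) = 1"
  shows "ennreal ((LINT x|M. h x)\<^sup>2) \<le> (\<integral>\<^sup>+x. ennreal ((h x)\<^sup>2) \<partial>M)"
proof (cases "integrable M (\<lambda>x. (h x)\<^sup>2)")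
  case True
  define m where "m = (LINT x|M. h x)"
  have "0 \<le> (LINT x|M. (h x - m)\<^sup>2)" by simp
  also have "\<dots> = (LINT x|M. (h x)\<^sup>2 - 2 * m * h x + m\<^sup>2)"
    by (simp add: power2_diff algebra_simps)
  also have "\<dots> = (LINT x|M. (h x)\<^sup>2) - 2 * m * m + m\<^sup>2"
    using True h by (simp add: m_def M)
  finally have "m\<^sup>2 \<le> (LINT x|M. (h x)\<^sup>2)" by (simp add: power2_eq_square)
  then show ?thesis
    using True by (simp add: nn_integral_eq_integral m_def)
next
  case False
  have [measurable]: "h \<in> borel_measurable M" using h by simp
  have "(\<integral>\<^sup>+x. ennreal ((h x)\<^sup>2) \<partial>M) = \<infinity>"
  proof (rule ccontr)
    assume "(\<integral>\<^sup>+x. ennreal ((h x)\<^sup>2) \<partial>M) \<noteq> \<infinity>"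
    then have "integrable M (\<lambda>x. (h x)\<^sup>2)"
      by (intro integrableI_bounded) (auto simp: less_top)
    then show False using False by simp
  qed
  then show ?thesis by simp
qed

lemma unit_interval_measure:
  shows "finite_measure (restrict_space lborel {0..1::real})"
    and "measure (restrict_space lborel {0..1::real}) (space (restrict_space lborel {0..1})) = 1"
  by (auto intro!: finite_measureI simp: measure_def emeasure_restrict_space space_restrict_space)

text \<open>\<open>F'\<close> may be unbounded: the start values converge and the derivatives
  \<open>ks j\<close> are bounded in \<open>L^1\<close>, so all curves stay in one interval from
  \<open>- B\<close> to \<open>B\<close>, where \<open>F'\<close> is bounded. There the fundamental
  theorem of calculus passes to the limit, and Jensen's inequality gives the square. The end values
  \<open>a\<close> and \<open>b\<close> are prescribed separately because \<open>\<gamma>\<close> is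
  a limit only almost everywhere.\<close>

lemma limit_chain_rule_bound:
  fixes \<gamma>s ks :: "nat \<Rightarrow> real \<Rightarrow> real" and \<gamma> k F F' :: "real \<Rightarrow> real"
  defines "L \<equiv> restrict_space lborel {0..1}"
  assumes deriv: "\<And>j s. (\<gamma>s j has_real_derivative ks j s) (at s)"
    and cont: "\<And>j. continuous_on UNIV (ks j)"
    and F: "\<And>t. (F has_real_derivative F' t) (at t)" "continuous_on UNIV F'"
    and ends: "(\<lambda>j. \<gamma>s j 0) \<longlonglongrightarrow> a" "(\<lambda>j. \<gamma>s j 1) \<longlonglongrightarrow> b"
    and [measurable]: "\<gamma> \<in> borel_measurable borel" "k \<in> borel_measurable borel"
    and lim: "AE s in L. (\<lambda>j. \<gamma>s j s) \<longlonglongrightarrow> \<gamma> s"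
    and k: "(\<integral>\<^sup>+s. ennreal \<bar>k s\<bar> \<partial>L) < \<infinity>"
    and klim: "(\<lambda>j. \<integral>\<^sup>+s. ennreal \<bar>k s - ks j s\<bar> \<partial>L) \<longlonglongrightarrow> 0"
  shows "ennreal ((F b - F a)\<^sup>2) \<le> (\<integral>\<^sup>+s. ennreal ((F' (\<gamma> s) * k s)\<^sup>2) \<partial>L)"
proof -
  interpret L: finite_measure L unfolding L_def by (rule unit_interval_measure)
  have L1: "measure L (space L) = 1" unfolding L_def by (rule unit_interval_measure)
  have L_meas: "f \<in> borel_measurable L" if "f \<in> borel_measurable borel" for f :: "real \<Rightarrow> real"
    unfolding L_def using that by (intro measurable_restrict_space1) simp
  have L_int: "(LINT s|L. f s) = (LINT s|lborel. indicator {0..1} s *\<^sub>R f s)" for f :: "real \<Rightarrow> real"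
    unfolding L_def by (subst integral_restrict_space) auto
  have ks_meas[measurable]: "ks j \<in> borel_measurable borel" for j
    using cont by (rule borel_measurable_continuous_onI)
  have F'_meas[measurable]: "F' \<in> borel_measurable borel"
    using F(2) by (rule borel_measurable_continuous_onI)
  have \<gamma>s_cont: "continuous_on UNIV (\<gamma>s j)" for j
    using deriv by (meson DERIV_isCont continuous_at_imp_continuous_on)
  have \<gamma>s_meas[measurable]: "\<gamma>s j \<in> borel_measurable borel" for j
    using \<gamma>s_cont by (rule borel_measurable_continuous_onI)
  have k_int: "integrable L k"
    using k by (intro integrableI_bounded L_meas) auto
  have cont_int: "integrable L f" if "continuous_on UNIV f" for f :: "real \<Rightarrow> real"
    unfolding L_def using borel_integrable_compact[of "{0..1}" f] continuous_on_subset[OF that]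
    by (subst integrable_restrict_space) auto
  have FTC: "(LINT s|L. indicator {0..t} s * f s) = H t - H 0"
    if "0 \<le> t" "t \<le> 1" "\<And>s. (H has_real_derivative f s) (at s)" "continuous_on UNIV f" for H f :: "real \<Rightarrow> real" and t
  proof -
    have "(LINT s|L. indicator {0..t} s * f s) = (LINT s|lborel. f s * indicator {0..t} s)"
      unfolding L_int by (rule Bochner_Integration.integral_cong) (use that(1,2) in \<open>auto simp: indicator_def\<close>)
    also have "\<dots> = H t - H 0"
    proof (rule integral_FTC_Icc_real[OF that(1)])
      show "DERIV H s :> f s" "isCont f s" for s
        using that(3) continuous_on_interior[OF that(4)] by auto
    qed
    finally show ?thesis .
  qed
  define d where "d = (\<lambda>j. LINT s|L. \<bar>k s - ks j s\<bar>)"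
  have kd_int: "integrable L (\<lambda>s. \<bar>k s - ks j s\<bar>)" for j
    using k_int cont_int[OF cont] by simp
  have d_eq: "(\<integral>\<^sup>+s. ennreal \<bar>k s - ks j s\<bar> \<partial>L) = ennreal (d j)" for j
    unfolding d_def using kd_int by (intro nn_integral_eq_integral) auto
  have "(\<lambda>j. enn2real (ennreal (d j))) \<longlonglongrightarrow> enn2real 0"
    using klim unfolding d_eq by (intro tendsto_enn2real) auto
  then have d_lim: "d \<longlonglongrightarrow> 0"
    by (simp add: d_def)
  obtain D where D: "\<And>j. d j \<le> D"
    using convergent_imp_Bseq[OF convergentI[OF d_lim]] unfolding Bseq_def by (metis abs_le_iff real_norm_def)
  obtain A where A: "\<And>j. \<bar>\<gamma>s j 0\<bar> \<le> A"
    using convergent_imp_Bseq[OF convergentI[OF ends(1)]] unfolding Bseq_def by (metis real_norm_def)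
  define B where "B = A + (LINT s|L. \<bar>k s\<bar>) + D"
  have \<gamma>s_bound: "\<bar>\<gamma>s j t\<bar> \<le> B" if t: "0 \<le> t" "t \<le> 1" for j t
  proof -
    have "\<bar>\<gamma>s j t - \<gamma>s j 0\<bar> = \<bar>LINT s|L. indicator {0..t} s * ks j s\<bar>"
      using FTC[OF t deriv cont] by simp
    also have "\<dots> \<le> (LINT s|L. \<bar>indicator {0..t} s * ks j s\<bar>)"
      by (rule integral_abs_bound)
    also have "\<dots> \<le> (LINT s|L. \<bar>k s\<bar> + \<bar>k s - ks j s\<bar>)"
    proof (rule integral_mono_AE')
      show "integrable L (\<lambda>s. \<bar>k s\<bar> + \<bar>k s - ks j s\<bar>)"
        using k_int kd_int by simp
    qed (auto simp: indicator_def)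
    also have "\<dots> = (LINT s|L. \<bar>k s\<bar>) + d j"
      unfolding d_def using k_int kd_int by simp
    finally show ?thesis using A[of j] D[of j] unfolding B_def by linarith
  qed
  have "compact (F' ` {-B..B})"
    by (intro compact_continuous_image continuous_on_subset[OF F(2)]) auto
  then obtain K where K: "\<And>t. \<bar>t\<bar> \<le> B \<Longrightarrow> \<bar>F' t\<bar> \<le> K"
  proof -
    from compact_imp_bounded[OF \<open>compact (F' ` {-B..B})\<close>]
    obtain K where "\<forall>y\<in>F' ` {-B..B}. norm y \<le> K" unfolding bounded_iff by blast
    then have "\<bar>F' t\<bar> \<le> K" if "\<bar>t\<bar> \<le> B" for t using that by (auto simp: abs_le_iff)
    then show thesis by (rule that)
  qed
  have K_\<gamma>s: "\<bar>F' (\<gamma>s j s)\<bar> \<le> K" if "s \<in> space L" for j s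
    using that by (intro K \<gamma>s_bound) (auto simp: L_def space_restrict_space)
  have "K \<ge> 0"
    using K[OF \<gamma>s_bound[of 0 0]] by simp
  have comp_lim: "AE s in L. (\<lambda>j. F' (\<gamma>s j s) * k s) \<longlonglongrightarrow> F' (\<gamma> s) * k s"
    using lim
  proof eventually_elim
    case (elim s)
    have "isCont F' (\<gamma> s)" using F(2) continuous_on_eq_continuous_at by blast
    from isCont_tendsto_compose[OF this elim] show ?case by (rule tendsto_mult_right)
  qed
  have bnd1: "AE s in L. norm (F' (\<gamma>s j s) * k s) \<le> K * \<bar>k s\<bar>" for j
  proof (rule AE_I2)
    fix s assume "s \<in> space L"
    then show "norm (F' (\<gamma>s j s) * k s) \<le> K * \<bar>k s\<bar>"
      using mult_right_mono[OF K_\<gamma>s, of s "\<bar>k s\<bar>" j] by (simp add: abs_mult)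
  qed
  have Kk_int: "integrable L (\<lambda>s. K * \<bar>k s\<bar>)" using k_int by simp
  have m1: "(\<lambda>s. F' (\<gamma> s) * k s) \<in> borel_measurable L" by (rule L_meas) measurable
  have m2: "(\<lambda>s. F' (\<gamma>s j s) * k s) \<in> borel_measurable L" for j by (rule L_meas) measurable
  note dct = m1 m2 Kk_int comp_lim bnd1
  have int_lim: "integrable L (\<lambda>s. F' (\<gamma> s) * k s)"
    by (rule integrable_dominated_convergence[OF dct])
  have int_j: "integrable L (\<lambda>s. F' (\<gamma>s j s) * k s)" for j
    by (rule integrable_dominated_convergence2[OF dct])
  have lim1: "(\<lambda>j. LINT s|L. F' (\<gamma>s j s) * k s) \<longlonglongrightarrow> (LINT s|L. F' (\<gamma> s) * k s)"
    by (rule integral_dominated_convergence[OF dct])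
  have cont_F': "continuous_on UNIV (\<lambda>s. F' (\<gamma>s j s) * ks j s)" for j
    by (intro continuous_on_mult cont continuous_on_compose2[OF F(2) \<gamma>s_cont]) auto
  have eq: "F (\<gamma>s j 1) - F (\<gamma>s j 0) = (LINT s|L. F' (\<gamma>s j s) * ks j s)" for j
  proof -
    have "((\<lambda>s. F (\<gamma>s j s)) has_real_derivative F' (\<gamma>s j s) * ks j s) (at s)" for s
      using DERIV_chain2[OF F(1) deriv] .
    from FTC[OF _ _ this cont_F', of 1]
    have "(LINT s|L. indicator {0..1} s * (F' (\<gamma>s j s) * ks j s)) = F (\<gamma>s j 1) - F (\<gamma>s j 0)" by simp
    moreover have "(LINT s|L. indicator {0..1} s * (F' (\<gamma>s j s) * ks j s)) = (LINT s|L. F' (\<gamma>s j s) * ks j s)"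
      by (rule Bochner_Integration.integral_cong) (auto simp: L_def space_restrict_space)
    ultimately show ?thesis by simp
  qed
  \<comment> \<open>Replacing \<open>ks j\<close> by \<open>k\<close> costs at most \<open>K\<close>
    times the \<open>L^1\<close> error; after that the integrands have the fixed majorant
    \<open>K * \<bar>k s\<bar>\<close>.\<close>
  have diff: "\<bar>(F (\<gamma>s j 1) - F (\<gamma>s j 0)) - (LINT s|L. F' (\<gamma>s j s) * k s)\<bar> \<le> K * d j" for j
  proof -
    have "(F (\<gamma>s j 1) - F (\<gamma>s j 0)) - (LINT s|L. F' (\<gamma>s j s) * k s)
        = (LINT s|L. F' (\<gamma>s j s) * ks j s - F' (\<gamma>s j s) * k s)"
      unfolding eq using cont_int[OF cont_F'] int_j by simp
    also have "\<bar>\<dots>\<bar> \<le> (LINT s|L. \<bar>F' (\<gamma>s j s) * ks j s - F' (\<gamma>s j s) * k s\<bar>)"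
      by (rule integral_abs_bound)
    also have "\<dots> \<le> (LINT s|L. K * \<bar>k s - ks j s\<bar>)"
    proof (rule integral_mono_AE')
      show "integrable L (\<lambda>s. K * \<bar>k s - ks j s\<bar>)" using kd_int by simp
      show "AE s in L. \<bar>F' (\<gamma>s j s) * ks j s - F' (\<gamma>s j s) * k s\<bar> \<le> K * \<bar>k s - ks j s\<bar>"
      proof (rule AE_I2)
        fix s assume s: "s \<in> space L"
        have "\<bar>F' (\<gamma>s j s) * ks j s - F' (\<gamma>s j s) * k s\<bar> = \<bar>F' (\<gamma>s j s)\<bar> * \<bar>k s - ks j s\<bar>"
          by (subst abs_minus_commute) (simp flip: abs_mult right_diff_distrib)
        also have "\<dots> \<le> K * \<bar>k s - ks j s\<bar>"
          by (intro mult_right_mono K_\<gamma>s s) simp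
        finally show "\<bar>F' (\<gamma>s j s) * ks j s - F' (\<gamma>s j s) * k s\<bar> \<le> K * \<bar>k s - ks j s\<bar>" .
      qed
    qed (use \<open>K \<ge> 0\<close> in simp)
    finally show ?thesis by (simp add: d_def)
  qed
  have "(\<lambda>j. (F (\<gamma>s j 1) - F (\<gamma>s j 0)) - (LINT s|L. F' (\<gamma>s j s) * k s)) \<longlonglongrightarrow> 0"
  proof (rule Lim_null_comparison)
    show "\<forall>\<^sub>F j in sequentially. norm ((F (\<gamma>s j 1) - F (\<gamma>s j 0)) - (LINT s|L. F' (\<gamma>s j s) * k s)) \<le> K * d j"
      using diff by (intro always_eventually) auto
    show "(\<lambda>j. K * d j) \<longlonglongrightarrow> 0"
      using tendsto_mult_left[OF d_lim, of K] by simp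
  qed
  moreover have "(\<lambda>j. (F (\<gamma>s j 1) - F (\<gamma>s j 0)) - (LINT s|L. F' (\<gamma>s j s) * k s))
      \<longlonglongrightarrow> (F b - F a) - (LINT s|L. F' (\<gamma> s) * k s)"
    by (intro tendsto_diff lim1 isCont_tendsto_compose[OF DERIV_isCont[OF F(1)]] ends)
  ultimately have "(F b - F a) - (LINT s|L. F' (\<gamma> s) * k s) = 0"
    using LIMSEQ_unique by blast
  then have "F b - F a = (LINT s|L. F' (\<gamma> s) * k s)" by simp
  then show ?thesis
    using L.square_integral_le_nn_integral_square[OF int_lim L1] by simp
qed

text \<open>The points \<open>\<omega>\<close> label the segments from \<open>P \<omega>\<close> to
  \<open>P \<omega> + Q \<omega>\<close>. By \<open>push\<close>, at each time \<open>s\<close> the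
  points on the segments are distributed with density at most \<open>C\<close> on one ball. So an
  \<open>L^1\<close> error on the ball controls the error on the segments, and almost every segment
  avoids exceptional null sets for almost every \<open>s\<close>.\<close>

lemma weak_gradient_path_bound:
  fixes u :: "'a::euclidean_space \<Rightarrow> real" and P Q :: "'w \<Rightarrow> 'a"
  defines "L \<equiv> restrict_space lborel {0..1::real}"
  assumes ug: "weak_gradient u g" and M: "sigma_finite_measure M"
    and [measurable]: "P \<in> borel_measurable M" "Q \<in> borel_measurable M"
    and "C \<ge> 0"
    and push: "\<And>s \<phi>. 0 \<le> s \<Longrightarrow> s \<le> 1 \<Longrightarrow> \<phi> \<in> borel_measurable borel \<Longrightarrow>
      (\<integral>\<^sup>+\<omega>. \<phi> (P \<omega> + s *\<^sub>R Q \<omega>) \<partial>M) \<le> ennreal C * (\<integral>\<^sup>+x\<in>cball 0 R. \<phi> x \<partial>lborel)"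
    and F: "\<And>t. (F has_real_derivative F' t) (at t)" "continuous_on UNIV F'"
  shows "AE \<omega> in M. ennreal ((F (u (P \<omega> + Q \<omega>)) - F (u (P \<omega>)))\<^sup>2)
    \<le> (\<integral>\<^sup>+s. ennreal ((F' (u (P \<omega> + s *\<^sub>R Q \<omega>)))\<^sup>2 * (norm (g (P \<omega> + s *\<^sub>R Q \<omega>)))\<^sup>2 * (norm (Q \<omega>))\<^sup>2) \<partial>L)"
proof -
  interpret M: sigma_finite_measure M by (rule M)
  interpret L: finite_measure L unfolding L_def by (rule unit_interval_measure)
  interpret PL: pair_sigma_finite M L ..
  have L_space: "space L = {0..1}" unfolding L_def by (simp add: space_restrict_space)
  have L1: "emeasure L (space L) = 1"
    unfolding L_def by (simp add: emeasure_restrict_space space_restrict_space)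
  have id_L: "(\<lambda>s. s) \<in> borel_measurable L"
    unfolding L_def by (intro measurable_restrict_space1) simp
  have "locally_integrable u" and g: "locally_integrable g"
    using ug unfolding weak_gradient_def by auto
  then have [measurable]: "u \<in> borel_measurable borel" "g \<in> borel_measurable borel"
    by (auto intro: locally_integrable_measurable)
  \<comment> \<open>The errors \<open>(1 / 2) ^ j\<close> are summable, which makes the whole
    sequence converge on almost every segment.\<close>
  define approx where "approx = (\<lambda>(j::nat) v G. (\<forall>x. GDERIV v x :> G x) \<and> continuous_on UNIV G \<and>
    (\<integral>\<^sup>+x\<in>cball 0 R. ennreal (norm (u x - v x)) \<partial>lborel) \<le> ennreal ((1 / 2) ^ j) \<and>
    (\<integral>\<^sup>+x\<in>cball 0 R. ennreal (norm (g x - G x)) \<partial>lborel) \<le> ennreal ((1 / 2) ^ j))"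
  have "\<forall>j. \<exists>v G. approx j v G"
    unfolding approx_def using weak_gradient_C1_approx[OF ug] by simp
  from choice[OF this] obtain v where "\<forall>j. \<exists>G. approx j (v j) G" ..
  from choice[OF this] obtain G where vG_approx: "\<forall>j. approx j (v j) (G j)" ..
  have vG: "\<And>j x. GDERIV (v j) x :> G j x" "\<And>j. continuous_on UNIV (G j)"
    and u_err: "\<And>j. (\<integral>\<^sup>+x\<in>cball 0 R. ennreal (norm (u x - v j x)) \<partial>lborel) \<le> ennreal ((1 / 2) ^ j)"
    and g_err: "\<And>j. (\<integral>\<^sup>+x\<in>cball 0 R. ennreal (norm (g x - G j x)) \<partial>lborel) \<le> ennreal ((1 / 2) ^ j)"
    using vG_approx unfolding approx_def by auto
  have G_meas[measurable]: "G j \<in> borel_measurable borel" for j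
    using vG(2) by (rule borel_measurable_continuous_onI)
  have "continuous_on UNIV (v j)" for j
    using vG(1) unfolding gderiv_def by (meson continuous_at_imp_continuous_on has_derivative_continuous)
  then have v_meas[measurable]: "v j \<in> borel_measurable borel" for j
    by (rule borel_measurable_continuous_onI)
  define Z where "Z = (\<lambda>\<omega> s. P \<omega> + s *\<^sub>R Q \<omega>)"
  have Z_pair[measurable]: "(\<lambda>z. Z (fst z) (snd z)) \<in> borel_measurable (M \<Otimes>\<^sub>M L)"
  proof -
    have [measurable]: "snd \<in> borel_measurable (M \<Otimes>\<^sub>M L)"
      by (rule measurable_compose[OF measurable_snd id_L])
    show ?thesis unfolding Z_def by measurable
  qed
  have Z_fst[measurable]: "(\<lambda>\<omega>. Z \<omega> s) \<in> borel_measurable M" for s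
    unfolding Z_def by measurable
  have Z_borel[measurable]: "Z \<omega> \<in> borel_measurable borel" for \<omega>
    unfolding Z_def by measurable
  have Z_L[measurable]: "Z \<omega> \<in> borel_measurable L" for \<omega>
    using measurable_compose[OF id_L Z_borel] by simp
  have push': "(\<integral>\<^sup>+\<omega>. \<phi> (Z \<omega> s) \<partial>M) \<le> ennreal (C * b)"
    if "\<phi> \<in> borel_measurable borel" "(\<integral>\<^sup>+x\<in>cball 0 R. \<phi> x \<partial>lborel) \<le> ennreal b" "s \<in> space L" "b \<ge> 0"
    for \<phi> :: "'a \<Rightarrow> ennreal" and s b
  proof -
    have "(\<integral>\<^sup>+\<omega>. \<phi> (Z \<omega> s) \<partial>M) \<le> ennreal C * (\<integral>\<^sup>+x\<in>cball 0 R. \<phi> x \<partial>lborel)"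
      unfolding Z_def using that by (intro push) (auto simp: L_space)
    also have "\<dots> \<le> ennreal C * ennreal b" using that by (intro mult_left_mono) auto
    finally show ?thesis using \<open>C \<ge> 0\<close> that by (simp add: ennreal_mult)
  qed
  have push_pair: "(\<integral>\<^sup>+s. (\<integral>\<^sup>+\<omega>. \<phi> (Z \<omega> s) \<partial>M) \<partial>L) \<le> ennreal (C * b)"
    if "\<phi> \<in> borel_measurable borel" "(\<integral>\<^sup>+x\<in>cball 0 R. \<phi> x \<partial>lborel) \<le> ennreal b" "b \<ge> 0"
    for \<phi> :: "'a \<Rightarrow> ennreal" and b
  proof -
    have "(\<integral>\<^sup>+s. (\<integral>\<^sup>+\<omega>. \<phi> (Z \<omega> s) \<partial>M) \<partial>L) \<le> (\<integral>\<^sup>+s. ennreal (C * b) \<partial>L)"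
      using that by (intro nn_integral_mono push') auto
    then show ?thesis by (simp add: L1)
  qed
  have swap: "(\<integral>\<^sup>+\<omega>. (\<integral>\<^sup>+s. \<phi> (Z \<omega> s) \<partial>L) \<partial>M) = (\<integral>\<^sup>+s. (\<integral>\<^sup>+\<omega>. \<phi> (Z \<omega> s) \<partial>M) \<partial>L)"
    if [measurable]: "\<phi> \<in> borel_measurable borel" for \<phi> :: "'a \<Rightarrow> ennreal"
  proof (rule PL.Fubini'[symmetric])
    have "(\<lambda>z. \<phi> (Z (fst z) (snd z))) \<in> borel_measurable (M \<Otimes>\<^sub>M L)" by measurable
    then show "(\<lambda>(\<omega>, s). \<phi> (Z \<omega> s)) \<in> borel_measurable (M \<Otimes>\<^sub>M L)" by (simp add: split_beta')
  qed
  \<comment> \<open>Convergence at a fixed time, for use at the end points 0 and 1; these form a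
    null set of times, which the joint statement that follows cannot see.\<close>
  have A: "AE \<omega> in M. (\<lambda>j. ennreal (norm (u (Z \<omega> s) - v j (Z \<omega> s)))) \<longlonglongrightarrow> 0" if "s \<in> space L" for s
    using push'[OF _ u_err that] \<open>C \<ge> 0\<close>
    by (intro AE_tendsto_0_if_summable_integral[where C = C]) auto
  have "AE z in M \<Otimes>\<^sub>M L. (\<lambda>j. ennreal (norm (u (Z (fst z) (snd z)) - v j (Z (fst z) (snd z))))) \<longlonglongrightarrow> 0"
  proof (rule AE_tendsto_0_if_summable_integral[where C = C])
    fix j
    have "(\<integral>\<^sup>+z. ennreal (norm (u (Z (fst z) (snd z)) - v j (Z (fst z) (snd z)))) \<partial>(M \<Otimes>\<^sub>M L))
        = (\<integral>\<^sup>+s. (\<integral>\<^sup>+\<omega>. ennreal (norm (u (Z \<omega> s) - v j (Z \<omega> s))) \<partial>M) \<partial>L)"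
      by (subst PL.nn_integral_snd[symmetric]) auto
    also have "\<dots> \<le> ennreal (C * (1 / 2) ^ j)"
      by (rule push_pair[OF _ u_err]) auto
    finally show "(\<integral>\<^sup>+z. ennreal (norm (u (Z (fst z) (snd z)) - v j (Z (fst z) (snd z)))) \<partial>(M \<Otimes>\<^sub>M L))
        \<le> ennreal (C * (1 / 2) ^ j)" .
  qed (use \<open>C \<ge> 0\<close> in auto)
  then have A3: "AE \<omega> in M. AE s in L. (\<lambda>j. ennreal (norm (u (Z \<omega> s) - v j (Z \<omega> s)))) \<longlonglongrightarrow> 0"
    by (auto dest!: PL.AE_pair)
  have A4: "AE \<omega> in M. (\<lambda>j. \<integral>\<^sup>+s. ennreal (norm (g (Z \<omega> s) - G j (Z \<omega> s))) \<partial>L) \<longlonglongrightarrow> 0"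
  proof (rule AE_tendsto_0_if_summable_integral[where C = C])
    fix j
    have "(\<lambda>z. ennreal (norm (g (Z (fst z) (snd z)) - G j (Z (fst z) (snd z))))) \<in> borel_measurable (M \<Otimes>\<^sub>M L)"
      by measurable
    from L.borel_measurable_nn_integral_fst[OF this]
    show "(\<lambda>\<omega>. \<integral>\<^sup>+s. ennreal (norm (g (Z \<omega> s) - G j (Z \<omega> s))) \<partial>L) \<in> borel_measurable M" by simp
    show "(\<integral>\<^sup>+\<omega>. (\<integral>\<^sup>+s. ennreal (norm (g (Z \<omega> s) - G j (Z \<omega> s))) \<partial>L) \<partial>M) \<le> ennreal (C * (1 / 2) ^ j)"
      by (subst swap[where \<phi> = "\<lambda>x. ennreal (norm (g x - G j x))"]) (auto intro!: push_pair[OF _ g_err])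
  qed fact
  have A5: "AE \<omega> in M. (\<integral>\<^sup>+s. ennreal (norm (g (Z \<omega> s))) \<partial>L) \<noteq> \<infinity>"
  proof (rule nn_integral_PInf_AE)
    have "(\<lambda>z. ennreal (norm (g (Z (fst z) (snd z))))) \<in> borel_measurable (M \<Otimes>\<^sub>M L)"
      by measurable
    from L.borel_measurable_nn_integral_fst[OF this]
    show "(\<lambda>\<omega>. \<integral>\<^sup>+s. ennreal (norm (g (Z \<omega> s))) \<partial>L) \<in> borel_measurable M" by simp
    define b where "b = enn2real (\<integral>\<^sup>+x\<in>cball 0 R. ennreal (norm (g x)) \<partial>lborel)"
    have "b \<ge> 0" unfolding b_def by simp
    have b: "(\<integral>\<^sup>+x\<in>cball 0 R. ennreal (norm (g x)) \<partial>lborel) = ennreal b"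
      unfolding b_def using locally_integrable_nn_integral[OF g compact_cball, of 0 R] by simp
    have "(\<integral>\<^sup>+\<omega>. (\<integral>\<^sup>+s. ennreal (norm (g (Z \<omega> s))) \<partial>L) \<partial>M) \<le> ennreal (C * b)"
      by (subst swap[where \<phi> = "\<lambda>x. ennreal (norm (g x))"])
        (auto intro!: push_pair simp: b \<open>b \<ge> 0\<close>)
    then show "(\<integral>\<^sup>+\<omega>. (\<integral>\<^sup>+s. ennreal (norm (g (Z \<omega> s))) \<partial>L) \<partial>M) \<noteq> \<infinity>"
      by (auto simp: top_unique)
  qed
  have "0 \<in> space L" "1 \<in> space L" by (auto simp: L_space)
  from A[OF this(1)] A[OF this(2)] A3 A4 A5 show ?thesis
  proof eventually_elim
    case (elim \<omega>)
    have conv: "(\<lambda>j. v j x) \<longlonglongrightarrow> u x" if "(\<lambda>j. ennreal (norm (u x - v j x))) \<longlonglongrightarrow> 0" for x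
    proof -
      have "(\<lambda>j. norm (u x - v j x)) \<longlonglongrightarrow> 0"
        using that by (subst (asm) ennreal_tendsto_0_iff) auto
      then have "(\<lambda>j. v j x - u x) \<longlonglongrightarrow> 0"
        by (intro tendsto_norm_zero_cancel[of "\<lambda>j. v j x - u x"]) (simp add: abs_minus_commute)
      then show ?thesis by (rule LIM_zero_cancel)
    qed
    have "ennreal ((F (u (Z \<omega> 1)) - F (u (Z \<omega> 0)))\<^sup>2)
        \<le> (\<integral>\<^sup>+s. ennreal ((F' (u (Z \<omega> s)) * (Q \<omega> \<bullet> g (Z \<omega> s)))\<^sup>2) \<partial>L)"
    proof (rule limit_chain_rule_bound[where F = F and F' = F' and a = "u (Z \<omega> 0)" and b = "u (Z \<omega> 1)"
          and \<gamma> = "\<lambda>s. u (Z \<omega> s)" and k = "\<lambda>s. Q \<omega> \<bullet> g (Z \<omega> s)" and \<gamma>s = "\<lambda>j s. v j (Z \<omega> s)" and ks = "\<lambda>j s. Q \<omega> \<bullet> G j (Z \<omega> s)", folded L_def])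
      show "((\<lambda>s. v j (Z \<omega> s)) has_real_derivative Q \<omega> \<bullet> G j (Z \<omega> s)) (at s)" for j s
      proof -
        have "(Z \<omega> has_derivative (\<lambda>h. h *\<^sub>R Q \<omega>)) (at s)"
          unfolding Z_def by (auto intro!: derivative_eq_intros)
        moreover have "(v j has_derivative (\<lambda>h. h \<bullet> G j (Z \<omega> s))) (at (Z \<omega> s))"
          using vG(1) unfolding gderiv_def by blast
        ultimately have "((\<lambda>s. v j (Z \<omega> s)) has_derivative (\<lambda>h. (h *\<^sub>R Q \<omega>) \<bullet> G j (Z \<omega> s))) (at s)"
          by (rule has_derivative_compose)
        then show ?thesis
          unfolding has_field_derivative_def by (simp add: mult.commute[of _ "Q \<omega> \<bullet> G j (Z \<omega> s)"])
      qed
      show "continuous_on UNIV (\<lambda>s. Q \<omega> \<bullet> G j (Z \<omega> s))" for j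
        unfolding Z_def by (intro continuous_intros continuous_on_compose2[OF vG(2)]) auto
      show "(\<lambda>j. v j (Z \<omega> 0)) \<longlonglongrightarrow> u (Z \<omega> 0)" "(\<lambda>j. v j (Z \<omega> 1)) \<longlonglongrightarrow> u (Z \<omega> 1)"
        using elim(1,2) by (auto intro: conv)
      show "AE s in L. (\<lambda>j. v j (Z \<omega> s)) \<longlonglongrightarrow> u (Z \<omega> s)"
        using elim(3) by eventually_elim (rule conv)
      have cs: "\<bar>Q \<omega> \<bullet> y\<bar> \<le> norm (Q \<omega>) * norm y" for y
        by (rule Cauchy_Schwarz_ineq2)
      have "(\<integral>\<^sup>+s. ennreal \<bar>Q \<omega> \<bullet> g (Z \<omega> s)\<bar> \<partial>L) \<le> (\<integral>\<^sup>+s. ennreal (norm (Q \<omega>)) * ennreal (norm (g (Z \<omega> s))) \<partial>L)"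
        by (intro nn_integral_mono) (simp flip: ennreal_mult add: cs ennreal_leI)
      also have "\<dots> = ennreal (norm (Q \<omega>)) * (\<integral>\<^sup>+s. ennreal (norm (g (Z \<omega> s))) \<partial>L)"
        by (rule nn_integral_cmult) measurable
      also have "\<dots> < \<infinity>"
        using elim(5) by (simp add: ennreal_mult_less_top less_top)
      finally show "(\<integral>\<^sup>+s. ennreal \<bar>Q \<omega> \<bullet> g (Z \<omega> s)\<bar> \<partial>L) < \<infinity>" .
      have up: "(\<integral>\<^sup>+s. ennreal \<bar>Q \<omega> \<bullet> g (Z \<omega> s) - Q \<omega> \<bullet> G j (Z \<omega> s)\<bar> \<partial>L)
          \<le> ennreal (norm (Q \<omega>)) * (\<integral>\<^sup>+s. ennreal (norm (g (Z \<omega> s) - G j (Z \<omega> s))) \<partial>L)" for j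
      proof -
        have "(\<integral>\<^sup>+s. ennreal \<bar>Q \<omega> \<bullet> g (Z \<omega> s) - Q \<omega> \<bullet> G j (Z \<omega> s)\<bar> \<partial>L)
            \<le> (\<integral>\<^sup>+s. ennreal (norm (Q \<omega>)) * ennreal (norm (g (Z \<omega> s) - G j (Z \<omega> s))) \<partial>L)"
          by (intro nn_integral_mono) (simp flip: ennreal_mult inner_diff_right add: cs ennreal_leI)
        also have "\<dots> = ennreal (norm (Q \<omega>)) * (\<integral>\<^sup>+s. ennreal (norm (g (Z \<omega> s) - G j (Z \<omega> s))) \<partial>L)"
          by (rule nn_integral_cmult) measurable
        finally show ?thesis .
      qed
      have "(\<lambda>j. ennreal (norm (Q \<omega>)) * (\<integral>\<^sup>+s. ennreal (norm (g (Z \<omega> s) - G j (Z \<omega> s))) \<partial>L)) \<longlonglongrightarrow> 0"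
        using ennreal_tendsto_cmult[OF _ elim(4), of "ennreal (norm (Q \<omega>))"] by simp
      then show "(\<lambda>j. \<integral>\<^sup>+s. ennreal \<bar>Q \<omega> \<bullet> g (Z \<omega> s) - Q \<omega> \<bullet> G j (Z \<omega> s)\<bar> \<partial>L) \<longlonglongrightarrow> 0"
        by (rule tendsto_sandwich[rotated 3, OF _ _ _ tendsto_const]) (use up in \<open>auto intro!: always_eventually\<close>)
    qed (use F in \<open>simp_all, measurable\<close>)
    also have "\<dots> \<le> (\<integral>\<^sup>+s. ennreal ((F' (u (Z \<omega> s)))\<^sup>2 * (norm (g (Z \<omega> s)))\<^sup>2 * (norm (Q \<omega>))\<^sup>2) \<partial>L)"
    proof (intro nn_integral_mono ennreal_leI)
      fix s
      have "(Q \<omega> \<bullet> g (Z \<omega> s))\<^sup>2 \<le> (norm (Q \<omega>) * norm (g (Z \<omega> s)))\<^sup>2"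
        by (intro power2_le_iff_abs_le[THEN iffD2] Cauchy_Schwarz_ineq2) simp
      from mult_left_mono[OF this, of "(F' (u (Z \<omega> s)))\<^sup>2"]
      show "(F' (u (Z \<omega> s)) * (Q \<omega> \<bullet> g (Z \<omega> s)))\<^sup>2
          \<le> (F' (u (Z \<omega> s)))\<^sup>2 * (norm (g (Z \<omega> s)))\<^sup>2 * (norm (Q \<omega>))\<^sup>2"
        by (simp add: power_mult_distrib mult_ac)
    qed
    finally show ?case by (simp add: Z_def)
  qed
qed

subsection \<open>Poincare inequality on balls\<close>

text \<open>The substitution divides by \<open>c ^ DIM('a)\<close>, and for \<open>c\<close> at
  least 1/2 this costs at most \<open>2 ^ DIM('a)\<close>.\<close>

lemma nn_integral_lborel_affine_le:
  fixes f :: "'a::euclidean_space \<Rightarrow> ennreal"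
  assumes "f \<in> borel_measurable borel" and "1 / 2 \<le> c"
  shows "(\<integral>\<^sup>+x. f (t + c *\<^sub>R x) \<partial>lborel) \<le> ennreal (2 ^ DIM('a)) * (\<integral>\<^sup>+x. f x \<partial>lborel)"
proof -
  have "1 \<le> (2 * c) ^ DIM('a)" using assms(2) by (intro one_le_power) simp
  then have one: "1 \<le> ennreal (2 ^ DIM('a)) * ennreal (c ^ DIM('a))"
    using assms(2) by (simp flip: ennreal_mult add: power_mult_distrib)
  have "(\<integral>\<^sup>+x. f (t + c *\<^sub>R x) \<partial>lborel)
      \<le> ennreal (2 ^ DIM('a)) * ennreal (c ^ DIM('a)) * (\<integral>\<^sup>+x. f (t + c *\<^sub>R x) \<partial>lborel)"
    using mult_right_mono[OF one, of "\<integral>\<^sup>+x. f (t + c *\<^sub>R x) \<partial>lborel"] by simp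
  also have "\<dots> = ennreal (2 ^ DIM('a)) * (\<integral>\<^sup>+x. f x \<partial>lborel)"
    using nn_integral_lborel_affine[OF assms(1), of c t] assms(2) by (simp add: mult.assoc ennreal_power)
  finally show ?thesis .
qed

text \<open>The pathwise bound is integrated over all segments: Tonelli puts the time integral
  outside, and \<open>push\<close> is applied at each time.\<close>

lemma weak_gradient_path_integral_bound:
  fixes u :: "'a::euclidean_space \<Rightarrow> real" and P Q :: "'w \<Rightarrow> 'a"
  assumes ug: "weak_gradient u g" and M: "sigma_finite_measure M"
    and PQ[measurable]: "P \<in> borel_measurable M" "Q \<in> borel_measurable M"
    and "C \<ge> 0"
    and push: "\<And>s \<phi>. 0 \<le> s \<Longrightarrow> s \<le> 1 \<Longrightarrow> \<phi> \<in> borel_measurable borel \<Longrightarrow>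
      (\<integral>\<^sup>+\<omega>. \<phi> (P \<omega> + s *\<^sub>R Q \<omega>) \<partial>M) \<le> ennreal C * (\<integral>\<^sup>+x\<in>cball 0 R. \<phi> x \<partial>lborel)"
    and D: "\<And>\<omega>. \<omega> \<in> space M \<Longrightarrow> norm (Q \<omega>) \<le> D"
    and F: "\<And>t. (F has_real_derivative F' t) (at t)" "continuous_on UNIV F'"
  shows "(\<integral>\<^sup>+\<omega>. ennreal ((F (u (P \<omega> + Q \<omega>)) - F (u (P \<omega>)))\<^sup>2) \<partial>M)
    \<le> ennreal (D\<^sup>2 * C) * (\<integral>\<^sup>+x\<in>cball 0 R. ennreal ((F' (u x))\<^sup>2 * (norm (g x))\<^sup>2) \<partial>lborel)"
proof -
  define L where "L = restrict_space lborel {0..1::real}"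
  interpret M: sigma_finite_measure M by (rule M)
  interpret L: finite_measure L unfolding L_def by (rule unit_interval_measure)
  interpret PL: pair_sigma_finite M L ..
  have L_space: "space L = {0..1}" unfolding L_def by (simp add: space_restrict_space)
  have L1: "emeasure L (space L) = 1"
    unfolding L_def by (simp add: emeasure_restrict_space space_restrict_space)
  have id_L: "(\<lambda>s. s) \<in> borel_measurable L"
    unfolding L_def by (intro measurable_restrict_space1) simp
  have snd_L[measurable]: "snd \<in> borel_measurable (M \<Otimes>\<^sub>M L)"
    by (rule measurable_compose[OF measurable_snd id_L])
  have "locally_integrable u" "locally_integrable g"
    using ug unfolding weak_gradient_def by auto
  then have [measurable]: "u \<in> borel_measurable borel" "g \<in> borel_measurable borel"
    by (auto intro: locally_integrable_measurable)
  have [measurable]: "F' \<in> borel_measurable borel"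
    using F(2) by (rule borel_measurable_continuous_onI)
  define G where "G = (\<lambda>x. ennreal ((F' (u x))\<^sup>2 * (norm (g x))\<^sup>2))"
  have [measurable]: "G \<in> borel_measurable borel" unfolding G_def by measurable
  have G_pair: "(\<lambda>(\<omega>, s). ennreal (D\<^sup>2) * G (P \<omega> + s *\<^sub>R Q \<omega>)) \<in> borel_measurable (M \<Otimes>\<^sub>M L)"
    unfolding split_beta' by measurable
  have path: "AE \<omega> in M. ennreal ((F (u (P \<omega> + Q \<omega>)) - F (u (P \<omega>)))\<^sup>2)
    \<le> (\<integral>\<^sup>+s. ennreal ((F' (u (P \<omega> + s *\<^sub>R Q \<omega>)))\<^sup>2 * (norm (g (P \<omega> + s *\<^sub>R Q \<omega>)))\<^sup>2 * (norm (Q \<omega>))\<^sup>2)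
        \<partial>restrict_space lborel {0..1})"
    by (rule weak_gradient_path_bound[OF ug M PQ \<open>C \<ge> 0\<close>]) (rule push F | assumption)+
  have "(\<integral>\<^sup>+\<omega>. ennreal ((F (u (P \<omega> + Q \<omega>)) - F (u (P \<omega>)))\<^sup>2) \<partial>M)
      \<le> (\<integral>\<^sup>+\<omega>. (\<integral>\<^sup>+s. ennreal (D\<^sup>2) * G (P \<omega> + s *\<^sub>R Q \<omega>) \<partial>L) \<partial>M)"
  proof (rule nn_integral_mono_AE)
    show "AE \<omega> in M. ennreal ((F (u (P \<omega> + Q \<omega>)) - F (u (P \<omega>)))\<^sup>2)
        \<le> (\<integral>\<^sup>+s. ennreal (D\<^sup>2) * G (P \<omega> + s *\<^sub>R Q \<omega>) \<partial>L)"
      using path AE_space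
    proof eventually_elim
      case (elim \<omega>)
      have "(norm (Q \<omega>))\<^sup>2 \<le> D\<^sup>2" using D[OF elim(2)] by (intro power_mono) auto
      note elim(1)
      also have "(\<integral>\<^sup>+s. ennreal ((F' (u (P \<omega> + s *\<^sub>R Q \<omega>)))\<^sup>2 * (norm (g (P \<omega> + s *\<^sub>R Q \<omega>)))\<^sup>2 * (norm (Q \<omega>))\<^sup>2)
            \<partial>restrict_space lborel {0..1})
          \<le> (\<integral>\<^sup>+s. ennreal (D\<^sup>2) * G (P \<omega> + s *\<^sub>R Q \<omega>) \<partial>L)"
        unfolding L_def G_def
        using \<open>(norm (Q \<omega>))\<^sup>2 \<le> D\<^sup>2\<close>
        by (intro nn_integral_mono) (auto simp flip: ennreal_mult simp: mult.commute[of "D\<^sup>2"] intro!: ennreal_leI mult_left_mono)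
      finally show ?case .
    qed
  qed
  also have "\<dots> = (\<integral>\<^sup>+s. (\<integral>\<^sup>+\<omega>. ennreal (D\<^sup>2) * G (P \<omega> + s *\<^sub>R Q \<omega>) \<partial>M) \<partial>L)"
    by (rule PL.Fubini'[symmetric, OF G_pair])
  also have "\<dots> \<le> (\<integral>\<^sup>+s. ennreal (D\<^sup>2) * (ennreal C * (\<integral>\<^sup>+x\<in>cball 0 R. G x \<partial>lborel)) \<partial>L)"
  proof (rule nn_integral_mono)
    fix s assume s: "s \<in> space L"
    have "(\<integral>\<^sup>+\<omega>. ennreal (D\<^sup>2) * G (P \<omega> + s *\<^sub>R Q \<omega>) \<partial>M) = ennreal (D\<^sup>2) * (\<integral>\<^sup>+\<omega>. G (P \<omega> + s *\<^sub>R Q \<omega>) \<partial>M)"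
      by (rule nn_integral_cmult) measurable
    also have "\<dots> \<le> ennreal (D\<^sup>2) * (ennreal C * (\<integral>\<^sup>+x\<in>cball 0 R. G x \<partial>lborel))"
      using s by (intro mult_left_mono push) (auto simp: L_space)
    finally show "(\<integral>\<^sup>+\<omega>. ennreal (D\<^sup>2) * G (P \<omega> + s *\<^sub>R Q \<omega>) \<partial>M) \<le> \<dots>" .
  qed
  also have "\<dots> = ennreal (D\<^sup>2 * C) * (\<integral>\<^sup>+x\<in>cball 0 R. G x \<partial>lborel)"
    using \<open>C \<ge> 0\<close> by (simp add: L1 ennreal_mult mult.assoc)
  finally show ?thesis unfolding G_def .
qed

text \<open>Every pair of points of the ball is joined by its segment. With \<open>y\<close> fixed,
  the substitution of \<open>(1 - s) y + s x\<close> for \<open>x\<close> has Jacobian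
  \<open>s ^ DIM('a)\<close>, which degenerates as \<open>s\<close> tends to 0. So \<open>x\<close>
  is substituted when \<open>s\<close> is at least 1/2 and \<open>y\<close> otherwise.\<close>

lemma poincare_double_integral_cball:
  fixes u :: "'a::euclidean_space \<Rightarrow> real"
  defines "V \<equiv> \<lambda>R. measure lborel (cball (0::'a) R)"
  assumes ug: "weak_gradient u g" and "R \<ge> 0"
    and F: "\<And>t. (F has_real_derivative F' t) (at t)" "continuous_on UNIV F'"
  shows "(\<integral>\<^sup>+y\<in>cball 0 R. (\<integral>\<^sup>+x\<in>cball 0 R. ennreal ((F (u x) - F (u y))\<^sup>2) \<partial>lborel) \<partial>lborel)
    \<le> ennreal ((2 * R)\<^sup>2 * (2 ^ DIM('a) * V R)) * (\<integral>\<^sup>+x\<in>cball 0 R. ennreal ((F' (u x))\<^sup>2 * (norm (g x))\<^sup>2) \<partial>lborel)"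
proof -
  let ?B = "cball (0::'a) R"
  have V: "emeasure lborel ?B = ennreal (V R)"
    unfolding V_def using emeasure_compact_finite[of ?B] by (intro emeasure_eq_ennreal_measure) auto
  have [simp]: "V R \<ge> 0" by (simp add: V_def)
  have B[measurable]: "?B \<in> sets borel" by simp
  have BB: "?B \<times> ?B \<in> sets (borel :: ('a \<times> 'a) measure)"
    by (intro borel_closed closed_Times) auto
  define M where "M = restrict_space (lborel :: ('a \<times> 'a) measure) (?B \<times> ?B)"
  have M: "sigma_finite_measure M"
    unfolding M_def using BB by (intro sigma_finite_measure_restrict_space sigma_finite_lborel) simp
  have M_meas: "f \<in> borel_measurable M" if "f \<in> borel_measurable borel" for f :: "'a \<times> 'a \<Rightarrow> 'b::topological_space"
    unfolding M_def using that by (intro measurable_restrict_space1) simp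
  have M_int: "(\<integral>\<^sup>+z. f z \<partial>M) = (\<integral>\<^sup>+y\<in>?B. (\<integral>\<^sup>+x\<in>?B. f (x, y) \<partial>lborel) \<partial>lborel)"
    "(\<integral>\<^sup>+z. f z \<partial>M) = (\<integral>\<^sup>+x\<in>?B. (\<integral>\<^sup>+y\<in>?B. f (x, y) \<partial>lborel) \<partial>lborel)"
    if f[measurable]: "f \<in> borel_measurable borel" for f :: "'a \<times> 'a \<Rightarrow> ennreal"
  proof -
    have "f \<in> borel_measurable (borel \<Otimes>\<^sub>M borel)" using f unfolding borel_prod .
    then have mm: "(\<lambda>z. f z * indicator (?B \<times> ?B) z) \<in> borel_measurable (lborel \<Otimes>\<^sub>M lborel)"
      using BB unfolding lborel_prod by simp
    have "(\<integral>\<^sup>+z. f z \<partial>M) = (\<integral>\<^sup>+z. f z * indicator (?B \<times> ?B) z \<partial>(lborel \<Otimes>\<^sub>M lborel))"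
      unfolding M_def lborel_prod using BB by (intro nn_integral_restrict_space) simp
    also have "\<dots> = (\<integral>\<^sup>+x. (\<integral>\<^sup>+y. f (x, y) * indicator (?B \<times> ?B) (x, y) \<partial>lborel) \<partial>lborel)"
      by (rule lborel.nn_integral_fst[symmetric, OF mm])
    finally have 1: "(\<integral>\<^sup>+z. f z \<partial>M) = (\<integral>\<^sup>+x. (\<integral>\<^sup>+y. f (x, y) * indicator (?B \<times> ?B) (x, y) \<partial>lborel) \<partial>lborel)" .
    also have "\<dots> = (\<integral>\<^sup>+y. (\<integral>\<^sup>+x. f (x, y) * indicator (?B \<times> ?B) (x, y) \<partial>lborel) \<partial>lborel)"
      by (rule lborel_pair.Fubini[symmetric, OF mm])
    finally have 2: "(\<integral>\<^sup>+z. f z \<partial>M) = (\<integral>\<^sup>+y. (\<integral>\<^sup>+x. f (x, y) * indicator (?B \<times> ?B) (x, y) \<partial>lborel) \<partial>lborel)" .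
    show "(\<integral>\<^sup>+z. f z \<partial>M) = (\<integral>\<^sup>+y\<in>?B. (\<integral>\<^sup>+x\<in>?B. f (x, y) \<partial>lborel) \<partial>lborel)"
      unfolding 2 by (intro nn_integral_cong) (auto simp: indicator_def)
    show "(\<integral>\<^sup>+z. f z \<partial>M) = (\<integral>\<^sup>+x\<in>?B. (\<integral>\<^sup>+y\<in>?B. f (x, y) \<partial>lborel) \<partial>lborel)"
      unfolding 1 by (intro nn_integral_cong) (auto simp: indicator_def)
  qed
  have half: "(\<integral>\<^sup>+y\<in>?B. (\<integral>\<^sup>+x\<in>?B. \<phi> ((1 - s) *\<^sub>R y + s *\<^sub>R x) \<partial>lborel) \<partial>lborel)
      \<le> ennreal (2 ^ DIM('a) * V R) * (\<integral>\<^sup>+x\<in>?B. \<phi> x \<partial>lborel)"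
    if s: "1 / 2 \<le> s" "s \<le> 1" and [measurable]: "\<phi> \<in> borel_measurable borel" for s and \<phi> :: "'a \<Rightarrow> ennreal"
  proof -
    have "(\<integral>\<^sup>+x\<in>?B. \<phi> ((1 - s) *\<^sub>R y + s *\<^sub>R x) \<partial>lborel) \<le> ennreal (2 ^ DIM('a)) * (\<integral>\<^sup>+x\<in>?B. \<phi> x \<partial>lborel)"
      if y: "y \<in> ?B" for y
    proof -
      have "(\<integral>\<^sup>+x\<in>?B. \<phi> ((1 - s) *\<^sub>R y + s *\<^sub>R x) \<partial>lborel)
          \<le> (\<integral>\<^sup>+x. \<phi> ((1 - s) *\<^sub>R y + s *\<^sub>R x) * indicator ?B ((1 - s) *\<^sub>R y + s *\<^sub>R x) \<partial>lborel)"
      proof (intro nn_integral_mono)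
        fix x
        have "(1 - s) *\<^sub>R y + s *\<^sub>R x \<in> ?B" if "x \<in> ?B"
          using convexD[OF convex_cball y that, of "1 - s" s] s by simp
        then show "\<phi> ((1 - s) *\<^sub>R y + s *\<^sub>R x) * indicator ?B x
            \<le> \<phi> ((1 - s) *\<^sub>R y + s *\<^sub>R x) * indicator ?B ((1 - s) *\<^sub>R y + s *\<^sub>R x)"
          by (auto simp: indicator_def)
      qed
      also have "\<dots> \<le> ennreal (2 ^ DIM('a)) * (\<integral>\<^sup>+x\<in>?B. \<phi> x \<partial>lborel)"
        by (rule nn_integral_lborel_affine_le) (use s in auto)
      finally show ?thesis .
    qed
    then have "(\<integral>\<^sup>+y\<in>?B. (\<integral>\<^sup>+x\<in>?B. \<phi> ((1 - s) *\<^sub>R y + s *\<^sub>R x) \<partial>lborel) \<partial>lborel)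
        \<le> (\<integral>\<^sup>+y\<in>?B. (ennreal (2 ^ DIM('a)) * (\<integral>\<^sup>+x\<in>?B. \<phi> x \<partial>lborel)) \<partial>lborel)"
      by (intro nn_integral_mono) (auto simp: indicator_def)
    also have "\<dots> = ennreal (2 ^ DIM('a) * V R) * (\<integral>\<^sup>+x\<in>?B. \<phi> x \<partial>lborel)"
      by (subst nn_integral_cmult_indicator) (auto simp: V ennreal_mult mult_ac)
    finally show ?thesis .
  qed
  have "(\<integral>\<^sup>+z. ennreal ((F (u (snd z + (fst z - snd z))) - F (u (snd z)))\<^sup>2) \<partial>M)
      \<le> ennreal ((2 * R)\<^sup>2 * (2 ^ DIM('a) * V R)) * (\<integral>\<^sup>+x\<in>?B. ennreal ((F' (u x))\<^sup>2 * (norm (g x))\<^sup>2) \<partial>lborel)"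
  proof (rule weak_gradient_path_integral_bound[OF ug M])
    show "snd \<in> borel_measurable M" "(\<lambda>z. fst z - snd z) \<in> borel_measurable M"
      by (intro M_meas borel_measurable_continuous_onI continuous_intros)+
    show "norm (fst z - snd z) \<le> 2 * R" if "z \<in> space M" for z
      using that norm_triangle_ineq4[of "fst z" "snd z"] unfolding M_def by (auto simp: space_restrict_space)
    fix s :: real and \<phi> :: "'a \<Rightarrow> ennreal"
    assume s: "0 \<le> s" "s \<le> 1" and [measurable]: "\<phi> \<in> borel_measurable borel"
    have [measurable]: "(\<lambda>z::'a \<times> 'a. snd z + s *\<^sub>R (fst z - snd z)) \<in> borel_measurable borel"
      by (intro borel_measurable_continuous_onI continuous_intros)
    have m: "(\<lambda>z. \<phi> (snd z + s *\<^sub>R (fst z - snd z))) \<in> borel_measurable borel"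
      by measurable
    show "(\<integral>\<^sup>+z. \<phi> (snd z + s *\<^sub>R (fst z - snd z)) \<partial>M)
        \<le> ennreal (2 ^ DIM('a) * V R) * (\<integral>\<^sup>+x\<in>?B. \<phi> x \<partial>lborel)"
    proof (cases "1 / 2 \<le> s")
      case True
      have "(\<lambda>x y. snd (x, y) + s *\<^sub>R (fst (x, y) - snd (x, y))) = (\<lambda>x y::'a. (1 - s) *\<^sub>R y + s *\<^sub>R x)"
        by (auto simp: algebra_simps)
      then have "\<And>x y. snd (x, y) + s *\<^sub>R (fst (x, y) - snd (x, y)) = (1 - s) *\<^sub>R (y::'a) + s *\<^sub>R x"
        by meson
      then show ?thesis
        using half[of s \<phi>] True s unfolding M_int(1)[OF m] by simp
    next
      case False
      have "\<And>x y. snd (x, y) + s *\<^sub>R (fst (x, y) - snd (x, y)) = (1 - (1 - s)) *\<^sub>R (x::'a) + (1 - s) *\<^sub>R y"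
        by (simp add: algebra_simps)
      then show ?thesis
        using half[of "1 - s" \<phi>] False s unfolding M_int(2)[OF m] by simp
    qed
  qed (use F in auto)
  moreover have "(\<integral>\<^sup>+z. ennreal ((F (u (snd z + (fst z - snd z))) - F (u (snd z)))\<^sup>2) \<partial>M)
      = (\<integral>\<^sup>+y\<in>?B. (\<integral>\<^sup>+x\<in>?B. ennreal ((F (u x) - F (u y))\<^sup>2) \<partial>lborel) \<partial>lborel)"
  proof -
    have [measurable]: "u \<in> borel_measurable borel"
      using ug unfolding weak_gradient_def by (auto intro: locally_integrable_measurable)
    have [measurable]: "F \<in> borel_measurable borel"
      using F(1) by (intro borel_measurable_continuous_onI) (meson DERIV_isCont continuous_at_imp_continuous_on)
    have [measurable]: "(fst :: 'a \<times> 'a \<Rightarrow> 'a) \<in> borel_measurable borel" "(snd :: 'a \<times> 'a \<Rightarrow> 'a) \<in> borel_measurable borel"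
      by (intro borel_measurable_continuous_onI continuous_intros)+
    show ?thesis by (subst M_int(1)) auto
  qed
  ultimately show ?thesis by simp
qed

subsection \<open>Moment and Poincare inequalities for dilation weights\<close>

text \<open>Used at \<open>y = 2 * (\<tau> * q x)\<close>, where it leaves the gain
  \<open>\<tau> * q x\<close>.\<close>

lemma exp_neg_le:
  assumes "0 \<le> y" "y \<le> (1::real)"
  shows "exp (- y) \<le> 1 - y / 2"
proof -
  have "exp (- y) = 1 / exp y" by (simp add: exp_minus field_simps)
  also have "\<dots> \<le> 1 / (1 + y)"
    using assms exp_ge_add_one_self[of y] by (intro divide_left_mono) auto
  also have "\<dots> \<le> 1 - y / 2"
    using assms mult_left_mono[of y 1 y] by (simp add: field_simps)
  finally show ?thesis .
qed

lemma exp_le_linear: "exp (y::real) \<le> 1 + y * exp y"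
proof -
  have "1 - y \<le> exp (- y)" using exp_ge_add_one_self[of "- y"] by simp
  then have "(1 - y) * exp y \<le> exp (- y) * exp y" by (intro mult_right_mono) auto
  then show ?thesis by (simp add: exp_minus algebra_simps)
qed

lemma nn_integral_le_if_cball_le:
  fixes f :: "'a::euclidean_space \<Rightarrow> ennreal"
  assumes [measurable]: "f \<in> borel_measurable borel"
    and le: "\<And>n::nat. (\<integral>\<^sup>+x\<in>cball 0 (real n). f x \<partial>lborel) \<le> c"
  shows "(\<integral>\<^sup>+x. f x \<partial>lborel) \<le> c"
proof -
  define h where "h = (\<lambda>n::nat. \<lambda>x. f x * indicator (cball 0 (real n)) x)"
  have [measurable]: "cball (0::'a) r \<in> sets borel" for r by simp
  have inc: "incseq h"
    by (rule incseq_SucI) (auto simp: h_def le_fun_def indicator_def)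
  have sup: "(SUP n. h n x) = f x" for x
  proof (rule antisym)
    show "(SUP n. h n x) \<le> f x" by (rule SUP_least) (auto simp: h_def indicator_def)
    obtain n where "norm x \<le> real n" using real_arch_simple by blast
    then have "f x \<le> h n x" by (simp add: h_def)
    also have "\<dots> \<le> (SUP n. h n x)" by (rule SUP_upper) simp
    finally show "f x \<le> (SUP n. h n x)" .
  qed
  have "(\<integral>\<^sup>+x. f x \<partial>lborel) = (\<integral>\<^sup>+x. (SUP n. h n x) \<partial>lborel)"
    by (simp add: sup)
  also have "\<dots> = (SUP n. \<integral>\<^sup>+x. h n x \<partial>lborel)"
    by (rule nn_integral_monotone_convergence_SUP[OF inc]) (simp add: h_def)
  also have "\<dots> \<le> c"
    using le by (intro SUP_least) (simp add: h_def)
  finally show ?thesis .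
qed

text \<open>For \<open>m = exp (- 2 U)\<close> the function \<open>q\<close> is, up to a constant, a
  lower bound for the radial derivative of \<open>U\<close>. The assumption \<open>dilation\<close>
  is the integrated form of \<open>x . grad (ln m) <= A - 2 q\<close>, so that only differences of
  \<open>U\<close> along rays enter. The coercivity \<open>a\<close> serves to absorb the factor
  \<open>norm x\<close> produced by the vector field \<open>x\<close>.\<close>

locale dilation_weight =
  fixes m q :: "'a::euclidean_space \<Rightarrow> real" and A a :: real
  assumes m_meas[measurable]: "m \<in> borel_measurable borel"
    and q_meas[measurable]: "q \<in> borel_measurable borel"
    and m_pos: "m x > 0"
    and a_pos: "a > 0" and A_nonneg: "A \<ge> 0"
    and q_coercive: "a * (norm x)\<^sup>2 \<le> q x"
    and dilation: "0 \<le> \<tau> \<Longrightarrow> \<tau> \<le> 1 \<Longrightarrow> m ((1 + \<tau>) *\<^sub>R x) \<le> m x * exp (\<tau> * (A - 2 * q x))"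
    and q_bounded: "\<exists>B. \<forall>x\<in>cball 0 R. q x \<le> B"
    and m_bounded: "\<exists>b>0. \<exists>B. \<forall>x\<in>cball 0 R. b \<le> m x \<and> m x \<le> B"
begin

lemma q_nonneg: "0 \<le> q x"
  using q_coercive[of x] a_pos by (meson less_imp_le mult_nonneg_nonneg order_trans zero_le_power2)

text \<open>\<open>DIM('a) + A\<close> is the divergence of the field \<open>x\<close> plus the
  constant part of the logarithmic radial derivative of the weight. The exponential bounds the
  higher-order terms in \<open>\<tau>\<close>, and the factor 2 pays for absorbing half of the
  moment.\<close>

definition K1 :: real where
  "K1 = 2 * ((DIM('a) + A) * exp (DIM('a) + A))"

text \<open>\<open>2 / a\<close> comes from Young's inequality and is doubled by the same
  absorption; \<open>2 ^ DIM('a) * exp A\<close> is the cost of dilating the gradient integral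
  back.\<close>

definition K2 :: real where
  "K2 = 4 / a * (2 ^ DIM('a) * exp A)"

lemma K_nonneg: "K1 \<ge> 0" "K2 \<ge> 0"
  unfolding K1_def K2_def using a_pos A_nonneg by auto

text \<open>The first product is the factor by which a dilation changes the weighted volume. As
  \<open>2 * (\<tau> * q x)\<close> is at most 1, its decaying exponential lies below a line, and
  the resulting gain \<open>\<tau> * q x\<close> stays on the left to become the moment.\<close>

lemma dilation_factor:
  assumes "0 \<le> \<tau>" "\<tau> \<le> 1" "2 * (\<tau> * q x) \<le> 1"
  shows "(1 + \<tau>) ^ DIM('a) * exp (\<tau> * (A - 2 * q x)) + \<tau> * q x \<le> 1 + K1 / 2 * \<tau>"
proof -
  define e where "e = \<tau> * (DIM('a) + A)"
  have "(1 + \<tau>) ^ DIM('a) \<le> exp \<tau> ^ DIM('a)"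
    using assms exp_ge_add_one_self[of \<tau>] by (intro power_mono) auto
  also have "\<dots> = exp (\<tau> * DIM('a))" by (simp add: exp_of_nat_mult[symmetric] mult.commute)
  finally have "(1 + \<tau>) ^ DIM('a) * exp (\<tau> * (A - 2 * q x)) \<le> exp (\<tau> * DIM('a)) * exp (\<tau> * (A - 2 * q x))"
    by (intro mult_right_mono) auto
  also have "\<dots> = exp e * exp (- (2 * (\<tau> * q x)))"
    by (simp add: e_def exp_add[symmetric] algebra_simps)
  also have "\<dots> \<le> exp e * (1 - \<tau> * q x)"
    using exp_neg_le[of "2 * (\<tau> * q x)"] assms q_nonneg[of x] by (intro mult_left_mono) auto
  finally have 1: "(1 + \<tau>) ^ DIM('a) * exp (\<tau> * (A - 2 * q x)) \<le> exp e * (1 - \<tau> * q x)" .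
  have "e \<ge> 0" using assms A_nonneg by (simp add: e_def)
  have "\<tau> * q x \<le> exp e * (\<tau> * q x)"
    using \<open>e \<ge> 0\<close> assms q_nonneg[of x] mult_right_mono[of 1 "exp e" "\<tau> * q x"] by simp
  then have "exp e * (1 - \<tau> * q x) + \<tau> * q x \<le> exp e" by (simp add: algebra_simps)
  also have "exp e \<le> 1 + e * exp e" by (rule exp_le_linear)
  also have "\<dots> \<le> 1 + e * exp (DIM('a) + A)"
  proof -
    have "e \<le> 1 * (DIM('a) + A)" unfolding e_def using assms A_nonneg by (intro mult_right_mono) auto
    then show ?thesis using \<open>e \<ge> 0\<close> by (intro add_left_mono mult_left_mono) auto
  qed
  also have "\<dots> = 1 + K1 / 2 * \<tau>" by (simp add: e_def K1_def)
  finally show ?thesis using 1 by linarith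
qed

text \<open>Dilating \<open>x\<close> by the factor \<open>1 + \<tau>\<close> is the discrete form of integrating by parts against the
  vector field \<open>x\<close>; the boundary term on the ball has a favourable sign.\<close>

lemma moment_cball:
  fixes u :: "'a \<Rightarrow> real"
  assumes ug: "weak_gradient u g" and "R > 0"
    and F: "\<And>t. (F has_real_derivative F' t) (at t)" "continuous_on UNIV F'"
    and fin: "(\<integral>\<^sup>+x\<in>cball 0 R. ennreal ((F (u x))\<^sup>2 * m x) \<partial>lborel) < \<infinity>"
  shows "(\<integral>\<^sup>+x\<in>cball 0 R. ennreal ((F (u x))\<^sup>2 * m x * q x) \<partial>lborel)
    \<le> ennreal K1 * (\<integral>\<^sup>+x\<in>cball 0 R. ennreal ((F (u x))\<^sup>2 * m x) \<partial>lborel)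
      + ennreal K2 * (\<integral>\<^sup>+x\<in>cball 0 R. ennreal ((F' (u x))\<^sup>2 * (norm (g x))\<^sup>2 * m x) \<partial>lborel)"
proof -
  let ?B = "cball (0::'a) R"
  have [measurable]: "?B \<in> sets borel" by simp
  have "locally_integrable u" "locally_integrable g"
    using ug unfolding weak_gradient_def by auto
  then have [measurable]: "u \<in> borel_measurable borel" "g \<in> borel_measurable borel"
    by (auto intro: locally_integrable_measurable)
  have [measurable]: "F' \<in> borel_measurable borel"
    using F(2) by (rule borel_measurable_continuous_onI)
  have [measurable]: "F \<in> borel_measurable borel"
    using F(1) by (intro borel_measurable_continuous_onI) (meson DERIV_isCont continuous_at_imp_continuous_on)
  define W where "W = (\<lambda>x. F (u x))"
  define G where "G = (\<lambda>x. (F' (u x))\<^sup>2 * (norm (g x))\<^sup>2)"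
  have [measurable]: "W \<in> borel_measurable borel" "G \<in> borel_measurable borel"
    unfolding W_def G_def by measurable
  have G_nonneg: "G x \<ge> 0" for x by (simp add: G_def)
  define L where "L = restrict_space lborel {0..1::real}"
  interpret L: finite_measure L unfolding L_def by (rule unit_interval_measure)
  interpret PL: pair_sigma_finite lborel L ..
  have L_space: "space L = {0..1}" unfolding L_def by (simp add: space_restrict_space)
  have L1: "emeasure L (space L) = 1"
    unfolding L_def by (simp add: emeasure_restrict_space space_restrict_space)
  have id_L: "(\<lambda>s. s) \<in> borel_measurable L"
    unfolding L_def by (intro measurable_restrict_space1) simp
  have snd_L[measurable]: "snd \<in> borel_measurable ((lborel :: 'a measure) \<Otimes>\<^sub>M L)"
    by (rule measurable_compose[OF measurable_snd id_L])
  obtain B0 where B0: "\<And>x. x \<in> ?B \<Longrightarrow> q x \<le> B0" using q_bounded by blast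
  define Qb where "Qb = max 1 B0"
  have Qb: "Qb \<ge> 1" "\<And>x. x \<in> ?B \<Longrightarrow> q x \<le> Qb" using B0 by (auto simp: Qb_def le_max_iff_disj)
  \<comment> \<open>The step depends on the bound for \<open>q\<close> on the ball, hence on
    \<open>R\<close>; the resulting constants do not.\<close>
  define \<tau> where "\<tau> = 1 / (2 * Qb)"
  have \<tau>: "0 < \<tau>" "\<tau> \<le> 1" using Qb(1) by (auto simp: \<tau>_def)
  have \<tau>q: "2 * (\<tau> * q x) \<le> 1" if "x \<in> ?B" for x
    using Qb(1) Qb(2)[OF that] by (simp add: \<tau>_def field_simps)
  \<comment> \<open>The dilation factor along the segment from the contracted point to
    \<open>x\<close>: it runs from \<open>1 / (1 + \<tau>)\<close> to 1 and never falls below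
    1/2.\<close>
  define \<theta> where "\<theta> = (\<lambda>s. 1 / (1 + \<tau>) + s * (1 - 1 / (1 + \<tau>)))"
  have [measurable]: "\<theta> \<in> borel_measurable borel" unfolding \<theta>_def by measurable
  have inv: "1 / 2 \<le> 1 / (1 + \<tau>)" "1 / (1 + \<tau>) \<le> 1" using \<tau> by (auto simp: field_simps)
  have \<theta>: "1 / 2 \<le> \<theta> s" "\<theta> s \<le> 1" if "0 \<le> s" "s \<le> 1" for s
  proof -
    have "0 \<le> s * (1 - 1 / (1 + \<tau>))" using that inv by (intro mult_nonneg_nonneg) auto
    then show "1 / 2 \<le> \<theta> s" using inv unfolding \<theta>_def by linarith
    have "\<theta> s \<le> 1 / (1 + \<tau>) + 1 * (1 - 1 / (1 + \<tau>))"
      unfolding \<theta>_def using that inv by (intro add_left_mono mult_right_mono) auto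
    then show "\<theta> s \<le> 1" by simp
  qed
  define H where "H = (\<lambda>x. \<integral>\<^sup>+s. ennreal (G (\<theta> s *\<^sub>R x)) \<partial>L)"
  have G_pair: "(\<lambda>z. ennreal (G (\<theta> (snd z) *\<^sub>R fst z))) \<in> borel_measurable ((lborel :: 'a measure) \<Otimes>\<^sub>M L)"
    by measurable
  have H_meas[measurable]: "H \<in> borel_measurable borel"
    using L.borel_measurable_nn_integral_fst[OF G_pair] unfolding H_def by simp
  define \<alpha> where "\<alpha> = (\<integral>\<^sup>+x\<in>?B. ennreal ((W x)\<^sup>2 * m x) \<partial>lborel)"
  define \<beta> where "\<beta> = (\<integral>\<^sup>+x\<in>?B. ennreal ((W x)\<^sup>2 * m x * q x) \<partial>lborel)"
  define E where "E = (\<integral>\<^sup>+x\<in>?B. ennreal (G x * m x) \<partial>lborel)"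

  have path: "AE x in restrict_space lborel ?B. ennreal ((W x - W ((1 / (1 + \<tau>)) *\<^sub>R x))\<^sup>2)
      \<le> ennreal (\<tau>\<^sup>2 * (norm x)\<^sup>2) * H x"
  proof -
    have "AE x in restrict_space lborel ?B. ennreal ((F (u ((1 / (1 + \<tau>)) *\<^sub>R x + (1 - 1 / (1 + \<tau>)) *\<^sub>R x))
          - F (u ((1 / (1 + \<tau>)) *\<^sub>R x)))\<^sup>2)
        \<le> (\<integral>\<^sup>+s. ennreal ((F' (u ((1 / (1 + \<tau>)) *\<^sub>R x + s *\<^sub>R (1 - 1 / (1 + \<tau>)) *\<^sub>R x)))\<^sup>2
            * (norm (g ((1 / (1 + \<tau>)) *\<^sub>R x + s *\<^sub>R (1 - 1 / (1 + \<tau>)) *\<^sub>R x)))\<^sup>2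
            * (norm ((1 - 1 / (1 + \<tau>)) *\<^sub>R x))\<^sup>2) \<partial>restrict_space lborel {0..1})"
    proof (rule weak_gradient_path_bound[OF ug, where C = "2 ^ DIM('a)" and R = R])
      show "sigma_finite_measure (restrict_space lborel ?B)"
        by (intro sigma_finite_measure_restrict_space sigma_finite_lborel) simp
      show "(\<lambda>x. (1 / (1 + \<tau>)) *\<^sub>R x) \<in> borel_measurable (restrict_space lborel ?B)"
        "(\<lambda>x. (1 - 1 / (1 + \<tau>)) *\<^sub>R x) \<in> borel_measurable (restrict_space lborel ?B)"
        by (intro measurable_restrict_space1; measurable)+
      fix s :: real and \<phi> :: "'a \<Rightarrow> ennreal"
      assume s: "0 \<le> s" "s \<le> 1" and [measurable]: "\<phi> \<in> borel_measurable borel"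
      have eq: "(1 / (1 + \<tau>)) *\<^sub>R x + s *\<^sub>R (1 - 1 / (1 + \<tau>)) *\<^sub>R x = 0 + \<theta> s *\<^sub>R x" for x :: 'a
        by (simp add: \<theta>_def scaleR_add_left)
      have "(\<integral>\<^sup>+x. \<phi> (0 + \<theta> s *\<^sub>R x) \<partial>restrict_space lborel ?B) = (\<integral>\<^sup>+x\<in>?B. \<phi> (0 + \<theta> s *\<^sub>R x) \<partial>lborel)"
        by (rule nn_integral_restrict_space) simp
      also have "\<dots> \<le> (\<integral>\<^sup>+x. \<phi> (0 + \<theta> s *\<^sub>R x) * indicator ?B (0 + \<theta> s *\<^sub>R x) \<partial>lborel)"
      proof (rule nn_integral_mono)
        fix x :: 'a
        have "norm (\<theta> s *\<^sub>R x) \<le> norm x"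
          using \<theta>[OF s] by (simp add: mult_left_le_one_le)
        then show "\<phi> (0 + \<theta> s *\<^sub>R x) * indicator ?B x \<le> \<phi> (0 + \<theta> s *\<^sub>R x) * indicator ?B (0 + \<theta> s *\<^sub>R x)"
          by (auto simp: indicator_def)
      qed
      also have "\<dots> \<le> ennreal (2 ^ DIM('a)) * (\<integral>\<^sup>+x\<in>?B. \<phi> x \<partial>lborel)"
        by (rule nn_integral_lborel_affine_le) (use \<theta>[OF s] in auto)
      finally show "(\<integral>\<^sup>+x. \<phi> ((1 / (1 + \<tau>)) *\<^sub>R x + s *\<^sub>R (1 - 1 / (1 + \<tau>)) *\<^sub>R x) \<partial>restrict_space lborel ?B)
          \<le> ennreal (2 ^ DIM('a)) * (\<integral>\<^sup>+x\<in>?B. \<phi> x \<partial>lborel)"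
        unfolding eq .
    qed (use F in auto)
    then show ?thesis
    proof eventually_elim
      case (elim x)
      have eq: "(1 / (1 + \<tau>)) *\<^sub>R x + s *\<^sub>R (1 - 1 / (1 + \<tau>)) *\<^sub>R x = \<theta> s *\<^sub>R x" for s
        by (simp add: \<theta>_def scaleR_add_left)
      have one: "(1 / (1 + \<tau>)) *\<^sub>R x + (1 - 1 / (1 + \<tau>)) *\<^sub>R x = x"
        by (simp flip: scaleR_add_left)
      have "1 - 1 / (1 + \<tau>) \<le> \<tau>" using \<tau> by (simp add: field_simps)
      then have "(1 - 1 / (1 + \<tau>))\<^sup>2 \<le> \<tau>\<^sup>2" using inv by (intro power_mono) auto
      then have n: "(norm ((1 - 1 / (1 + \<tau>)) *\<^sub>R x))\<^sup>2 \<le> \<tau>\<^sup>2 * (norm x)\<^sup>2"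
        by (simp add: power_mult_distrib mult_right_mono)
      have "ennreal ((W x - W ((1 / (1 + \<tau>)) *\<^sub>R x))\<^sup>2)
          \<le> (\<integral>\<^sup>+s. ennreal ((F' (u (\<theta> s *\<^sub>R x)))\<^sup>2 * (norm (g (\<theta> s *\<^sub>R x)))\<^sup>2
              * (norm ((1 - 1 / (1 + \<tau>)) *\<^sub>R x))\<^sup>2) \<partial>L)"
        using elim unfolding W_def eq one L_def .
      also have "\<dots> \<le> (\<integral>\<^sup>+s. ennreal (\<tau>\<^sup>2 * (norm x)\<^sup>2) * ennreal (G (\<theta> s *\<^sub>R x)) \<partial>L)"
      proof (rule nn_integral_mono)
        fix s
        show "ennreal ((F' (u (\<theta> s *\<^sub>R x)))\<^sup>2 * (norm (g (\<theta> s *\<^sub>R x)))\<^sup>2 * (norm ((1 - 1 / (1 + \<tau>)) *\<^sub>R x))\<^sup>2)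
            \<le> ennreal (\<tau>\<^sup>2 * (norm x)\<^sup>2) * ennreal (G (\<theta> s *\<^sub>R x))"
          using mult_left_mono[OF n G_nonneg[of "\<theta> s *\<^sub>R x"]]
          by (simp flip: ennreal_mult add: G_def mult.commute ennreal_leI)
      qed
      also have "\<dots> = ennreal (\<tau>\<^sup>2 * (norm x)\<^sup>2) * H x"
      proof -
        have "(\<lambda>s. ennreal (G (\<theta> s *\<^sub>R x))) \<in> borel_measurable L"
          using measurable_compose[OF id_L, of "\<lambda>s. ennreal (G (\<theta> s *\<^sub>R x))" borel] by simp
        then show ?thesis unfolding H_def by (rule nn_integral_cmult)
      qed
      finally show ?case .
    qed
  qed

  \<comment> \<open>\<open>W x\<close> is expanded around its value at the contracted point; the
    negative square is dropped and the cross term is split by Young's inequality. The weight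
    \<open>a / 2\<close> lets \<open>q_coercive\<close> turn the first part into half of the gain
    \<open>\<tau> * q x\<close>.\<close>
  have pw: "AE x in restrict_space lborel ?B. ennreal ((W x)\<^sup>2 * m x)
      \<le> ennreal ((W ((1 / (1 + \<tau>)) *\<^sub>R x))\<^sup>2 * m x) + ennreal (\<tau> / 2) * ennreal ((W x)\<^sup>2 * m x * q x)
        + ennreal (2 * \<tau> / a) * (ennreal (m x) * H x)"
    using path
  proof eventually_elim
    case (elim x)
    show ?case
    proof (cases "H x = \<infinity>")
      case True
      then have "ennreal (2 * \<tau> / a) * (ennreal (m x) * H x) = \<infinity>"
        using \<tau> a_pos m_pos[of x] by (simp add: ennreal_mult_top)
      then show ?thesis by simp
    next
      case False
      define h where "h = enn2real (H x)"
      have h: "H x = ennreal h" "h \<ge> 0" unfolding h_def using False by (auto simp: less_top)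
      let ?w = "W ((1 / (1 + \<tau>)) *\<^sub>R x)"
      have d: "(W x - ?w)\<^sup>2 \<le> \<tau>\<^sup>2 * (norm x)\<^sup>2 * h"
        using elim h(2) unfolding h(1) by (simp flip: ennreal_mult)
      have "\<bar>W x - ?w\<bar> \<le> \<tau> * norm x * sqrt h"
      proof (rule abs_le_square_iff[THEN iffD2, of _ "\<tau> * norm x * sqrt h", THEN order_trans])
        show "(W x - ?w)\<^sup>2 \<le> (\<tau> * norm x * sqrt h)\<^sup>2"
          using d h(2) by (simp add: power_mult_distrib)
        show "\<bar>\<tau> * norm x * sqrt h\<bar> \<le> \<tau> * norm x * sqrt h"
          using \<tau> h(2) by simp
      qed
      then have "2 * (\<bar>W x\<bar> * \<bar>W x - ?w\<bar>) \<le> 2 * (\<bar>W x\<bar> * (\<tau> * norm x * sqrt h))"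
        by (intro mult_left_mono) auto
      also have "\<dots> \<le> \<tau> * (a / 2 * ((W x)\<^sup>2 * (norm x)\<^sup>2) + 2 / a * h)"
      proof -
        define X where "X = sqrt (a / 2) * (\<bar>W x\<bar> * norm x)"
        define Y where "Y = sqrt (2 / a) * sqrt h"
        have "X * Y = (sqrt (a / 2) * sqrt (2 / a)) * (\<bar>W x\<bar> * norm x * sqrt h)"
          unfolding X_def Y_def by (simp only: mult_ac)
        moreover have "sqrt (a / 2) * sqrt (2 / a) = 1"
          using a_pos by (simp flip: real_sqrt_mult)
        ultimately have XY: "X * Y = \<bar>W x\<bar> * norm x * sqrt h" by simp
        have X2: "X\<^sup>2 = a / 2 * ((W x)\<^sup>2 * (norm x)\<^sup>2)"
          unfolding X_def using a_pos by (simp add: power_mult_distrib)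
        have Y2: "Y\<^sup>2 = 2 / a * h"
          unfolding Y_def using a_pos h(2) by (simp add: power_mult_distrib)
        have "2 * (X * Y) \<le> X\<^sup>2 + Y\<^sup>2"
          using sum_squares_bound[of X Y] by simp
        then have "2 * (\<bar>W x\<bar> * norm x * sqrt h) \<le> a / 2 * ((W x)\<^sup>2 * (norm x)\<^sup>2) + 2 / a * h"
          unfolding XY X2 Y2 .
        from mult_left_mono[OF this, of \<tau>] show ?thesis using \<tau> by (simp add: mult_ac)
      qed
      also have "\<dots> \<le> \<tau> * (1 / 2 * ((W x)\<^sup>2 * q x) + 2 / a * h)"
      proof -
        have "(W x)\<^sup>2 * (a * (norm x)\<^sup>2) \<le> (W x)\<^sup>2 * q x"
          using q_coercive[of x] by (intro mult_left_mono) auto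
        then show ?thesis using \<tau> by (intro mult_left_mono add_right_mono) (auto simp: mult_ac)
      qed
      finally have cross: "2 * (\<bar>W x\<bar> * \<bar>W x - ?w\<bar>) \<le> \<tau> * (1 / 2 * ((W x)\<^sup>2 * q x) + 2 / a * h)" .
      have "(W x)\<^sup>2 = ?w\<^sup>2 + 2 * (W x * (W x - ?w)) - (W x - ?w)\<^sup>2"
        by (simp add: power2_eq_square algebra_simps)
      also have "\<dots> \<le> ?w\<^sup>2 + 2 * (\<bar>W x\<bar> * \<bar>W x - ?w\<bar>)"
        using abs_ge_self[of "W x * (W x - ?w)"] zero_le_power2[of "W x - ?w"]
        unfolding abs_mult by linarith
      finally have "(W x)\<^sup>2 \<le> ?w\<^sup>2 + \<tau> * (1 / 2 * ((W x)\<^sup>2 * q x) + 2 / a * h)"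
        using cross by linarith
      from mult_right_mono[OF this, of "m x"]
      have "(W x)\<^sup>2 * m x \<le> ?w\<^sup>2 * m x + \<tau> / 2 * ((W x)\<^sup>2 * m x * q x) + 2 * \<tau> / a * (m x * h)"
        using m_pos[of x] by (simp add: algebra_simps)
      then have "ennreal ((W x)\<^sup>2 * m x) \<le> ennreal (?w\<^sup>2 * m x + \<tau> / 2 * ((W x)\<^sup>2 * m x * q x) + 2 * \<tau> / a * (m x * h))"
        by (rule ennreal_leI)
      also have "\<dots> = ennreal (?w\<^sup>2 * m x) + ennreal (\<tau> / 2) * ennreal ((W x)\<^sup>2 * m x * q x)
          + ennreal (2 * \<tau> / a) * (ennreal (m x) * H x)"
      proof -
        have "0 \<le> ?w\<^sup>2 * m x" "0 \<le> (W x)\<^sup>2 * m x * q x" "0 \<le> m x * h" "0 \<le> 2 * \<tau> / a" "0 \<le> \<tau> / 2" "0 \<le> m x"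
          using m_pos[of x] q_nonneg[of x] h(2) \<tau> a_pos by auto
        then show ?thesis
          unfolding h(1) using h(2) by (simp only: ennreal_plus ennreal_mult add_nonneg_nonneg mult_nonneg_nonneg)
      qed
      finally show ?thesis .
    qed
  qed

  define T1 where "T1 = (\<integral>\<^sup>+x\<in>?B. ennreal ((W ((1 / (1 + \<tau>)) *\<^sub>R x))\<^sup>2 * m x) \<partial>lborel)"
  define T3 where "T3 = (\<integral>\<^sup>+x\<in>?B. (ennreal (m x) * H x) \<partial>lborel)"
  have main: "\<alpha> \<le> T1 + ennreal (\<tau> / 2) * \<beta> + ennreal (2 * \<tau> / a) * T3"
  proof -
    have "\<alpha> = (\<integral>\<^sup>+x. ennreal ((W x)\<^sup>2 * m x) \<partial>restrict_space lborel ?B)"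
      unfolding \<alpha>_def by (rule nn_integral_restrict_space[symmetric]) simp
    also have "\<dots> \<le> (\<integral>\<^sup>+x. ennreal ((W ((1 / (1 + \<tau>)) *\<^sub>R x))\<^sup>2 * m x) + ennreal (\<tau> / 2) * ennreal ((W x)\<^sup>2 * m x * q x)
        + ennreal (2 * \<tau> / a) * (ennreal (m x) * H x) \<partial>restrict_space lborel ?B)"
      by (rule nn_integral_mono_AE) (rule pw)
    also have "\<dots> = (\<integral>\<^sup>+x. ennreal ((W ((1 / (1 + \<tau>)) *\<^sub>R x))\<^sup>2 * m x) * indicator ?B x
        + ennreal (\<tau> / 2) * (ennreal ((W x)\<^sup>2 * m x * q x) * indicator ?B x)
        + ennreal (2 * \<tau> / a) * (ennreal (m x) * H x * indicator ?B x) \<partial>lborel)"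
      by (subst nn_integral_restrict_space) (auto intro!: nn_integral_cong simp: indicator_def)
    also have "\<dots> = T1 + ennreal (\<tau> / 2) * \<beta> + ennreal (2 * \<tau> / a) * T3"
      unfolding T1_def T3_def \<beta>_def by (simp add: nn_integral_add nn_integral_cmult)
    finally show ?thesis .
  qed

  \<comment> \<open>Substituting \<open>(1 + \<tau>) x\<close> brings in the dilation factor. The
    preimage of the ball lies in the ball, so extending the domain to the whole ball only increases
    the bound.\<close>
  have T1: "T1 + ennreal \<tau> * \<beta> \<le> ennreal (1 + K1 / 2 * \<tau>) * \<alpha>"
  proof -
    have "T1 = ennreal ((1 + \<tau>) ^ DIM('a)) * (\<integral>\<^sup>+x. ennreal ((W x)\<^sup>2 * m ((1 + \<tau>) *\<^sub>R x)) * indicator ?B ((1 + \<tau>) *\<^sub>R x) \<partial>lborel)"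
    proof -
      define f where "f = (\<lambda>x. ennreal ((W ((1 / (1 + \<tau>)) *\<^sub>R x))\<^sup>2 * m x) * indicator ?B x)"
      have [measurable]: "f \<in> borel_measurable borel" unfolding f_def by measurable
      have "f (0 + (1 + \<tau>) *\<^sub>R x) = ennreal ((W x)\<^sup>2 * m ((1 + \<tau>) *\<^sub>R x)) * indicator ?B ((1 + \<tau>) *\<^sub>R x)" for x
        using \<tau> by (simp add: f_def)
      then show ?thesis
        using nn_integral_lborel_affine[of f "1 + \<tau>" 0] \<tau>
        by (simp add: T1_def f_def[symmetric] ennreal_power del: ennreal_plus)
    qed
    also have "\<dots> \<le> ennreal ((1 + \<tau>) ^ DIM('a)) * (\<integral>\<^sup>+x\<in>?B. ennreal ((W x)\<^sup>2 * m x * exp (\<tau> * (A - 2 * q x))) \<partial>lborel)"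
    proof (intro mult_left_mono nn_integral_mono)
      fix x :: 'a
      have "norm x \<le> norm ((1 + \<tau>) *\<^sub>R x)"
        using \<tau> mult_right_mono[of 1 "1 + \<tau>" "norm x"] by simp
      moreover have "(W x)\<^sup>2 * m ((1 + \<tau>) *\<^sub>R x) \<le> (W x)\<^sup>2 * m x * exp (\<tau> * (A - 2 * q x))"
        using mult_left_mono[OF dilation[of \<tau> x], of "(W x)\<^sup>2"] \<tau> by (simp add: mult.assoc)
      ultimately show "ennreal ((W x)\<^sup>2 * m ((1 + \<tau>) *\<^sub>R x)) * indicator ?B ((1 + \<tau>) *\<^sub>R x)
          \<le> ennreal ((W x)\<^sup>2 * m x * exp (\<tau> * (A - 2 * q x))) * indicator ?B x"
        by (auto simp: indicator_def intro: ennreal_leI)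
    qed simp
    finally have "T1 + ennreal \<tau> * \<beta> \<le> ennreal ((1 + \<tau>) ^ DIM('a)) * (\<integral>\<^sup>+x\<in>?B. ennreal ((W x)\<^sup>2 * m x * exp (\<tau> * (A - 2 * q x))) \<partial>lborel)
        + ennreal \<tau> * \<beta>"
      by (rule add_right_mono)
    also have "\<dots> = (\<integral>\<^sup>+x. ennreal ((1 + \<tau>) ^ DIM('a)) * (ennreal ((W x)\<^sup>2 * m x * exp (\<tau> * (A - 2 * q x))) * indicator ?B x)
        + ennreal \<tau> * (ennreal ((W x)\<^sup>2 * m x * q x) * indicator ?B x) \<partial>lborel)"
      unfolding \<beta>_def by (simp add: nn_integral_add nn_integral_cmult)
    also have "\<dots> \<le> (\<integral>\<^sup>+x. ennreal (1 + K1 / 2 * \<tau>) * (ennreal ((W x)\<^sup>2 * m x) * indicator ?B x) \<partial>lborel)"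
    proof (rule nn_integral_mono)
      fix x :: 'a
      show "ennreal ((1 + \<tau>) ^ DIM('a)) * (ennreal ((W x)\<^sup>2 * m x * exp (\<tau> * (A - 2 * q x))) * indicator ?B x)
          + ennreal \<tau> * (ennreal ((W x)\<^sup>2 * m x * q x) * indicator ?B x)
          \<le> ennreal (1 + K1 / 2 * \<tau>) * (ennreal ((W x)\<^sup>2 * m x) * indicator ?B x)"
      proof (cases "x \<in> ?B")
        case True
        define w where "w = (W x)\<^sup>2 * m x"
        have "w \<ge> 0" using m_pos[of x] by (simp add: w_def)
        have "((1 + \<tau>) ^ DIM('a) * exp (\<tau> * (A - 2 * q x)) + \<tau> * q x) * w \<le> (1 + K1 / 2 * \<tau>) * w"
          using dilation_factor[of \<tau> x] \<tau> \<tau>q[OF True] \<open>w \<ge> 0\<close> by (intro mult_right_mono) auto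
        then have "(1 + \<tau>) ^ DIM('a) * (w * exp (\<tau> * (A - 2 * q x))) + \<tau> * (w * q x) \<le> (1 + K1 / 2 * \<tau>) * w"
          by (simp add: algebra_simps)
        then have "ennreal ((1 + \<tau>) ^ DIM('a) * (w * exp (\<tau> * (A - 2 * q x))) + \<tau> * (w * q x)) \<le> ennreal ((1 + K1 / 2 * \<tau>) * w)"
          by (rule ennreal_leI)
        moreover have "ennreal ((1 + \<tau>) ^ DIM('a) * (w * exp (\<tau> * (A - 2 * q x))) + \<tau> * (w * q x))
            = ennreal ((1 + \<tau>) ^ DIM('a)) * ennreal (w * exp (\<tau> * (A - 2 * q x))) + ennreal \<tau> * ennreal (w * q x)"
          using \<tau> \<open>w \<ge> 0\<close> q_nonneg[of x]
          by (simp only: ennreal_plus ennreal_mult mult_nonneg_nonneg zero_le_power add_nonneg_nonneg exp_ge_zero less_imp_le zero_le_one)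
        moreover have "ennreal ((1 + K1 / 2 * \<tau>) * w) = ennreal (1 + K1 / 2 * \<tau>) * ennreal w"
          using \<tau> K_nonneg \<open>w \<ge> 0\<close> by (intro ennreal_mult) auto
        ultimately show ?thesis using True unfolding w_def by simp
      qed simp
    qed
    also have "\<dots> = ennreal (1 + K1 / 2 * \<tau>) * \<alpha>"
      unfolding \<alpha>_def by (rule nn_integral_cmult) measurable
    finally show ?thesis .
  qed

  \<comment> \<open>For each time the contraction by \<open>c = \<theta> s\<close> is undone. The
    weight at \<open>y / c\<close> is at most \<open>exp A\<close> times the weight at
    \<open>y\<close>, because \<open>q\<close> is nonnegative.\<close>
  have T3: "T3 \<le> ennreal (2 ^ DIM('a) * exp A) * E"
  proof -
    have "T3 = (\<integral>\<^sup>+x. (\<integral>\<^sup>+s. ennreal (m x) * indicator ?B x * ennreal (G (\<theta> s *\<^sub>R x)) \<partial>L) \<partial>lborel)"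
    proof -
      have ms: "(\<lambda>s. ennreal (G (\<theta> s *\<^sub>R x))) \<in> borel_measurable L" for x
        using measurable_compose[OF id_L, of "\<lambda>s. ennreal (G (\<theta> s *\<^sub>R x))" borel] by simp
      show ?thesis
        unfolding T3_def H_def
        by (intro nn_integral_cong) (subst nn_integral_cmult[OF ms], simp add: mult_ac)
    qed
    also have "\<dots> = (\<integral>\<^sup>+s. (\<integral>\<^sup>+x. ennreal (m x) * indicator ?B x * ennreal (G (\<theta> s *\<^sub>R x)) \<partial>lborel) \<partial>L)"
    proof (rule PL.Fubini'[symmetric])
      show "(\<lambda>(x, s). ennreal (m x) * indicator ?B x * ennreal (G (\<theta> s *\<^sub>R x))) \<in> borel_measurable ((lborel :: 'a measure) \<Otimes>\<^sub>M L)"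
        unfolding split_beta' by measurable
    qed
    also have "\<dots> \<le> (\<integral>\<^sup>+s. ennreal (2 ^ DIM('a) * exp A) * E \<partial>L)"
    proof (rule nn_integral_mono)
      fix s assume "s \<in> space L"
      then have s: "0 \<le> s" "s \<le> 1" by (auto simp: L_space)
      define c where "c = \<theta> s"
      have c: "1 / 2 \<le> c" "c \<le> 1" using \<theta>[OF s] by (auto simp: c_def)
      define f where "f = (\<lambda>y. ennreal (m ((1 / c) *\<^sub>R y)) * indicator ?B ((1 / c) *\<^sub>R y) * ennreal (G y))"
      have [measurable]: "f \<in> borel_measurable borel" unfolding f_def by measurable
      have "(\<integral>\<^sup>+x. ennreal (m x) * indicator ?B x * ennreal (G (c *\<^sub>R x)) \<partial>lborel) = (\<integral>\<^sup>+x. f (0 + c *\<^sub>R x) \<partial>lborel)"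
        using c by (simp add: f_def)
      also have "\<dots> \<le> ennreal (2 ^ DIM('a)) * (\<integral>\<^sup>+y. f y \<partial>lborel)"
        by (rule nn_integral_lborel_affine_le) (use c in auto)
      also have "\<dots> \<le> ennreal (2 ^ DIM('a)) * (\<integral>\<^sup>+y. ennreal (exp A) * (ennreal (G y * m y) * indicator ?B y) \<partial>lborel)"
      proof (intro mult_left_mono nn_integral_mono)
        fix y :: 'a
        have "norm y \<le> norm ((1 / c) *\<^sub>R y)"
          using c mult_right_mono[of 1 "1 / c" "norm y"] by simp
        moreover have "m ((1 / c) *\<^sub>R y) * G y \<le> exp A * (G y * m y)"
        proof -
          define t where "t = 1 / c - 1"
          have t: "0 \<le> t" "t \<le> 1" using c by (auto simp: t_def field_simps)
          have "m ((1 / c) *\<^sub>R y) \<le> m y * exp (t * (A - 2 * q y))"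
            using dilation[OF t, of y] by (simp add: t_def)
          also have "t * (A - 2 * q y) \<le> t * A"
            using t q_nonneg[of y] by (intro mult_left_mono) auto
          then have "m y * exp (t * (A - 2 * q y)) \<le> m y * exp A"
            using t A_nonneg m_pos[of y] mult_right_mono[of t 1 A] by (intro mult_left_mono) auto
          finally have "m ((1 / c) *\<^sub>R y) \<le> m y * exp A" .
          from mult_right_mono[OF this G_nonneg[of y]] show ?thesis by (simp add: mult_ac)
        qed
        ultimately show "f y \<le> ennreal (exp A) * (ennreal (G y * m y) * indicator ?B y)"
          using G_nonneg[of y] m_pos[of y] m_pos[of "(1 / c) *\<^sub>R y"]
          by (auto simp: f_def indicator_def simp flip: ennreal_mult intro!: ennreal_leI)
      qed simp
      also have "\<dots> = ennreal (2 ^ DIM('a) * exp A) * E"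
        unfolding E_def by (subst nn_integral_cmult) (auto simp: ennreal_mult mult.assoc)
      finally show "(\<integral>\<^sup>+x. ennreal (m x) * indicator ?B x * ennreal (G (\<theta> s *\<^sub>R x)) \<partial>lborel) \<le> ennreal (2 ^ DIM('a) * exp A) * E"
        unfolding c_def .
    qed
    also have "\<dots> = ennreal (2 ^ DIM('a) * exp A) * E" by (simp add: L1)
    finally show ?thesis .
  qed

  have \<alpha>_fin: "\<alpha> < \<infinity>" using fin unfolding \<alpha>_def W_def .
  \<comment> \<open>Finiteness permits cancelling half of \<open>\<beta>\<close> in the final step;
    on the ball it follows from the bound on \<open>q\<close>.\<close>
  have \<beta>_fin: "\<beta> < \<infinity>"
  proof -
    have "\<beta> \<le> (\<integral>\<^sup>+x. ennreal Qb * (ennreal ((W x)\<^sup>2 * m x) * indicator ?B x) \<partial>lborel)"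
      unfolding \<beta>_def
    proof (rule nn_integral_mono)
      fix x :: 'a
      show "ennreal ((W x)\<^sup>2 * m x * q x) * indicator ?B x \<le> ennreal Qb * (ennreal ((W x)\<^sup>2 * m x) * indicator ?B x)"
        using Qb(1) Qb(2)[of x] m_pos[of x]
        by (auto simp: indicator_def simp flip: ennreal_mult intro!: ennreal_leI simp: mult.commute[of Qb] mult_left_mono)
    qed
    also have "\<dots> = ennreal Qb * \<alpha>"
      unfolding \<alpha>_def by (rule nn_integral_cmult) measurable
    also have "\<dots> < \<infinity>" using \<alpha>_fin by (simp add: ennreal_mult_less_top)
    finally show ?thesis .
  qed
  have "\<beta> \<le> ennreal K1 * \<alpha> + ennreal K2 * E"
  proof (cases "E = \<infinity>")
    case True
    have "K2 > 0" unfolding K2_def using a_pos by simp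
    then have "ennreal K2 * E = \<infinity>" using True by (simp add: ennreal_mult_top)
    then show ?thesis by simp
  next
    case False
    obtain x y z where x: "\<alpha> = ennreal x" "x \<ge> 0" and y: "\<beta> = ennreal y" "y \<ge> 0" and z: "E = ennreal z" "z \<ge> 0"
      using \<alpha>_fin \<beta>_fin False by (cases \<alpha>; cases \<beta>; cases E) auto
    define D where "D = 2 ^ DIM('a) * exp A"
    have D: "D \<ge> 0" by (simp add: D_def)
    have "\<alpha> + ennreal \<tau> * \<beta> \<le> (T1 + ennreal \<tau> * \<beta>) + ennreal (\<tau> / 2) * \<beta> + ennreal (2 * \<tau> / a) * T3"
      using add_right_mono[OF main, of "ennreal \<tau> * \<beta>"] by (simp add: add_ac)
    also have "\<dots> \<le> ennreal (1 + K1 / 2 * \<tau>) * \<alpha> + ennreal (\<tau> / 2) * \<beta> + ennreal (2 * \<tau> / a) * (ennreal D * E)"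
      using T1 T3 by (intro add_mono mult_left_mono) (auto simp: D_def)
    finally have le: "\<alpha> + ennreal \<tau> * \<beta> \<le> ennreal (1 + K1 / 2 * \<tau>) * \<alpha> + ennreal (\<tau> / 2) * \<beta> + ennreal (2 * \<tau> / a) * (ennreal D * E)" .
    have eq: "ennreal p * ennreal x + ennreal r * ennreal y + ennreal s * (ennreal D * ennreal z) = ennreal (p * x + r * y + s * (D * z))"
      if "p \<ge> 0" "r \<ge> 0" "s \<ge> 0" for p r s
      using that x(2) y(2) z(2) D by (simp add: ennreal_mult)
    have "ennreal (x + \<tau> * y) \<le> ennreal ((1 + K1 / 2 * \<tau>) * x + \<tau> / 2 * y + 2 * \<tau> / a * (D * z))"
    proof -
      have "ennreal (x + \<tau> * y) = ennreal x + ennreal \<tau> * ennreal y"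
        using x(2) y(2) \<tau> by (simp add: ennreal_mult)
      then show ?thesis
        using le unfolding x(1) y(1) z(1) using \<tau> a_pos K_nonneg by (subst (asm) eq) auto
    qed
    then have "x + \<tau> * y \<le> (1 + K1 / 2 * \<tau>) * x + \<tau> / 2 * y + 2 * \<tau> / a * (D * z)"
      using x y z D \<tau> a_pos K_nonneg by (subst (asm) ennreal_le_iff) auto
    \<comment> \<open>The leading terms \<open>x\<close> cancel and everything left is proportional
      to \<open>\<tau>\<close>, so one fixed step suffices in place of a limit.\<close>
    then have "\<tau> * y \<le> \<tau> * (K1 * x + K2 * z)"
      unfolding K2_def D_def[symmetric] using a_pos by (simp add: field_simps)
    then have "y \<le> K1 * x + K2 * z" using \<tau> by simp
    then show ?thesis
      using x y z K_nonneg by (simp flip: ennreal_mult ennreal_plus add: ennreal_leI)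
  qed
  then show ?thesis unfolding \<alpha>_def \<beta>_def E_def W_def G_def .
qed

end

section \<open>From balls to the whole space\<close>

lemma exists_nn_integral_le_average:
  fixes h :: "'w \<Rightarrow> ennreal"
  assumes "finite_measure M" and [measurable]: "h \<in> borel_measurable M"
    and pos: "emeasure M (space M) \<noteq> 0" and "t \<noteq> \<infinity>"
    and le: "(\<integral>\<^sup>+x. h x \<partial>M) \<le> t * emeasure M (space M)"
  shows "\<exists>x\<in>space M. h x \<le> t"
proof (rule ccontr)
  interpret finite_measure M by fact
  assume "\<not> ?thesis"
  then have gt: "t < h x" if "x \<in> space M" for x using that by auto
  have "(\<integral>\<^sup>+x. t \<partial>M) + (\<integral>\<^sup>+x. (h x - t) \<partial>M) = (\<integral>\<^sup>+x. t + (h x - t) \<partial>M)"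
    by (rule nn_integral_add[symmetric]) measurable
  also have "\<dots> = (\<integral>\<^sup>+x. h x \<partial>M)"
    using gt by (intro nn_integral_cong) (auto simp: add_diff_inverse_ennreal less_imp_le)
  also have "\<dots> \<le> (\<integral>\<^sup>+x. t \<partial>M) + 0" using le by simp
  finally have "(\<integral>\<^sup>+x. (h x - t) \<partial>M) \<le> 0"
    using \<open>t \<noteq> \<infinity>\<close> by (subst (asm) ennreal_add_left_cancel_le) (auto simp: ennreal_mult_eq_top_iff)
  then have "AE x in M. h x - t = 0"
    by (subst nn_integral_0_iff_AE[symmetric]) auto
  then have "AE x in M. False"
    using AE_space
  proof eventually_elim
    case (elim x)
    then show False using gt[of x] by (auto simp: diff_eq_0_iff_ennreal)
  qed
  then have "emeasure M (space M) = 0"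
    by (subst (asm) AE_iff_measurable[of "space M"]) auto
  then show False using pos by simp
qed

context dilation_weight
begin

text \<open>\<open>K1\<close> and \<open>K2\<close> are independent of the radius, so the estimates
  on balls pass to the whole space by monotone convergence.\<close>

lemma moment:
  fixes u :: "'a \<Rightarrow> real"
  assumes ug: "weak_gradient u g"
    and F: "\<And>t. (F has_real_derivative F' t) (at t)" "continuous_on UNIV F'"
    and fin: "(\<integral>\<^sup>+x. ennreal ((F (u x))\<^sup>2 * m x) \<partial>lborel) < \<infinity>"
  shows "(\<integral>\<^sup>+x. ennreal ((F (u x))\<^sup>2 * m x * q x) \<partial>lborel)
    \<le> ennreal K1 * (\<integral>\<^sup>+x. ennreal ((F (u x))\<^sup>2 * m x) \<partial>lborel)
      + ennreal K2 * (\<integral>\<^sup>+x. ennreal ((F' (u x))\<^sup>2 * (norm (g x))\<^sup>2 * m x) \<partial>lborel)"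
    (is "?l \<le> ?r")
proof (rule nn_integral_le_if_cball_le)
  have [measurable]: "u \<in> borel_measurable borel"
    using ug unfolding weak_gradient_def by (auto intro: locally_integrable_measurable)
  have [measurable]: "F \<in> borel_measurable borel"
    using F(1) by (intro borel_measurable_continuous_onI) (meson DERIV_isCont continuous_at_imp_continuous_on)
  show "(\<lambda>x. ennreal ((F (u x))\<^sup>2 * m x * q x)) \<in> borel_measurable borel" by measurable
  fix n :: nat
  let ?R = "real n + 1"
  have mono: "(\<integral>\<^sup>+x\<in>cball 0 ?R. f x \<partial>lborel) \<le> (\<integral>\<^sup>+x. f x \<partial>lborel)" for f :: "'a \<Rightarrow> ennreal"
    by (intro nn_integral_mono) (auto simp: indicator_def)
  have "(\<integral>\<^sup>+x\<in>cball 0 (real n). ennreal ((F (u x))\<^sup>2 * m x * q x) \<partial>lborel)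
      \<le> (\<integral>\<^sup>+x\<in>cball 0 ?R. ennreal ((F (u x))\<^sup>2 * m x * q x) \<partial>lborel)"
    by (intro nn_integral_mono) (auto simp: indicator_def)
  also have "\<dots> \<le> ennreal K1 * (\<integral>\<^sup>+x\<in>cball 0 ?R. ennreal ((F (u x))\<^sup>2 * m x) \<partial>lborel)
      + ennreal K2 * (\<integral>\<^sup>+x\<in>cball 0 ?R. ennreal ((F' (u x))\<^sup>2 * (norm (g x))\<^sup>2 * m x) \<partial>lborel)"
    by (rule moment_cball[OF ug _ F le_less_trans[OF mono fin]]) simp
  also have "\<dots> \<le> ?r"
    by (intro add_mono mult_left_mono mono) auto
  finally show "(\<integral>\<^sup>+x\<in>cball 0 (real n). ennreal ((F (u x))\<^sup>2 * m x * q x) \<partial>lborel) \<le> ?r" .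
qed

text \<open>On a large ball \<open>m\<close> is comparable to Lebesgue measure and the ball
  inequality applies. Outside it \<open>q\<close> is so large that the moment inequality bounds the
  tail by the gradient term plus less than half of the whole integral, and that part is
  absorbed.\<close>

lemma poincare:
  assumes m_fin: "(\<integral>\<^sup>+x. ennreal (m x) \<partial>lborel) < \<infinity>"
  shows "\<exists>K\<ge>0. \<forall>u g F F'. weak_gradient u g \<longrightarrow> (\<forall>t. (F has_real_derivative F' t) (at t)) \<longrightarrow>
    continuous_on UNIV F' \<longrightarrow> (\<integral>\<^sup>+x. ennreal ((F (u x))\<^sup>2 * m x) \<partial>lborel) < \<infinity> \<longrightarrow>
    (\<exists>c. (\<integral>\<^sup>+x. ennreal ((F (u x) - c)\<^sup>2 * m x) \<partial>lborel)
      \<le> ennreal K * (\<integral>\<^sup>+x. ennreal ((F' (u x))\<^sup>2 * (norm (g x))\<^sup>2 * m x) \<partial>lborel))"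
proof -
  \<comment> \<open>Beyond this radius coercivity gives
    \<open>q x \<ge> 2 * (K1 + 1)\<close>.\<close>
  define R where "R = sqrt (2 * (K1 + 1) / a)"
  have "R > 0" using a_pos K_nonneg by (simp add: R_def)
  have R2: "a * R\<^sup>2 = 2 * (K1 + 1)" using a_pos K_nonneg by (simp add: R_def)
  have q_out: "2 * (K1 + 1) \<le> q x" if "x \<notin> cball 0 R" for x
  proof -
    have "R\<^sup>2 \<le> (norm x)\<^sup>2" using that \<open>R > 0\<close> by (intro power_mono) auto
    then have "a * R\<^sup>2 \<le> a * (norm x)\<^sup>2" using a_pos by simp
    then show ?thesis using q_coercive[of x] R2 by linarith
  qed
  let ?B = "cball (0::'a) R"
  have [measurable]: "?B \<in> sets borel" by simp
  obtain mlo mhi where mlo: "mlo > 0" and m: "\<And>x. x \<in> ?B \<Longrightarrow> mlo \<le> m x \<and> m x \<le> mhi"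
    using m_bounded by blast
  have "mhi > 0" using m[of 0] mlo \<open>R > 0\<close> by auto
  define V where "V = measure lborel ?B"
  have V: "emeasure lborel ?B = ennreal V"
    unfolding V_def using emeasure_compact_finite[of ?B] by (intro emeasure_eq_ennreal_measure) auto
  have "V > 0"
  proof -
    have "emeasure lborel ?B \<noteq> 0"
    proof
      assume "emeasure lborel ?B = 0"
      then have "?B \<in> null_sets lborel" by auto
      then have "negligible ?B" unfolding negligible_iff_null_sets by (rule null_sets_completionI)
      then have "negligible (ball (0::'a) R)" by (rule negligible_subset) auto
      then show False using open_not_negligible[of "ball (0::'a) R"] \<open>R > 0\<close> by simp
    qed
    then have "V \<noteq> 0" using V by auto
    moreover have "V \<ge> 0" by (simp add: V_def)
    ultimately show ?thesis by simp
  qed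
  define Kp where "Kp = (2 * R)\<^sup>2 * 2 ^ DIM('a)"
  have "Kp \<ge> 0" by (simp add: Kp_def)
  \<comment> \<open>The contributions of the ball and of the tail, doubled by the
    absorption.\<close>
  define K where "K = 2 * (mhi * Kp / mlo + K2 / (2 * (K1 + 1)))"
  have "mhi * Kp / mlo > 0" using \<open>mhi > 0\<close> mlo \<open>R > 0\<close> by (simp add: Kp_def)
  moreover have "K2 / (2 * (K1 + 1)) \<ge> 0" using K_nonneg by simp
  ultimately have "K > 0" unfolding K_def by (intro mult_pos_pos add_pos_nonneg) auto
  then have "K \<ge> 0" by simp
  have main: "\<exists>c. (\<integral>\<^sup>+x. ennreal ((F (u x) - c)\<^sup>2 * m x) \<partial>lborel)
      \<le> ennreal K * (\<integral>\<^sup>+x. ennreal ((F' (u x))\<^sup>2 * (norm (g x))\<^sup>2 * m x) \<partial>lborel)"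
    if ug: "weak_gradient u g" and F1: "\<forall>t. (F has_real_derivative F' t) (at t)"
      and F2: "continuous_on UNIV F'" and fin: "(\<integral>\<^sup>+x. ennreal ((F (u x))\<^sup>2 * m x) \<partial>lborel) < \<infinity>"
    for u g F F'
  proof -
    have [measurable]: "u \<in> borel_measurable borel" "g \<in> borel_measurable borel"
      using ug unfolding weak_gradient_def by (auto intro: locally_integrable_measurable)
    have [measurable]: "F \<in> borel_measurable borel"
      using F1 by (intro borel_measurable_continuous_onI) (meson DERIV_isCont continuous_at_imp_continuous_on)
    have [measurable]: "F' \<in> borel_measurable borel"
      using F2 by (rule borel_measurable_continuous_onI)
    define G where "G = (\<lambda>x. (F' (u x))\<^sup>2 * (norm (g x))\<^sup>2)"
    have [measurable]: "G \<in> borel_measurable borel" unfolding G_def by measurable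
    have G_nonneg: "G x \<ge> 0" for x by (simp add: G_def)
    define E where "E = (\<integral>\<^sup>+x. ennreal (G x * m x) \<partial>lborel)"
    define EB where "EB = (\<integral>\<^sup>+x\<in>?B. ennreal (G x) \<partial>lborel)"
    have EB: "EB \<le> ennreal (1 / mlo) * E"
    proof -
      have "EB \<le> (\<integral>\<^sup>+x. ennreal (1 / mlo) * ennreal (G x * m x) \<partial>lborel)"
        unfolding EB_def
      proof (rule nn_integral_mono)
        fix x :: 'a
        show "ennreal (G x) * indicator ?B x \<le> ennreal (1 / mlo) * ennreal (G x * m x)"
        proof (cases "x \<in> ?B")
          case True
          have "G x * mlo \<le> G x * m x" using m[OF True] G_nonneg by (intro mult_left_mono) auto
          then have "G x \<le> 1 / mlo * (G x * m x)" using mlo by (simp add: field_simps)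
          then show ?thesis using True mlo G_nonneg[of x] m_pos[of x]
            by (simp flip: ennreal_mult add: ennreal_leI)
        qed simp
      qed
      also have "\<dots> = ennreal (1 / mlo) * E"
        unfolding E_def by (rule nn_integral_cmult) measurable
      finally show ?thesis .
    qed
    show ?thesis
    proof (cases "E = \<infinity>")
      case True
      then have "ennreal K * E = \<infinity>" using \<open>K > 0\<close> by (simp add: ennreal_mult_top)
      then show ?thesis unfolding E_def G_def by simp
    next
      case False
      have "EB < \<infinity>"
      proof -
        have "ennreal (1 / mlo) * E < \<infinity>" using False by (simp add: ennreal_mult_less_top less_top)
        then show ?thesis using EB by (rule le_less_trans[rotated])
      qed
      define M where "M = restrict_space lborel ?B"
      have M_int: "(\<integral>\<^sup>+x. h x \<partial>M) = (\<integral>\<^sup>+x\<in>?B. h x \<partial>lborel)" for h :: "'a \<Rightarrow> ennreal"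
        unfolding M_def by (rule nn_integral_restrict_space) simp
      have M_space: "space M = ?B" unfolding M_def by (simp add: space_restrict_space)
      have M_em: "emeasure M (space M) = ennreal V"
        unfolding M_space V[symmetric] unfolding M_def by (subst emeasure_restrict_space) auto
      have M_fin: "finite_measure M" by (rule finite_measureI) (simp add: M_em)
      define h where "h = (\<lambda>y. \<integral>\<^sup>+x\<in>?B. ennreal ((F (u x) - F (u y))\<^sup>2) \<partial>lborel)"
      have [measurable]: "h \<in> borel_measurable borel"
      proof -
        have "(\<lambda>z. ennreal ((F (u (snd z)) - F (u (fst z)))\<^sup>2) * indicator ?B (snd z)) \<in> borel_measurable (borel \<Otimes>\<^sub>M lborel)"
          by measurable
        from lborel.borel_measurable_nn_integral_fst[OF this] show ?thesis unfolding h_def by simp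
      qed
      have "(\<integral>\<^sup>+y\<in>?B. h y \<partial>lborel) \<le> ennreal (Kp * V) * EB"
        using poincare_double_integral_cball[OF ug _ F1[rule_format] F2, of R] \<open>R > 0\<close>
        unfolding h_def EB_def G_def Kp_def V_def by (simp add: mult.assoc)
      also have "\<dots> = (ennreal Kp * EB) * emeasure M (space M)"
        unfolding M_em using \<open>Kp \<ge> 0\<close> \<open>V > 0\<close> by (simp add: ennreal_mult mult_ac)
      finally have le: "(\<integral>\<^sup>+y. h y \<partial>M) \<le> (ennreal Kp * EB) * emeasure M (space M)"
        unfolding M_int .
      \<comment> \<open>One of the two points of the double integral is frozen where the inner
        integral is no worse than its mean; its value \<open>F (u y)\<close> becomes the
        constant.\<close>
      have "\<exists>y\<in>space M. h y \<le> ennreal Kp * EB"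
      proof (rule exists_nn_integral_le_average[OF M_fin _ _ _ le])
        show "h \<in> borel_measurable M" unfolding M_def by (intro measurable_restrict_space1) simp
        show "emeasure M (space M) \<noteq> 0" unfolding M_em using \<open>V > 0\<close> by simp
        show "ennreal Kp * EB \<noteq> \<infinity>" using \<open>EB < \<infinity>\<close> by (simp add: ennreal_mult_eq_top_iff)
      qed
      then obtain y where y: "h y \<le> ennreal Kp * EB" by blast
      define c where "c = F (u y)"
      define F0 where "F0 = (\<lambda>t. F t - c)"
      have F0: "\<And>t. (F0 has_real_derivative F' t) (at t)"
        unfolding F0_def using F1 by (auto intro!: derivative_eq_intros)
      have [measurable]: "F0 \<in> borel_measurable borel" unfolding F0_def by measurable
      define I where "I = (\<integral>\<^sup>+x. ennreal ((F0 (u x))\<^sup>2 * m x) \<partial>lborel)"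
      \<comment> \<open>Finiteness enters twice: in the moment inequality for \<open>F0\<close> and
        in the absorption of \<open>I\<close>. The finite mass of \<open>m\<close> pays for
        subtracting the constant.\<close>
      have I_fin: "I < \<infinity>"
      proof -
        have "I \<le> (\<integral>\<^sup>+x. ennreal 2 * ennreal ((F (u x))\<^sup>2 * m x) + ennreal (2 * c\<^sup>2) * ennreal (m x) \<partial>lborel)"
          unfolding I_def
        proof (rule nn_integral_mono)
          fix x :: 'a
          have "0 \<le> (F (u x) + c)\<^sup>2" by simp
          then have "(F0 (u x))\<^sup>2 \<le> 2 * (F (u x))\<^sup>2 + 2 * c\<^sup>2"
            unfolding F0_def by (simp add: power2_eq_square algebra_simps)
          from mult_right_mono[OF this, of "m x"]
          have "(F0 (u x))\<^sup>2 * m x \<le> 2 * ((F (u x))\<^sup>2 * m x) + 2 * c\<^sup>2 * m x"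
            using m_pos[of x] by (simp add: algebra_simps)
          then have "ennreal ((F0 (u x))\<^sup>2 * m x) \<le> ennreal (2 * ((F (u x))\<^sup>2 * m x) + 2 * c\<^sup>2 * m x)"
            by (rule ennreal_leI)
          also have "\<dots> = ennreal 2 * ennreal ((F (u x))\<^sup>2 * m x) + ennreal (2 * c\<^sup>2) * ennreal (m x)"
            using m_pos[of x] by (subst ennreal_plus) (auto simp: ennreal_mult less_imp_le)
          finally show "ennreal ((F0 (u x))\<^sup>2 * m x) \<le> \<dots>" .
        qed
        also have "\<dots> = ennreal 2 * (\<integral>\<^sup>+x. ennreal ((F (u x))\<^sup>2 * m x) \<partial>lborel) + ennreal (2 * c\<^sup>2) * (\<integral>\<^sup>+x. ennreal (m x) \<partial>lborel)"
          by (simp add: nn_integral_add nn_integral_cmult)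
        also have "\<dots> < \<infinity>" using fin m_fin by (simp add: ennreal_mult_less_top)
        finally show ?thesis .
      qed
      have mom: "(\<integral>\<^sup>+x. ennreal ((F0 (u x))\<^sup>2 * m x * q x) \<partial>lborel) \<le> ennreal K1 * I + ennreal K2 * E"
        using moment[OF ug F0 F2 I_fin[unfolded I_def]] unfolding I_def E_def G_def .
      have inner: "(\<integral>\<^sup>+x\<in>?B. ennreal ((F0 (u x))\<^sup>2 * m x) \<partial>lborel) \<le> ennreal (mhi * Kp / mlo) * E"
      proof -
        have "(\<integral>\<^sup>+x\<in>?B. ennreal ((F0 (u x))\<^sup>2 * m x) \<partial>lborel) \<le> (\<integral>\<^sup>+x. ennreal mhi * (ennreal ((F (u x) - F (u y))\<^sup>2) * indicator ?B x) \<partial>lborel)"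
        proof (rule nn_integral_mono)
          fix x :: 'a
          show "ennreal ((F0 (u x))\<^sup>2 * m x) * indicator ?B x \<le> ennreal mhi * (ennreal ((F (u x) - F (u y))\<^sup>2) * indicator ?B x)"
          proof (cases "x \<in> ?B")
            case True
            have "(F0 (u x))\<^sup>2 * m x \<le> (F0 (u x))\<^sup>2 * mhi" using m[OF True] by (intro mult_left_mono) auto
            then have "ennreal ((F0 (u x))\<^sup>2 * m x) \<le> ennreal (mhi * (F0 (u x))\<^sup>2)" by (intro ennreal_leI) (simp add: mult.commute)
            then show ?thesis using True \<open>mhi > 0\<close> by (simp add: F0_def c_def ennreal_mult)
          qed simp
        qed
        also have "\<dots> = ennreal mhi * h y"
          unfolding h_def by (rule nn_integral_cmult) measurable
        also have "\<dots> \<le> ennreal mhi * (ennreal Kp * (ennreal (1 / mlo) * E))"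
          using y EB by (meson mult_left_mono order_trans zero_le)
        also have "\<dots> = ennreal (mhi * Kp / mlo) * E"
          using \<open>mhi > 0\<close> \<open>Kp \<ge> 0\<close> mlo by (simp add: ennreal_mult[symmetric] mult.assoc[symmetric])
        finally show ?thesis .
      qed
      have outer: "(\<integral>\<^sup>+x. ennreal ((F0 (u x))\<^sup>2 * m x) * indicator (- ?B) x \<partial>lborel)
          \<le> ennreal (1 / (2 * (K1 + 1))) * (ennreal K1 * I + ennreal K2 * E)"
      proof -
        have "(\<integral>\<^sup>+x. ennreal ((F0 (u x))\<^sup>2 * m x) * indicator (- ?B) x \<partial>lborel)
            \<le> (\<integral>\<^sup>+x. ennreal (1 / (2 * (K1 + 1))) * ennreal ((F0 (u x))\<^sup>2 * m x * q x) \<partial>lborel)"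
        proof (rule nn_integral_mono)
          fix x :: 'a
          show "ennreal ((F0 (u x))\<^sup>2 * m x) * indicator (- ?B) x \<le> ennreal (1 / (2 * (K1 + 1))) * ennreal ((F0 (u x))\<^sup>2 * m x * q x)"
          proof (cases "x \<in> ?B")
            case False
            define w where "w = (F0 (u x))\<^sup>2 * m x"
            have "w \<ge> 0" using m_pos[of x] by (simp add: w_def)
            have "w * (2 * (K1 + 1)) \<le> w * q x" using q_out[OF False] \<open>w \<ge> 0\<close> by (intro mult_left_mono) auto
            then have "w \<le> 1 / (2 * (K1 + 1)) * (w * q x)" using K_nonneg by (simp add: field_simps)
            then have "ennreal w \<le> ennreal (1 / (2 * (K1 + 1))) * ennreal (w * q x)"
              using K_nonneg \<open>w \<ge> 0\<close> q_nonneg[of x] by (subst ennreal_mult[symmetric]) (auto intro: ennreal_leI)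
            then show ?thesis using False by (simp add: w_def)
          qed simp
        qed
        also have "\<dots> = ennreal (1 / (2 * (K1 + 1))) * (\<integral>\<^sup>+x. ennreal ((F0 (u x))\<^sup>2 * m x * q x) \<partial>lborel)"
          by (rule nn_integral_cmult) measurable
        also have "\<dots> \<le> ennreal (1 / (2 * (K1 + 1))) * (ennreal K1 * I + ennreal K2 * E)"
          by (intro mult_left_mono mom) simp
        finally show ?thesis .
      qed
      have split: "I = (\<integral>\<^sup>+x\<in>?B. ennreal ((F0 (u x))\<^sup>2 * m x) \<partial>lborel)
          + (\<integral>\<^sup>+x. ennreal ((F0 (u x))\<^sup>2 * m x) * indicator (- ?B) x \<partial>lborel)"
        unfolding I_def by (subst nn_integral_add[symmetric]) (auto intro!: nn_integral_cong simp: indicator_def)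
      have "I \<le> ennreal K * E"
      proof -
        obtain i z where i: "I = ennreal i" "i \<ge> 0" and z: "E = ennreal z" "z \<ge> 0"
          using I_fin False by (cases I; cases E) auto
        define k where "k = 1 / (2 * (K1 + 1))"
        have k: "k \<ge> 0" "k * K1 \<le> 1 / 2" using K_nonneg by (auto simp: k_def field_simps)
        have "I \<le> ennreal (mhi * Kp / mlo) * E + ennreal k * (ennreal K1 * I + ennreal K2 * E)"
          by (rule add_mono[OF inner outer, folded split k_def])
        then have le: "ennreal i \<le> ennreal (mhi * Kp / mlo) * ennreal z + ennreal k * (ennreal K1 * ennreal i + ennreal K2 * ennreal z)"
          unfolding i(1) z(1) .
        have "ennreal p * ennreal z + ennreal k * (ennreal K1 * ennreal i + ennreal K2 * ennreal z) = ennreal (p * z + k * (K1 * i + K2 * z))"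
          if "p \<ge> 0" for p
          using that i(2) z(2) k(1) K_nonneg by (simp add: ennreal_mult)
        from le[unfolded this[OF less_imp_le[OF \<open>mhi * Kp / mlo > 0\<close>]]]
        have "ennreal i \<le> ennreal (mhi * Kp / mlo * z + k * (K1 * i + K2 * z))" .
        then have "i \<le> mhi * Kp / mlo * z + k * (K1 * i + K2 * z)"
          using i z k K_nonneg \<open>mhi > 0\<close> mlo \<open>Kp \<ge> 0\<close> by (subst (asm) ennreal_le_iff) auto
        moreover have "k * K1 * i \<le> 1 / 2 * i" using k(2) i(2) by (rule mult_right_mono)
        moreover have "K * z = 2 * (mhi * Kp / mlo * z) + 2 * (k * K2 * z)"
          unfolding K_def k_def by (simp add: algebra_simps)
        moreover have "k * (K1 * i + K2 * z) = k * K1 * i + k * K2 * z"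
          by (simp add: algebra_simps)
        ultimately have "i \<le> K * z" by linarith
        then show ?thesis using i z \<open>K \<ge> 0\<close> by (simp flip: ennreal_mult add: ennreal_leI)
      qed
      then show ?thesis unfolding I_def E_def G_def F0_def by blast
    qed
  qed
  show ?thesis
    by (rule exI[of _ K], intro conjI allI impI, rule \<open>K \<ge> 0\<close>, rule main; assumption)
qed

end

subsection \<open>Perturbations of uniformly convex potentials\<close>

text \<open>\<open>U\<close> is split into a convex \<open>f\<close> and
  \<open>\<kappa> / 2 * (norm x)^2\<close>. Along rays convexity gives
  \<open>f ((1 + \<tau>) x) - f x >= \<tau> * (f x - f 0)\<close>, and the quadratic part grows by
  at least \<open>\<tau> * \<kappa> * (norm x)^2\<close>. The two lower bounds add up to
  \<open>\<tau> * (q x - C0)\<close>, which explains \<open>q\<close> and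
  \<open>A = 2 * C0\<close>.\<close>

lemma uniformly_convex_dilation_weight:
  fixes U :: "'a::euclidean_space \<Rightarrow> real"
  assumes "uniformly_convex U"
  shows "\<exists>q A a. dilation_weight (\<lambda>x. exp (- 2 * U x)) q A a \<and> (\<exists>c. \<forall>x. U x \<le> q x + c)"
proof -
  obtain \<kappa> where "\<kappa> > 0" and conv: "convex_on UNIV (\<lambda>x. U x - \<kappa> / 2 * (norm x)\<^sup>2)"
    using assms unfolding uniformly_convex_def by blast
  define f where "f = (\<lambda>x. U x - \<kappa> / 2 * (norm x)\<^sup>2)"
  have f_conv: "convex_on UNIV f" using conv unfolding f_def .
  have f_cont: "continuous_on UNIV f"
    using convex_on_continuous[OF open_UNIV f_conv] .
  have U_eq: "U x = f x + \<kappa> / 2 * (norm x)\<^sup>2" for x by (simp add: f_def)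
  have U_cont: "continuous_on UNIV U"
    unfolding U_eq[abs_def] by (intro continuous_intros f_cont)
  have bnd: "\<exists>b. \<forall>x\<in>cball 0 R. \<bar>h x\<bar> \<le> b" if "continuous_on UNIV h" for h :: "'a \<Rightarrow> real" and R
  proof -
    have "compact (h ` cball 0 R)"
      by (intro compact_continuous_image continuous_on_subset[OF that]) auto
    from compact_imp_bounded[OF this] show ?thesis unfolding bounded_iff by auto
  qed
  obtain S where S': "\<forall>x\<in>cball 0 1. \<bar>f x\<bar> \<le> S"
    using bnd[OF f_cont, of 1] by blast
  have S: "\<bar>f x\<bar> \<le> S" if "norm x \<le> 1" for x
    using S' that by simp
  have "S \<ge> 0" using S[of 0] by simp
  \<comment> \<open>Convexity on the segment from 0 to \<open>(1 + t) x\<close>, which contains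
    \<open>x\<close>.\<close>
  have ray: "(1 + t) * f x \<le> f ((1 + t) *\<^sub>R x) + t * f 0" if "t \<ge> 0" for t x
  proof -
    have "f ((1 - t / (1 + t)) *\<^sub>R ((1 + t) *\<^sub>R x) + (t / (1 + t)) *\<^sub>R 0)
        \<le> (1 - t / (1 + t)) * f ((1 + t) *\<^sub>R x) + (t / (1 + t)) * f 0"
      using that by (intro convex_onD[OF f_conv]) auto
    moreover have "(1 - t / (1 + t)) = 1 / (1 + t)" using that by (simp add: field_simps)
    ultimately have "f x \<le> 1 / (1 + t) * f ((1 + t) *\<^sub>R x) + t / (1 + t) * f 0"
      using that by simp
    then have "(1 + t) * f x \<le> (1 + t) * (1 / (1 + t) * f ((1 + t) *\<^sub>R x) + t / (1 + t) * f 0)"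
      using that by (intro mult_left_mono) auto
    also have "\<dots> = f ((1 + t) *\<^sub>R x) + t * f 0" using that by (simp add: distrib_left)
    finally show ?thesis .
  qed
  \<comment> \<open>A convex function lies above a downward cone: beyond the unit ball,
    \<open>x\<close> is compared along its ray with the unit vector \<open>y\<close>, where
    \<open>f\<close> is bounded by \<open>S\<close>.\<close>
  have low: "f x - f 0 \<ge> - (2 * S * (1 + norm x))" for x
  proof (cases "norm x \<le> 1")
    case True
    have "2 * S * 1 \<le> 2 * S * (1 + norm x)" using \<open>S \<ge> 0\<close> by (intro mult_left_mono) auto
    then show ?thesis using S[OF True] S[of 0] by auto
  next
    case False
    define r where "r = norm x"
    have r: "r > 1" using False by (simp add: r_def)
    define y where "y = (1 / r) *\<^sub>R x"
    have y: "norm y \<le> 1" "(1 + (r - 1)) *\<^sub>R y = x" using r by (auto simp: y_def r_def)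
    have "(1 + (r - 1)) * f y \<le> f x + (r - 1) * f 0"
      using ray[of "r - 1" y] r unfolding y(2) by simp
    then have "f x - f 0 \<ge> r * (f y - f 0)" by (simp add: algebra_simps)
    moreover have "r * (f y - f 0) \<ge> r * (- (2 * S))"
      using S[OF y(1)] S[of 0] r by (intro mult_left_mono) auto
    moreover have "2 * S * r \<le> 2 * S * (1 + r)" using \<open>S \<ge> 0\<close> by (intro mult_left_mono) auto
    ultimately show ?thesis unfolding r_def[symmetric] by (simp add: algebra_simps)
  qed
  \<comment> \<open>Completes the square: with it, half of the quadratic term together with the
    linear lower bound becomes \<open>\<kappa> / 2 * (norm x - 2 * S / \<kappa>)^2\<close>, and the
    other half gives the coercivity of \<open>q\<close>.\<close>
  define C0 where "C0 = 2 * S + 2 * S\<^sup>2 / \<kappa>"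
  have "C0 \<ge> 0" using \<open>S \<ge> 0\<close> \<open>\<kappa> > 0\<close> by (simp add: C0_def)
  define q where "q = (\<lambda>x. U x - U 0 + \<kappa> / 2 * (norm x)\<^sup>2 + C0)"
  have q_eq: "q x = (f x - f 0) + \<kappa> * (norm x)\<^sup>2 + C0" for x
    by (simp add: q_def U_eq)
  have q_cont: "continuous_on UNIV q"
    unfolding q_def by (intro continuous_intros U_cont)
  have "dilation_weight (\<lambda>x. exp (- 2 * U x)) q (2 * C0) (\<kappa> / 2)"
  proof
    show "(\<lambda>x. exp (- 2 * U x)) \<in> borel_measurable borel"
      by (intro borel_measurable_continuous_onI continuous_intros U_cont)
    show "q \<in> borel_measurable borel"
      using q_cont by (rule borel_measurable_continuous_onI)
    show "0 < exp (- 2 * U x)" for x by simp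
    show "0 < \<kappa> / 2" using \<open>\<kappa> > 0\<close> by simp
    show "0 \<le> 2 * C0" using \<open>C0 \<ge> 0\<close> by simp
    show "\<kappa> / 2 * (norm x)\<^sup>2 \<le> q x" for x
    proof -
      have "0 \<le> \<kappa> / 2 * (norm x - 2 * S / \<kappa>)\<^sup>2" using \<open>\<kappa> > 0\<close> by simp
      also have "\<dots> = \<kappa> / 2 * (norm x)\<^sup>2 - 2 * S * norm x + 2 * S\<^sup>2 / \<kappa>"
        using \<open>\<kappa> > 0\<close> by (simp add: power2_diff power_divide power2_eq_square field_simps)
      finally show ?thesis using low[of x] unfolding q_eq C0_def by (simp add: algebra_simps)
    qed
    show "exp (- 2 * U ((1 + \<tau>) *\<^sub>R x)) \<le> exp (- 2 * U x) * exp (\<tau> * (2 * C0 - 2 * q x))"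
      if \<tau>: "0 \<le> \<tau>" "\<tau> \<le> 1" for \<tau> x
    proof -
      have "\<tau> * (f x - f 0) \<le> f ((1 + \<tau>) *\<^sub>R x) - f x"
        using ray[OF \<tau>(1), of x] by (simp add: algebra_simps)
      moreover have "\<tau> * (\<kappa> * (norm x)\<^sup>2) \<le> \<kappa> / 2 * (norm ((1 + \<tau>) *\<^sub>R x))\<^sup>2 - \<kappa> / 2 * (norm x)\<^sup>2"
      proof -
        have "\<kappa> / 2 * (norm ((1 + \<tau>) *\<^sub>R x))\<^sup>2 - \<kappa> / 2 * (norm x)\<^sup>2
            = \<tau> * (\<kappa> * (norm x)\<^sup>2) + \<kappa> / 2 * \<tau>\<^sup>2 * (norm x)\<^sup>2"
        proof -
          have n: "norm ((1 + \<tau>) *\<^sub>R x) = (1 + \<tau>) * norm x" using \<tau> by simp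
          show ?thesis unfolding n by (simp add: power2_eq_square algebra_simps)
        qed
        then show ?thesis using \<open>\<kappa> > 0\<close> by simp
      qed
      moreover have "\<tau> * (q x - C0) = \<tau> * (f x - f 0) + \<tau> * (\<kappa> * (norm x)\<^sup>2)"
        unfolding q_eq by (simp add: algebra_simps)
      ultimately have "\<tau> * (q x - C0) \<le> U ((1 + \<tau>) *\<^sub>R x) - U x"
        unfolding U_eq by linarith
      then have "- 2 * U ((1 + \<tau>) *\<^sub>R x) \<le> - 2 * U x + \<tau> * (2 * C0 - 2 * q x)"
        by (simp add: algebra_simps)
      then show ?thesis by (simp flip: exp_add)
    qed
    show "\<exists>B. \<forall>x\<in>cball 0 R. q x \<le> B" for R
      using bnd[OF q_cont, of R] by (meson abs_le_D1)
    show "\<exists>b>0. \<exists>B. \<forall>x\<in>cball 0 R. b \<le> exp (- 2 * U x) \<and> exp (- 2 * U x) \<le> B" for R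
    proof -
      obtain b where b: "\<And>x. x \<in> cball 0 R \<Longrightarrow> \<bar>U x\<bar> \<le> b" using bnd[OF U_cont, of R] by blast
      show ?thesis
        by (rule exI[of _ "exp (- 2 * b)"], intro conjI, simp, rule exI[of _ "exp (2 * b)"])
          (auto dest!: b simp del: mem_cball)
    qed
  qed
  moreover have "U x \<le> q x + (U 0 - C0)" for x
    using \<open>\<kappa> > 0\<close> by (simp add: q_def)
  ultimately show ?thesis by blast
qed

text \<open>The weights \<open>exp (- 2 U)\<close> and \<open>e_star V\<close> are comparable with
  factor \<open>exp (2 B)\<close> in both directions, so each inequality transfers with that loss on
  either side. For the Poincare inequality this uses that the subtracted constant \<open>c\<close>
  is arbitrary and can be kept, whereas a mean changes with the measure. In the applications
  \<open>u\<close> is the logarithm of a ratio of densities.\<close>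

lemma ratio_exp_inequalities:
  fixes V :: "'a::euclidean_space \<Rightarrow> real"
  assumes V: "bounded_perturbation_of_uniformly_convex V"
    and V_meas[measurable]: "V \<in> borel_measurable borel"
    and V_fin: "(\<integral>\<^sup>+x. ennreal (e_star V x) \<partial>lborel) < \<infinity>"
  shows "\<exists>q K. q \<in> borel_measurable borel \<and> (\<forall>x. 0 \<le> q x) \<and> (\<exists>c. \<forall>x. V x \<le> q x + c) \<and> K > 0 \<and>
    (\<forall>u g. weak_gradient u g \<longrightarrow> (\<integral>\<^sup>+x. ennreal (exp (u x) * e_star V x) \<partial>lborel) < \<infinity> \<longrightarrow>
      (\<integral>\<^sup>+x. ennreal ((exp (u x / 2) - 1)\<^sup>2 * e_star V x * q x) \<partial>lborel)
        \<le> ennreal K * (\<integral>\<^sup>+x. ennreal ((exp (u x / 2) - 1)\<^sup>2 * e_star V x) \<partial>lborel)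
          + ennreal K * (\<integral>\<^sup>+x. ennreal (exp (u x) * (norm (g x))\<^sup>2 * e_star V x) \<partial>lborel) \<and>
      (\<exists>c. (\<integral>\<^sup>+x. ennreal ((exp (u x / 2) - c)\<^sup>2 * e_star V x) \<partial>lborel)
        \<le> ennreal K * (\<integral>\<^sup>+x. ennreal (exp (u x) * (norm (g x))\<^sup>2 * e_star V x) \<partial>lborel)))"
proof -
  obtain U B where U: "uniformly_convex U" and B: "\<And>x. \<bar>V x - U x\<bar> \<le> B"
    using V unfolding bounded_perturbation_of_uniformly_convex_def by blast
  obtain q A a c where dw: "dilation_weight (\<lambda>x. exp (- 2 * U x)) q A a" and c: "\<And>x. U x \<le> q x + c"
    using uniformly_convex_dilation_weight[OF U] by blast
  define m where "m = (\<lambda>x. exp (- 2 * U x))"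
  interpret dilation_weight m q A a using dw unfolding m_def .
  define E where "E = exp (2 * B)"
  have "E > 0" by (simp add: E_def)
  have m_le: "m x \<le> E * e_star V x" for x
    using B[of x] unfolding m_def e_star_def E_def by (simp flip: exp_add)
  have e_le: "e_star V x \<le> E * m x" for x
    using B[of x] unfolding m_def e_star_def E_def by (simp flip: exp_add)
  have e_pos: "e_star V x > 0" for x unfolding e_star_def by simp
  have e_meas[measurable]: "e_star V \<in> borel_measurable borel"
    unfolding e_star_def[abs_def] by measurable
  have to_m: "(\<integral>\<^sup>+x. ennreal (f x * e_star V x) \<partial>lborel) \<le> ennreal E * (\<integral>\<^sup>+x. ennreal (f x * m x) \<partial>lborel)"
    if [measurable]: "f \<in> borel_measurable borel" and f: "\<And>x. f x \<ge> 0" for f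
  proof -
    have "(\<integral>\<^sup>+x. ennreal (f x * e_star V x) \<partial>lborel) \<le> (\<integral>\<^sup>+x. ennreal E * ennreal (f x * m x) \<partial>lborel)"
    proof (rule nn_integral_mono)
      fix x :: 'a
      have "f x * e_star V x \<le> E * (f x * m x)"
        using mult_left_mono[OF e_le f] by (simp add: mult_ac)
      then show "ennreal (f x * e_star V x) \<le> ennreal E * ennreal (f x * m x)"
        using \<open>E > 0\<close> f[of x] m_pos[of x] by (simp flip: ennreal_mult add: ennreal_leI)
    qed
    also have "\<dots> = ennreal E * (\<integral>\<^sup>+x. ennreal (f x * m x) \<partial>lborel)"
      by (rule nn_integral_cmult) measurable
    finally show ?thesis .
  qed
  have to_e: "(\<integral>\<^sup>+x. ennreal (f x * m x) \<partial>lborel) \<le> ennreal E * (\<integral>\<^sup>+x. ennreal (f x * e_star V x) \<partial>lborel)"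
    if [measurable]: "f \<in> borel_measurable borel" and f: "\<And>x. f x \<ge> 0" for f
  proof -
    have "(\<integral>\<^sup>+x. ennreal (f x * m x) \<partial>lborel) \<le> (\<integral>\<^sup>+x. ennreal E * ennreal (f x * e_star V x) \<partial>lborel)"
    proof (rule nn_integral_mono)
      fix x :: 'a
      have "f x * m x \<le> E * (f x * e_star V x)"
        using mult_left_mono[OF m_le f] by (simp add: mult_ac)
      then show "ennreal (f x * m x) \<le> ennreal E * ennreal (f x * e_star V x)"
        using \<open>E > 0\<close> f[of x] e_pos[of x] by (simp flip: ennreal_mult add: ennreal_leI)
    qed
    also have "\<dots> = ennreal E * (\<integral>\<^sup>+x. ennreal (f x * e_star V x) \<partial>lborel)"
      by (rule nn_integral_cmult) measurable
    finally show ?thesis .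
  qed
  have m_fin: "(\<integral>\<^sup>+x. ennreal (m x) \<partial>lborel) < \<infinity>"
    using to_e[of "\<lambda>x. 1"] V_fin by (simp add: ennreal_mult_less_top le_less_trans)
  obtain Kp where "Kp \<ge> 0" and Kp: "\<And>u g F F'. weak_gradient u g \<Longrightarrow> (\<forall>t. (F has_real_derivative F' t) (at t)) \<Longrightarrow>
      continuous_on UNIV F' \<Longrightarrow> (\<integral>\<^sup>+x. ennreal ((F (u x))\<^sup>2 * m x) \<partial>lborel) < \<infinity> \<Longrightarrow>
      (\<exists>c. (\<integral>\<^sup>+x. ennreal ((F (u x) - c)\<^sup>2 * m x) \<partial>lborel)
        \<le> ennreal Kp * (\<integral>\<^sup>+x. ennreal ((F' (u x))\<^sup>2 * (norm (g x))\<^sup>2 * m x) \<partial>lborel))"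
    using poincare[OF m_fin] by blast
  \<comment> \<open>One constant for both inequalities: \<open>E * E\<close> for the two changes of
    weight, and \<open>+ 1\<close> for positivity.\<close>
  define K where "K = E * E * (K1 + K2 + Kp) + 1"
  have "K > 0" using \<open>E > 0\<close> \<open>Kp \<ge> 0\<close> K_nonneg by (simp add: K_def add_nonneg_pos)
  have EK: "E * k * E \<le> K" if "k \<le> K1 + K2 + Kp" for k
  proof -
    have "E * E * k \<le> E * E * (K1 + K2 + Kp)" using that \<open>E > 0\<close> by (intro mult_left_mono) auto
    then show ?thesis by (simp add: K_def mult_ac)
  qed
  \<comment> \<open>The derivative of \<open>exp (t / 2) - b\<close>. Its square
    \<open>exp t / 4\<close> produces the Fisher information in the gradient term; the factor 1/4 is
    later bounded by 1.\<close>
  define F' where "F' = (\<lambda>t::real. exp (t / 2) / 2)"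
  have F'2: "(F' t)\<^sup>2 = exp t / 4" for t
  proof -
    have "(exp (t / 2))\<^sup>2 = exp t" by (simp add: power2_eq_square flip: exp_add)
    then show ?thesis by (simp add: F'_def power_divide)
  qed
  have F_deriv: "((\<lambda>t. exp (t / 2) - b) has_real_derivative F' t) (at t)" for b t :: real
    unfolding F'_def by (auto intro!: derivative_eq_intros)
  have F'_cont: "continuous_on UNIV F'" unfolding F'_def by (intro continuous_intros) auto
  have ineq: "(\<integral>\<^sup>+x. ennreal ((exp (u x / 2) - 1)\<^sup>2 * e_star V x * q x) \<partial>lborel)
        \<le> ennreal K * (\<integral>\<^sup>+x. ennreal ((exp (u x / 2) - 1)\<^sup>2 * e_star V x) \<partial>lborel)
          + ennreal K * (\<integral>\<^sup>+x. ennreal (exp (u x) * (norm (g x))\<^sup>2 * e_star V x) \<partial>lborel) \<and>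
      (\<exists>c. (\<integral>\<^sup>+x. ennreal ((exp (u x / 2) - c)\<^sup>2 * e_star V x) \<partial>lborel)
        \<le> ennreal K * (\<integral>\<^sup>+x. ennreal (exp (u x) * (norm (g x))\<^sup>2 * e_star V x) \<partial>lborel))"
    if ug: "weak_gradient u g" and fin: "(\<integral>\<^sup>+x. ennreal (exp (u x) * e_star V x) \<partial>lborel) < \<infinity>" for u g
  proof -
    have [measurable]: "u \<in> borel_measurable borel" "g \<in> borel_measurable borel"
      using ug unfolding weak_gradient_def by (auto intro: locally_integrable_measurable)
    define D where "D = (\<integral>\<^sup>+x. ennreal (exp (u x) * (norm (g x))\<^sup>2 * e_star V x) \<partial>lborel)"
    have D: "(\<integral>\<^sup>+x. ennreal ((F' (u x))\<^sup>2 * (norm (g x))\<^sup>2 * m x) \<partial>lborel) \<le> ennreal E * D"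
    proof -
      have "(\<integral>\<^sup>+x. ennreal ((F' (u x))\<^sup>2 * (norm (g x))\<^sup>2 * m x) \<partial>lborel)
          \<le> (\<integral>\<^sup>+x. ennreal (exp (u x) * (norm (g x))\<^sup>2 * m x) \<partial>lborel)"
        unfolding F'2 by (intro nn_integral_mono ennreal_leI mult_right_mono) (auto simp: less_imp_le[OF m_pos])
      also have "\<dots> \<le> ennreal E * D" unfolding D_def by (rule to_e) auto
      finally show ?thesis .
    qed
    have exp2: "(exp (t / 2))\<^sup>2 = exp t" for t :: real
      by (simp add: power2_eq_square flip: exp_add)
    have fin_m: "(\<integral>\<^sup>+x. ennreal (exp (u x) * m x) \<partial>lborel) < \<infinity>"
      using to_e[of "\<lambda>x. exp (u x)"] fin by (simp add: ennreal_mult_less_top le_less_trans)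
    have fin1: "(\<integral>\<^sup>+x. ennreal ((exp (u x / 2) - 1)\<^sup>2 * m x) \<partial>lborel) < \<infinity>"
    proof -
      have "(\<integral>\<^sup>+x. ennreal ((exp (u x / 2) - 1)\<^sup>2 * m x) \<partial>lborel) \<le> (\<integral>\<^sup>+x. ennreal (exp (u x) * m x) + ennreal (m x) \<partial>lborel)"
      proof (rule nn_integral_mono)
        fix x :: 'a
        have "(exp (u x / 2) - 1)\<^sup>2 \<le> exp (u x) + 1"
          by (simp add: power2_diff exp2)
        from mult_right_mono[OF this less_imp_le[OF m_pos[of x]]]
        have "ennreal ((exp (u x / 2) - 1)\<^sup>2 * m x) \<le> ennreal (exp (u x) * m x + m x)"
          by (intro ennreal_leI) (simp add: distrib_right)
        then show "ennreal ((exp (u x / 2) - 1)\<^sup>2 * m x) \<le> ennreal (exp (u x) * m x) + ennreal (m x)"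
          using m_pos[of x] by simp
      qed
      also have "\<dots> = (\<integral>\<^sup>+x. ennreal (exp (u x) * m x) \<partial>lborel) + (\<integral>\<^sup>+x. ennreal (m x) \<partial>lborel)"
        by (rule nn_integral_add) measurable
      also have "\<dots> < \<infinity>" using fin_m m_fin by simp
      finally show ?thesis .
    qed
    define d where "d = (\<integral>\<^sup>+x. ennreal ((exp (u x / 2) - 1)\<^sup>2 * e_star V x) \<partial>lborel)"
    have "(\<integral>\<^sup>+x. ennreal ((exp (u x / 2) - 1)\<^sup>2 * e_star V x * q x) \<partial>lborel)
        \<le> ennreal E * (\<integral>\<^sup>+x. ennreal ((exp (u x / 2) - 1)\<^sup>2 * m x * q x) \<partial>lborel)"
      using to_m[of "\<lambda>x. (exp (u x / 2) - 1)\<^sup>2 * q x"] q_nonneg by (simp add: mult_ac)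
    also have "\<dots> \<le> ennreal E * (ennreal K1 * (\<integral>\<^sup>+x. ennreal ((exp (u x / 2) - 1)\<^sup>2 * m x) \<partial>lborel)
        + ennreal K2 * (\<integral>\<^sup>+x. ennreal ((F' (u x))\<^sup>2 * (norm (g x))\<^sup>2 * m x) \<partial>lborel))"
      by (intro mult_left_mono moment[OF ug F_deriv F'_cont fin1]) simp
    also have "\<dots> \<le> ennreal E * (ennreal K1 * (ennreal E * d) + ennreal K2 * (ennreal E * D))"
      unfolding d_def by (intro mult_left_mono add_mono to_e D) auto
    also have "\<dots> = ennreal (E * K1 * E) * d + ennreal (E * K2 * E) * D"
      using \<open>E > 0\<close> K_nonneg by (simp add: ennreal_mult distrib_left mult_ac)
    also have "\<dots> \<le> ennreal K * d + ennreal K * D"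
      using K_nonneg \<open>Kp \<ge> 0\<close> by (intro add_mono mult_right_mono ennreal_leI EK) auto
    finally have 1: "(\<integral>\<^sup>+x. ennreal ((exp (u x / 2) - 1)\<^sup>2 * e_star V x * q x) \<partial>lborel) \<le> ennreal K * d + ennreal K * D" .
    have "\<exists>c. (\<integral>\<^sup>+x. ennreal (((exp (u x / 2) - 0) - c)\<^sup>2 * m x) \<partial>lborel)
        \<le> ennreal Kp * (\<integral>\<^sup>+x. ennreal ((F' (u x))\<^sup>2 * (norm (g x))\<^sup>2 * m x) \<partial>lborel)"
      by (rule Kp[OF ug, of "\<lambda>t. exp (t / 2) - 0"]) (use F_deriv[of 0] F'_cont fin_m in \<open>auto simp: exp2\<close>)
    then obtain c where c: "(\<integral>\<^sup>+x. ennreal ((exp (u x / 2) - c)\<^sup>2 * m x) \<partial>lborel)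
        \<le> ennreal Kp * (\<integral>\<^sup>+x. ennreal ((F' (u x))\<^sup>2 * (norm (g x))\<^sup>2 * m x) \<partial>lborel)" by auto
    have "(\<integral>\<^sup>+x. ennreal ((exp (u x / 2) - c)\<^sup>2 * e_star V x) \<partial>lborel)
        \<le> ennreal E * (\<integral>\<^sup>+x. ennreal ((exp (u x / 2) - c)\<^sup>2 * m x) \<partial>lborel)"
      by (rule to_m) auto
    also have "\<dots> \<le> ennreal E * (ennreal Kp * (ennreal E * D))"
      using c D by (meson mult_left_mono order_trans zero_le)
    also have "\<dots> = ennreal (E * Kp * E) * D"
      using \<open>E > 0\<close> \<open>Kp \<ge> 0\<close> by (simp add: ennreal_mult mult_ac)
    also have "\<dots> \<le> ennreal K * D"
      using K_nonneg by (intro mult_right_mono ennreal_leI EK) auto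
    finally show ?thesis using 1 unfolding d_def D_def by blast
  qed
  have "V x \<le> q x + (c + B)" for x using c[of x] B[of x] by linarith
  then show ?thesis
    using q_meas q_nonneg \<open>K > 0\<close> ineq by (intro exI[of _ q] exI[of _ K]) blast
qed

subsection \<open>Distance to equilibrium\<close>

text \<open>If \<open>x\<close> and \<open>y\<close> lie on the same side of 1, their product is at
  least as far from 1 as either of them. On opposite sides the two contributions to the difference
  cannot cancel, so each is bounded by \<open>h1\<close>; the inequalities
  \<open>z - 1 <= z^2 - 1\<close> for \<open>z >= 1\<close> and \<open>1 - v <= 1 - v^2\<close> for
  \<open>v\<close> between 0 and 1 remove the squares.\<close>

lemma near_one_of_product_and_difference:
  fixes x y a b h1 h2 :: real
  assumes "x \<ge> 0" "y \<ge> 0" "a > 0" "b > 0"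
    and h1: "\<bar>a * (x\<^sup>2 - 1) - b * (y\<^sup>2 - 1)\<bar> \<le> h1" and h2: "\<bar>x * y - 1\<bar> \<le> h2"
  shows "\<bar>x - 1\<bar> \<le> h2 + h1 / a + h1 / b" "\<bar>y - 1\<bar> \<le> h2 + h1 / a + h1 / b"
proof -
  have nn: "0 \<le> h1" "0 \<le> h2" using h1 h2 by linarith+
  then have nn': "0 \<le> h1 / a" "0 \<le> h1 / b" using assms by auto
  have *: "\<bar>x - 1\<bar> \<le> h2 + h1 / a + h1 / b \<and> \<bar>y - 1\<bar> \<le> h2 + h1 / a + h1 / b"
    if "x \<ge> 1" "y \<ge> 1"
  proof -
    have "x * 1 \<le> x * y" "1 * y \<le> x * y" using that by (auto intro!: mult_mono)
    then have "x \<le> x * y" "y \<le> x * y" by simp_all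
    then show ?thesis using h2 that nn' by (intro conjI) linarith+
  qed
  have **: "\<bar>x - 1\<bar> \<le> h2 + h1 / a + h1 / b \<and> \<bar>y - 1\<bar> \<le> h2 + h1 / a + h1 / b"
    if "x \<le> 1" "y \<le> 1"
  proof -
    have "x * y \<le> x * 1" "x * y \<le> 1 * y" using that assms by (auto intro!: mult_left_le mult_left_le_one_le)
    then have "x * y \<le> x" "x * y \<le> y" by simp_all
    then show ?thesis using h2 that nn' by (intro conjI) linarith+
  qed
  have mixed: "z - 1 \<le> h1 / c \<and> 1 - v \<le> h1 / d"
    if "z \<ge> 1" "0 \<le> v" "v \<le> 1" "c > 0" "d > 0" "c * (z\<^sup>2 - 1) + d * (1 - v\<^sup>2) \<le> h1" for z v c d :: real
  proof -
    have z: "z - 1 \<le> z\<^sup>2 - 1" using that by (simp add: power2_eq_square)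
    have v: "1 - v \<le> 1 - v\<^sup>2" using that by (simp add: power2_eq_square mult_left_le)
    have "0 \<le> z - 1" "0 \<le> 1 - v" using that by auto
    then have "0 \<le> c * (z\<^sup>2 - 1)" "0 \<le> d * (1 - v\<^sup>2)" using z v that by auto
    moreover have "c * (z - 1) \<le> c * (z\<^sup>2 - 1)" "d * (1 - v) \<le> d * (1 - v\<^sup>2)"
      using z v that by (auto intro!: mult_left_mono)
    ultimately have "c * (z - 1) \<le> h1" "d * (1 - v) \<le> h1" using that by linarith+
    then show ?thesis using that by (simp add: pos_le_divide_eq mult.commute)
  qed
  have eq1: "a * (x\<^sup>2 - 1) + b * (1 - y\<^sup>2) = a * (x\<^sup>2 - 1) - b * (y\<^sup>2 - 1)"
    and eq2: "b * (y\<^sup>2 - 1) + a * (1 - x\<^sup>2) = - (a * (x\<^sup>2 - 1) - b * (y\<^sup>2 - 1))"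
    by (simp_all add: algebra_simps)
  have "\<bar>x - 1\<bar> \<le> h2 + h1 / a + h1 / b \<and> \<bar>y - 1\<bar> \<le> h2 + h1 / a + h1 / b"
  proof (cases "x \<ge> 1")
    case True
    show ?thesis
    proof (cases "y \<ge> 1")
      case False
      then show ?thesis
        using mixed[of x y a b] True assms(1-4) eq1 h1 nn nn' by (intro conjI) linarith+
    qed (use * True in auto)
  next
    case False
    show ?thesis
    proof (cases "y \<ge> 1")
      case True
      then show ?thesis
        using mixed[of y x b a] False assms(1-4) eq2 h1 nn nn' by (intro conjI) linarith+
    qed (use ** False in auto)
  qed
  then show "\<bar>x - 1\<bar> \<le> h2 + h1 / a + h1 / b" "\<bar>y - 1\<bar> \<le> h2 + h1 / a + h1 / b" by auto
qed

section \<open>Second moments and the Cauchy-Schwarz inequality\<close>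

lemma integrable_mult_of_squares:
  fixes f g :: "'w \<Rightarrow> real"
  assumes [measurable]: "f \<in> borel_measurable M" "g \<in> borel_measurable M"
    and int: "integrable M (\<lambda>x. (f x)\<^sup>2)" "integrable M (\<lambda>x. (g x)\<^sup>2)"
  shows "integrable M (\<lambda>x. f x * g x)"
proof (rule Bochner_Integration.integrable_bound)
  show "integrable M (\<lambda>x. (f x)\<^sup>2 + (g x)\<^sup>2)" using int by simp
  have "\<bar>f x * g x\<bar> \<le> (f x)\<^sup>2 + (g x)\<^sup>2" for x
    using sum_squares_bound[of "\<bar>f x\<bar>" "\<bar>g x\<bar>"] abs_ge_zero[of "f x * g x"]
    unfolding abs_mult power2_abs by linarith
  then show "AE x in M. norm (f x * g x) \<le> norm ((f x)\<^sup>2 + (g x)\<^sup>2)"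
    by (intro AE_I2) (auto intro: order_trans[OF _ abs_ge_self])
qed simp

text \<open>The quadratic form \<open>A s^2 - 2 C s t + B t^2\<close> is nonnegative; at
  \<open>s = B\<close>, \<open>t = C\<close> it equals \<open>B * (A * B - C^2)\<close>, which
  settles the case of positive \<open>B\<close>.\<close>

lemma integral_cauchy_schwarz:
  fixes f g :: "'w \<Rightarrow> real"
  assumes [measurable]: "f \<in> borel_measurable M" "g \<in> borel_measurable M"
    and int: "integrable M (\<lambda>x. (f x)\<^sup>2)" "integrable M (\<lambda>x. (g x)\<^sup>2)"
  shows "\<bar>LINT x|M. f x * g x\<bar> \<le> sqrt (LINT x|M. (f x)\<^sup>2) * sqrt (LINT x|M. (g x)\<^sup>2)"
proof -
  define A B C where "A = (LINT x|M. (f x)\<^sup>2)" and "B = (LINT x|M. (g x)\<^sup>2)" and "C = (LINT x|M. f x * g x)"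
  have fg: "integrable M (\<lambda>x. f x * g x)" by (rule integrable_mult_of_squares) fact+
  have AB: "A \<ge> 0" "B \<ge> 0" by (auto simp: A_def B_def)
  have quad: "0 \<le> s\<^sup>2 * A - 2 * (s * t) * C + t\<^sup>2 * B" for s t
  proof -
    have "0 \<le> (LINT x|M. (s * f x - t * g x)\<^sup>2)" by simp
    also have "\<dots> = (LINT x|M. s\<^sup>2 * (f x)\<^sup>2 - 2 * (s * t) * (f x * g x) + t\<^sup>2 * (g x)\<^sup>2)"
      by (intro Bochner_Integration.integral_cong) (auto simp: power2_eq_square algebra_simps)
    also have "\<dots> = s\<^sup>2 * A - 2 * (s * t) * C + t\<^sup>2 * B"
      using int fg by (simp add: A_def B_def C_def)
    finally show ?thesis .
  qed
  have "C\<^sup>2 \<le> A * B"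
  proof (cases "B = 0")
    case True
    have "C = 0"
    proof (rule ccontr)
      assume "C \<noteq> 0"
      \<comment> \<open>For \<open>B = 0\<close> the form is affine in \<open>t\<close>, and this
        value of \<open>t\<close> makes it equal to -1.\<close>
      then have "0 \<le> A - (A + 1)"
        using quad[of 1 "(A + 1) / (2 * C)"] True by (simp add: field_simps)
      then show False by simp
    qed
    then show ?thesis using AB by simp
  next
    case False
    then have "B > 0" using AB by simp
    have "0 \<le> B * (A * B - C\<^sup>2)"
      using quad[of B C] by (simp add: power2_eq_square algebra_simps)
    then show ?thesis using \<open>B > 0\<close> by (simp add: zero_le_mult_iff)
  qed
  then have "sqrt (C\<^sup>2) \<le> sqrt (A * B)" by (rule real_sqrt_le_mono)
  then show ?thesis by (simp add: real_sqrt_mult A_def B_def C_def)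
qed

lemma (in finite_measure) square_integrable_imp_integrable:
  fixes f :: "'a \<Rightarrow> real"
  assumes [measurable]: "f \<in> borel_measurable M" and "integrable M (\<lambda>x. (f x)\<^sup>2)"
  shows "integrable M f"
  using integrable_mult_of_squares[of f M "\<lambda>x. 1"] assms by simp

lemma (in finite_measure) integral_square_deviation:
  fixes f :: "'a \<Rightarrow> real"
  assumes f[measurable]: "f \<in> borel_measurable M" and f2: "integrable M (\<lambda>x. (f x)\<^sup>2)"
    and M: "measure M (space M) = 1"
  shows "integrable M (\<lambda>x. (f x - c)\<^sup>2)"
    "(LINT x|M. (f x - c)\<^sup>2) = (LINT x|M. (f x - (LINT y|M. f y))\<^sup>2) + ((LINT y|M. f y) - c)\<^sup>2"
    "((LINT y|M. f y))\<^sup>2 \<le> (LINT x|M. (f x)\<^sup>2)"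
proof -
  have f1: "integrable M f" using f f2 by (rule square_integrable_imp_integrable)
  have expand: "(LINT x|M. (f x - c)\<^sup>2) = (LINT x|M. (f x)\<^sup>2) - 2 * c * (LINT y|M. f y) + c\<^sup>2" for c
  proof -
    have "(LINT x|M. (f x - c)\<^sup>2) = (LINT x|M. (f x)\<^sup>2 - 2 * c * f x + c\<^sup>2)"
      by (intro Bochner_Integration.integral_cong) (auto simp: power2_diff)
    also have "\<dots> = (LINT x|M. (f x)\<^sup>2) - 2 * c * (LINT y|M. f y) + c\<^sup>2"
      using f1 f2 M by simp
    finally show ?thesis .
  qed
  have "integrable M (\<lambda>x. (f x)\<^sup>2 - 2 * c * f x + c\<^sup>2)" using f1 f2 by simp
  then show "integrable M (\<lambda>x. (f x - c)\<^sup>2)"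
    by (rule Bochner_Integration.integrable_cong[THEN iffD1, rotated 2]) (auto simp: power2_diff)
  show "(LINT x|M. (f x - c)\<^sup>2) = (LINT x|M. (f x - (LINT y|M. f y))\<^sup>2) + ((LINT y|M. f y) - c)\<^sup>2"
    unfolding expand by (simp add: power2_eq_square algebra_simps)
  have "0 \<le> (LINT x|M. (f x - (LINT y|M. f y))\<^sup>2)" by simp
  then show "((LINT y|M. f y))\<^sup>2 \<le> (LINT x|M. (f x)\<^sup>2)"
    unfolding expand by (simp add: power2_eq_square)
qed

text \<open>The reaction term forces the product of the means of \<open>\<alpha>\<close> and \<open>\<beta>\<close> to be close to \<open>1\<close>, the conserved
  charge forces the weighted difference of their squares to be close to its equilibrium value.\<close>

lemma (in finite_measure) square_distance_to_equilibrium: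
  fixes \<alpha> \<beta> \<sigma> :: "'a \<Rightarrow> real" and Cn Cp s A \<delta> :: real
  defines "K0 \<equiv> (1 + sqrt A) + (Cn + Cp) * (2 * s * sqrt A + 2 * A) / Cn + (Cn + Cp) * (2 * s * sqrt A + 2 * A) / Cp"
  assumes M: "measure M (space M) = 1"
    and meas[measurable]: "\<alpha> \<in> borel_measurable M" "\<beta> \<in> borel_measurable M" "\<sigma> \<in> borel_measurable M"
    and nonneg: "\<And>x. \<alpha> x \<ge> 0" "\<And>x. \<beta> x \<ge> 0" "\<And>x. \<sigma> x \<ge> 0" and s: "\<And>x. \<sigma> x \<le> s"
    and C: "Cn > 0" "Cp > 0"
    and int: "integrable M (\<lambda>x. (\<alpha> x)\<^sup>2)" "integrable M (\<lambda>x. (\<beta> x)\<^sup>2)"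
    and A: "(LINT x|M. (\<alpha> x)\<^sup>2) \<le> A" "(LINT x|M. (\<beta> x)\<^sup>2) \<le> A"
    and \<sigma>1: "(LINT x|M. (\<sigma> x)\<^sup>2) = 1"
    and charge: "(LINT x|M. \<sigma> x * (Cn * (\<alpha> x)\<^sup>2 - Cp * (\<beta> x)\<^sup>2)) = Cn - Cp"
    and var: "(LINT x|M. (\<alpha> x - (LINT y|M. \<alpha> y))\<^sup>2) \<le> \<delta>" "(LINT x|M. (\<beta> x - (LINT y|M. \<beta> y))\<^sup>2) \<le> \<delta>"
      "(LINT x|M. (\<sigma> x - (LINT y|M. \<sigma> y))\<^sup>2) \<le> \<delta>"
    and react: "integrable M (\<lambda>x. (\<alpha> x * \<beta> x - 1)\<^sup>2)" "(LINT x|M. (\<alpha> x * \<beta> x - 1)\<^sup>2) \<le> \<delta>"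
  shows "(LINT x|M. (\<alpha> x - 1)\<^sup>2) \<le> (1 + K0\<^sup>2) * \<delta>" "(LINT x|M. (\<beta> x - 1)\<^sup>2) \<le> (1 + K0\<^sup>2) * \<delta>"
    "(LINT x|M. (\<sigma> x - 1)\<^sup>2) \<le> 2 * \<delta>"
proof -
  define a b c where "a = (LINT x|M. \<alpha> x)" and "b = (LINT x|M. \<beta> x)" and "c = (LINT x|M. \<sigma> x)"
  define \<eta> where "\<eta> = sqrt \<delta>"
  have "s \<ge> 0" using s[of undefined] nonneg(3)[of undefined] by linarith
  have "0 \<le> (LINT x|M. (\<alpha> x)\<^sup>2)" by simp
  then have "A \<ge> 0" using A(1) by linarith
  have "0 \<le> (LINT x|M. (\<alpha> x - (LINT y|M. \<alpha> y))\<^sup>2)" by simp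
  then have "\<delta> \<ge> 0" using var(1) by linarith
  have \<eta>: "\<eta> \<ge> 0" "\<eta>\<^sup>2 = \<delta>" using \<open>\<delta> \<ge> 0\<close> by (auto simp: \<eta>_def)
  have int_\<sigma>: "integrable M (\<lambda>x. (\<sigma> x)\<^sup>2)"
    using \<sigma>1 not_integrable_integral_eq by fastforce
  note dev = integral_square_deviation[OF _ _ M]
  have i1: "integrable M \<alpha>" "integrable M \<beta>" "integrable M \<sigma>"
    using int int_\<sigma> by (auto intro: square_integrable_imp_integrable)
  have abc: "a \<ge> 0" "b \<ge> 0" "c \<ge> 0"
    unfolding a_def b_def c_def using nonneg by (auto intro: integral_nonneg_AE)
  have a2: "a\<^sup>2 \<le> A" "b\<^sup>2 \<le> A" "c\<^sup>2 \<le> 1"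
    using dev(3)[OF meas(1) int(1)] dev(3)[OF meas(2) int(2)] dev(3)[OF meas(3) int_\<sigma>] A \<sigma>1
    unfolding a_def b_def c_def by linarith+
  have c1: "c \<le> 1" using power2_le_imp_le[of c 1] a2(3) by simp

  \<comment> \<open>The second moment of \<open>\<sigma>\<close> is 1, which is energy conservation.
    Hence the variance alone determines how far the mean is from 1:
    \<open>1 - c <= 1 - c^2 <= \<delta>\<close>.\<close>
  have \<sigma>_var: "(LINT x|M. (\<sigma> x - c)\<^sup>2) = 1 - c\<^sup>2"
    using dev(2)[OF meas(3) int_\<sigma>, of 0] \<sigma>1 unfolding c_def by simp
  have "(LINT x|M. (\<sigma> x - 1)\<^sup>2) = (1 - c\<^sup>2) + (c - 1)\<^sup>2"
    using dev(2)[OF meas(3) int_\<sigma>, of 1] \<sigma>_var unfolding c_def by simp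
  also have "\<dots> = 2 * (1 - c)" by (simp add: power2_eq_square algebra_simps)
  also have "\<dots> \<le> 2 * (1 - c\<^sup>2)" using abc(3) c1 by (simp add: power2_eq_square mult_left_le)
  also have "\<dots> \<le> 2 * \<delta>" using \<sigma>_var var(3) unfolding c_def by simp
  finally show "(LINT x|M. (\<sigma> x - 1)\<^sup>2) \<le> 2 * \<delta>" .

  \<comment> \<open>The deficit is even of order \<open>\<delta>\<close>, but the order
    \<open>\<eta> = sqrt \<delta>\<close> matches the other errors and holds for large
    \<open>\<delta>\<close> as well.\<close>
  have c_dev: "1 - c \<le> 2 * \<eta>"
  proof -
    have "(1 - c) * (1 - c) \<le> (1 - c) * (1 + c)" using abc c1 by (intro mult_left_mono) auto
    also have "\<dots> = 1 - c\<^sup>2" by (simp add: power2_eq_square algebra_simps)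
    also have "\<dots> \<le> \<delta>" using \<sigma>_var var(3) unfolding c_def by simp
    finally have "(1 - c)\<^sup>2 \<le> \<eta>\<^sup>2" unfolding \<eta>(2) by (simp add: power2_eq_square)
    then have "1 - c \<le> \<eta>" using \<eta>(1) by (rule power2_le_imp_le)
    then show ?thesis using \<eta>(1) by linarith
  qed

  \<comment> \<open>Replaces \<open>f\<close> by its mean in a moment weighted by
    \<open>\<sigma>\<close>. The difference is the integral of
    \<open>\<sigma> * (f - f1) * (f + f1)\<close>, so Cauchy-Schwarz gives one power of
    \<open>\<eta>\<close>, with \<open>s\<close> and \<open>A\<close> bounding the other
    factors.\<close>
  have moment_dev: "\<bar>(LINT x|M. \<sigma> x * (f x)\<^sup>2) - f1\<^sup>2 * c\<bar> \<le> 2 * s * sqrt A * \<eta>" "integrable M (\<lambda>x. \<sigma> x * (f x)\<^sup>2)"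
    if [measurable]: "f \<in> borel_measurable M" and f: "integrable M (\<lambda>x. (f x)\<^sup>2)" "(LINT x|M. (f x)\<^sup>2) \<le> A"
      "(LINT x|M. (f x - f1)\<^sup>2) \<le> \<delta>" and f1: "f1 = (LINT x|M. f x)" "f1\<^sup>2 \<le> A" for f f1
  proof -
    have bound: "integrable M (\<lambda>x. \<sigma> x * h x)" if "integrable M h" for h :: "'a \<Rightarrow> real"
    proof (rule Bochner_Integration.integrable_bound)
      show "integrable M (\<lambda>x. s * h x)" using that by simp
      have [measurable]: "h \<in> borel_measurable M" using that by simp
      show "(\<lambda>x. \<sigma> x * h x) \<in> borel_measurable M" by measurable
      show "AE x in M. norm (\<sigma> x * h x) \<le> norm (s * h x)"
        using s nonneg(3) \<open>s \<ge> 0\<close> by (intro AE_I2) (auto simp: abs_mult intro!: mult_right_mono)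
    qed
    show i: "integrable M (\<lambda>x. \<sigma> x * (f x)\<^sup>2)" by (rule bound[OF f(1)])
    have id: "integrable M (\<lambda>x. (f x - f1)\<^sup>2)" "integrable M (\<lambda>x. (f x + f1)\<^sup>2)"
      using dev(1)[OF that(1) f(1), of f1] dev(1)[OF that(1) f(1), of "- f1"] by simp_all
    have "(LINT x|M. (f x + f1)\<^sup>2) = (LINT x|M. (f x - f1)\<^sup>2) + (2 * f1)\<^sup>2"
      using dev(2)[OF that(1) f(1), of "- f1", folded f1(1)] by simp
    also have "\<dots> = (LINT x|M. (f x)\<^sup>2) + 3 * f1\<^sup>2"
      using dev(2)[OF that(1) f(1), of 0, folded f1(1)] by (simp add: power_mult_distrib)
    also have "\<dots> \<le> 4 * A" using f(2) f1(2) by simp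
    finally have plus: "(LINT x|M. (f x + f1)\<^sup>2) \<le> 4 * A" .
    have "(LINT x|M. \<sigma> x * (f x)\<^sup>2) - f1\<^sup>2 * c = (LINT x|M. \<sigma> x * (f x)\<^sup>2 - f1\<^sup>2 * \<sigma> x)"
      using i i1(3) by (simp add: c_def)
    also have "\<dots> = (LINT x|M. (\<sigma> x * (f x - f1)) * (f x + f1))"
      by (intro Bochner_Integration.integral_cong) (auto simp: power2_eq_square algebra_simps)
    also have "\<bar>\<dots>\<bar> \<le> sqrt (LINT x|M. (\<sigma> x * (f x - f1))\<^sup>2) * sqrt (LINT x|M. (f x + f1)\<^sup>2)"
    proof (rule integral_cauchy_schwarz)
      show "integrable M (\<lambda>x. (\<sigma> x * (f x - f1))\<^sup>2)"
      proof (rule Bochner_Integration.integrable_bound)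
        show "integrable M (\<lambda>x. s\<^sup>2 * (f x - f1)\<^sup>2)" using id by simp
        show "AE x in M. norm ((\<sigma> x * (f x - f1))\<^sup>2) \<le> norm (s\<^sup>2 * (f x - f1)\<^sup>2)"
          using s nonneg(3) by (intro AE_I2) (auto simp: power_mult_distrib intro!: mult_right_mono power_mono)
      qed measurable
    qed (use id in auto)
    also have "\<dots> \<le> (s * \<eta>) * (2 * sqrt A)"
    proof (intro mult_mono)
      have "(LINT x|M. (\<sigma> x * (f x - f1))\<^sup>2) \<le> (LINT x|M. s\<^sup>2 * (f x - f1)\<^sup>2)"
        using s nonneg(3) id
        by (intro integral_mono_AE') (auto simp: power_mult_distrib intro!: AE_I2 mult_right_mono power_mono)
      also have "\<dots> \<le> s\<^sup>2 * \<delta>" using f(3) by (simp add: mult_left_mono)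
      finally have "sqrt (LINT x|M. (\<sigma> x * (f x - f1))\<^sup>2) \<le> sqrt (s\<^sup>2 * \<delta>)" by (rule real_sqrt_le_mono)
      then show "sqrt (LINT x|M. (\<sigma> x * (f x - f1))\<^sup>2) \<le> s * \<eta>"
        using \<open>s \<ge> 0\<close> by (simp add: real_sqrt_mult \<eta>_def)
      have "sqrt (LINT x|M. (f x + f1)\<^sup>2) \<le> sqrt (4 * A)" using plus by (rule real_sqrt_le_mono)
      then show "sqrt (LINT x|M. (f x + f1)\<^sup>2) \<le> 2 * sqrt A" by (simp add: real_sqrt_mult)
    qed (use \<open>s \<ge> 0\<close> \<eta>(1) in auto)
    finally show "\<bar>(LINT x|M. \<sigma> x * (f x)\<^sup>2) - f1\<^sup>2 * c\<bar> \<le> 2 * s * sqrt A * \<eta>" by (simp add: mult_ac)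
  qed
  note md_a = moment_dev[OF meas(1) int(1) A(1), of a, folded a_def, OF var(1)[folded a_def] refl a2(1)]
  note md_b = moment_dev[OF meas(2) int(2) A(2), of b, folded b_def, OF var(2)[folded b_def] refl a2(2)]

  define h1 where "h1 = (Cn + Cp) * (2 * s * sqrt A + 2 * A)"
  have diff: "\<bar>Cn * (a\<^sup>2 - 1) - Cp * (b\<^sup>2 - 1)\<bar> \<le> h1 * \<eta>"
  proof -
    define I J where "I = (LINT x|M. \<sigma> x * (\<alpha> x)\<^sup>2)" and "J = (LINT x|M. \<sigma> x * (\<beta> x)\<^sup>2)"
    have "(LINT x|M. \<sigma> x * (Cn * (\<alpha> x)\<^sup>2 - Cp * (\<beta> x)\<^sup>2)) = (LINT x|M. Cn * (\<sigma> x * (\<alpha> x)\<^sup>2) - Cp * (\<sigma> x * (\<beta> x)\<^sup>2))"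
      by (intro Bochner_Integration.integral_cong) (auto simp: algebra_simps)
    also have "\<dots> = Cn * I - Cp * J"
      unfolding I_def J_def using md_a(2) md_b(2) by simp
    finally have CIJ: "Cn * I - Cp * J = Cn - Cp" using charge by simp
    \<comment> \<open>The exact charge identity cancels the main terms; what remains are the two
      replacement errors and the deficit \<open>1 - c\<close> of the mean of
      \<open>\<sigma>\<close>.\<close>
    have eq: "Cn * (a\<^sup>2 - 1) - Cp * (b\<^sup>2 - 1)
        = - (Cn * (I - a\<^sup>2 * c)) + Cp * (J - b\<^sup>2 * c) + Cn * (a\<^sup>2 * (1 - c)) - Cp * (b\<^sup>2 * (1 - c))"
      using CIJ by (simp add: algebra_simps)
    have "\<bar>Cn * (I - a\<^sup>2 * c)\<bar> \<le> Cn * (2 * s * sqrt A * \<eta>)"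
      unfolding I_def abs_mult using md_a(1) C by (simp add: mult_left_mono)
    moreover have "\<bar>Cp * (J - b\<^sup>2 * c)\<bar> \<le> Cp * (2 * s * sqrt A * \<eta>)"
      unfolding J_def abs_mult using md_b(1) C by (simp add: mult_left_mono)
    moreover have "\<bar>Cn * (a\<^sup>2 * (1 - c))\<bar> \<le> Cn * (A * (2 * \<eta>))"
      unfolding abs_mult using C a2 c1 c_dev \<open>A \<ge> 0\<close> by (auto intro!: mult_mono mult_left_mono)
    moreover have "\<bar>Cp * (b\<^sup>2 * (1 - c))\<bar> \<le> Cp * (A * (2 * \<eta>))"
      unfolding abs_mult using C a2 c1 c_dev \<open>A \<ge> 0\<close> by (auto intro!: mult_mono mult_left_mono)
    moreover have "h1 * \<eta> = Cn * (2 * s * sqrt A * \<eta>) + Cp * (2 * s * sqrt A * \<eta>) + Cn * (A * (2 * \<eta>)) + Cp * (A * (2 * \<eta>))"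
      by (simp add: h1_def algebra_simps)
    ultimately show ?thesis unfolding eq by linarith
  qed

  have prod: "\<bar>a * b - 1\<bar> \<le> (1 + sqrt A) * \<eta>"
  proof -
    have iab: "integrable M (\<lambda>x. \<alpha> x * \<beta> x)"
      using int by (intro integrable_mult_of_squares) auto
    have "\<bar>LINT x|M. (\<alpha> x * \<beta> x - 1) * 1\<bar> \<le> sqrt (LINT x|M. (\<alpha> x * \<beta> x - 1)\<^sup>2) * sqrt (LINT x|M. 1\<^sup>2)"
      using react(1) by (intro integral_cauchy_schwarz) auto
    also have "\<dots> \<le> \<eta>" using react(2) M by (simp add: \<eta>_def)
    finally have 1: "\<bar>(LINT x|M. \<alpha> x * \<beta> x) - 1\<bar> \<le> \<eta>" using iab M by simp
    \<comment> \<open>Only \<open>\<alpha>\<close> has to be replaced by its mean, since the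
      integral of \<open>\<beta>\<close> is already \<open>b\<close>.\<close>
    have "(LINT x|M. \<alpha> x * \<beta> x) - a * b = (LINT x|M. \<alpha> x * \<beta> x - a * \<beta> x)"
      using iab i1 by (simp add: b_def)
    also have "\<dots> = (LINT x|M. (\<alpha> x - a) * \<beta> x)"
      by (simp add: left_diff_distrib)
    also have "\<bar>\<dots>\<bar> \<le> sqrt (LINT x|M. (\<alpha> x - a)\<^sup>2) * sqrt (LINT x|M. (\<beta> x)\<^sup>2)"
      using dev(1)[OF meas(1) int(1), of a] int by (intro integral_cauchy_schwarz) auto
    also have "\<dots> \<le> \<eta> * sqrt A"
      using var(1) A(2) \<eta>(1) by (intro mult_mono) (auto simp: \<eta>_def a_def)
    finally show ?thesis using 1 by (simp add: algebra_simps)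
  qed

  have K0: "(1 + sqrt A) * \<eta> + h1 * \<eta> / Cn + h1 * \<eta> / Cp = K0 * \<eta>"
    unfolding K0_def h1_def[symmetric] by (simp add: algebra_simps add_divide_distrib)
  note near = near_one_of_product_and_difference[OF abc(1,2) C diff prod, unfolded K0]
  have "(a - 1)\<^sup>2 \<le> (K0 * \<eta>)\<^sup>2" "(b - 1)\<^sup>2 \<le> (K0 * \<eta>)\<^sup>2"
    using near by (auto intro!: power2_le_iff_abs_le[THEN iffD2] order_trans[OF abs_ge_zero])
  then have sq: "(a - 1)\<^sup>2 \<le> K0\<^sup>2 * \<delta>" "(b - 1)\<^sup>2 \<le> K0\<^sup>2 * \<delta>"
    by (auto simp: power_mult_distrib \<eta>(2))
  show "(LINT x|M. (\<alpha> x - 1)\<^sup>2) \<le> (1 + K0\<^sup>2) * \<delta>"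
    using dev(2)[OF meas(1) int(1), of 1] var(1) sq(1) unfolding a_def by (simp add: distrib_right)
  show "(LINT x|M. (\<beta> x - 1)\<^sup>2) \<le> (1 + K0\<^sup>2) * \<delta>"
    using dev(2)[OF meas(2) int(2), of 1] var(2) sq(2) unfolding b_def by (simp add: distrib_right)
qed

subsection \<open>Entropy and entropy production\<close>

text \<open>Passes a bound valid for every weak gradient to the infimum in
  \<open>dirichlet_integral\<close>. Without any weak gradient the infimum is infinite, and
  \<open>k > 0\<close> keeps the right side infinite, whereas
  \<open>0 * \<infinity> = 0\<close>.\<close>

lemma le_affine_INF_ennreal:
  fixes f :: "'i \<Rightarrow> ennreal"
  assumes "k > 0" and le: "\<And>i. i \<in> I \<Longrightarrow> v \<le> b + ennreal k * f i"
  shows "v \<le> b + ennreal k * (INF i\<in>I. f i)"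
proof (cases "(INF i\<in>I. f i) = \<infinity>")
  case True
  then have "ennreal k * (INF i\<in>I. f i) = \<infinity>" using \<open>k > 0\<close> by (simp add: ennreal_mult_top)
  then show ?thesis by simp
next
  case False
  show ?thesis
  proof (rule ennreal_le_epsilon)
    fix \<epsilon> :: real assume "\<epsilon> > 0"
    have "(INF i\<in>I. f i) + 0 < (INF i\<in>I. f i) + ennreal (\<epsilon> / k)"
      using False \<open>\<epsilon> > 0\<close> \<open>k > 0\<close> by (subst ennreal_add_left_cancel_less) auto
    then have "(INF i\<in>I. f i) < (INF i\<in>I. f i) + ennreal (\<epsilon> / k)" by simp
    then obtain i where i: "i \<in> I" "f i < (INF i\<in>I. f i) + ennreal (\<epsilon> / k)"
      unfolding INF_less_iff by blast
    have "v \<le> b + ennreal k * f i" by (rule le[OF i(1)])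
    also have "\<dots> \<le> b + ennreal k * ((INF i\<in>I. f i) + ennreal (\<epsilon> / k))"
      using i(2) by (intro add_left_mono mult_left_mono) auto
    also have "\<dots> = b + ennreal k * (INF i\<in>I. f i) + ennreal \<epsilon>"
      using \<open>k > 0\<close> \<open>\<epsilon> > 0\<close> by (simp add: distrib_left add.assoc flip: ennreal_mult)
    finally show "v \<le> b + ennreal k * (INF i\<in>I. f i) + ennreal \<epsilon>" .
  qed
qed

text \<open>For \<open>x\<close> at most 2, \<open>ln x <= x - 1\<close> produces the factor
  \<open>2 * x + 1\<close>, which is at most 5. For larger \<open>x\<close>,
  \<open>x <= 2 * (x - 1)\<close> bounds the logarithmic term with factor 4, and
  \<open>1 - x^2\<close> is negative.\<close>

lemma lambda_B_square_le:
  assumes "x \<ge> 0"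
  shows "lambda_B (x\<^sup>2) \<le> 5 * (x - 1)\<^sup>2 * (1 + max 0 (ln (x\<^sup>2)))"
proof -
  have ge: "5 * (x - 1)\<^sup>2 * 1 \<le> 5 * (x - 1)\<^sup>2 * (1 + max 0 (ln (x\<^sup>2)))"
    by (intro mult_left_mono) auto
  consider "x = 0" | "0 < x" "x \<le> 2" | "x > 2" using assms by linarith
  then show ?thesis
  proof cases
    case 1
    then show ?thesis by (simp add: lambda_B_def)
  next
    case 2
    have "ln x \<le> x - 1" using 2 by (intro ln_le_minus_one) auto
    then have "2 * x\<^sup>2 * ln x \<le> 2 * x\<^sup>2 * (x - 1)" by (intro mult_left_mono) auto
    then have "lambda_B (x\<^sup>2) \<le> 2 * x\<^sup>2 * (x - 1) - x\<^sup>2 + 1"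
      using 2 by (simp add: lambda_B_def ln_realpow)
    also have "\<dots> = (2 * x + 1) * (x - 1)\<^sup>2"
      by (simp add: power2_eq_square algebra_simps)
    also have "\<dots> \<le> 5 * (x - 1)\<^sup>2" using 2 by (intro mult_right_mono) auto
    finally show ?thesis using ge by simp
  next
    case 3
    have l: "0 \<le> ln (x\<^sup>2)" using 3 by (intro ln_ge_zero one_le_power) auto
    have "x\<^sup>2 \<le> (2 * (x - 1))\<^sup>2" using 3 by (intro power_mono) auto
    also have "\<dots> = 4 * (x - 1)\<^sup>2" unfolding power_mult_distrib by simp
    finally have "x\<^sup>2 * ln (x\<^sup>2) \<le> 4 * (x - 1)\<^sup>2 * ln (x\<^sup>2)"
      using l by (rule mult_right_mono)
    also have "\<dots> \<le> 5 * (x - 1)\<^sup>2 * ln (x\<^sup>2)" using l by (intro mult_right_mono) auto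
    finally have "x\<^sup>2 * ln (x\<^sup>2) \<le> 5 * (x - 1)\<^sup>2 * ln (x\<^sup>2)" .
    moreover have "1 \<le> x\<^sup>2" using 3 by (intro one_le_power) auto
    moreover have "0 \<le> 5 * (x - 1)\<^sup>2" by simp
    ultimately show ?thesis unfolding lambda_B_def max_absorb2[OF l] distrib_left by linarith
  qed
qed

text \<open>With \<open>x = sqrt r\<close> the core is \<open>(x - 1)^2 <= (x^2 - 1) * ln x\<close>,
  from \<open>ln x >= 1 - 1 / x\<close> above 1 and \<open>ln x <= x - 1\<close> below;
  \<open>ln r = 2 * ln x\<close> gives the factor 2.\<close>

lemma reaction_dissipation_ge:
  assumes "r \<ge> 0"
  shows "ennreal (2 * (sqrt r - 1)\<^sup>2) \<le> reaction_dissipation r"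
proof (cases "r = 0")
  case True
  then show ?thesis by (simp add: reaction_dissipation_def)
next
  case False
  define x where "x = sqrt r"
  have x: "x > 0" "r = x\<^sup>2" using False assms by (auto simp: x_def)
  have "(x - 1)\<^sup>2 \<le> (x\<^sup>2 - 1) * ln x"
  proof (cases "x \<ge> 1")
    case True
    have "ln (1 / x) \<le> 1 / x - 1" using x by (intro ln_le_minus_one) auto
    then have l: "1 - 1 / x \<le> ln x" using x by (simp add: ln_div)
    have "(x - 1)\<^sup>2 = (x - 1)\<^sup>2 * 1" by simp
    also have "\<dots> \<le> (x - 1)\<^sup>2 * ((x + 1) / x)" using x by (intro mult_left_mono) auto
    also have "\<dots> = (x\<^sup>2 - 1) * (1 - 1 / x)" using x by (simp add: power2_eq_square field_simps)
    also have "\<dots> \<le> (x\<^sup>2 - 1) * ln x"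
      using l True by (intro mult_left_mono) (auto simp: one_le_power)
    finally show ?thesis .
  next
    case False
    have l: "ln x \<le> x - 1" using x by (intro ln_le_minus_one) auto
    have "(x - 1)\<^sup>2 = (x - 1)\<^sup>2 * 1" by simp
    also have "\<dots> \<le> (x - 1)\<^sup>2 * (x + 1)" using x by (intro mult_left_mono) auto
    also have "\<dots> = (x\<^sup>2 - 1) * (x - 1)" by (simp add: power2_eq_square algebra_simps)
    also have "\<dots> \<le> (x\<^sup>2 - 1) * ln x"
      using l False x by (intro mult_left_mono_neg) (auto simp: power_le_one)
    finally show ?thesis .
  qed
  then have "2 * (sqrt r - 1)\<^sup>2 \<le> (r - 1) * ln r"
    using x unfolding x_def[symmetric] by (simp add: ln_realpow)
  then show ?thesis using False by (simp add: reaction_dissipation_def ennreal_leI)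
qed

text \<open>Isolates what the entropy argument takes from the potential: a normalized weight, two
  inequalities for \<open>exp (u / 2)\<close>, and \<open>V_le\<close>, through which a moment in
  \<open>q\<close> controls the growth of the logarithm.\<close>

locale equilibrium =
  fixes V q :: "'a::euclidean_space \<Rightarrow> real" and b K :: real
  assumes V_meas[measurable]: "V \<in> borel_measurable borel"
    and e_star_integrable: "integrable lborel (e_star V)" and e_star_mass: "(LINT x|lborel. e_star V x) = 1"
    and q_meas[measurable]: "q \<in> borel_measurable borel"
    and q_nonneg: "0 \<le> q x" and V_le: "V x \<le> q x + b" and K_pos: "K > 0"
    and moment_ineq: "weak_gradient u g \<Longrightarrow> (\<integral>\<^sup>+x. ennreal (exp (u x) * e_star V x) \<partial>lborel) < \<infinity> \<Longrightarrow>
      (\<integral>\<^sup>+x. ennreal ((exp (u x / 2) - 1)\<^sup>2 * e_star V x * q x) \<partial>lborel)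
        \<le> ennreal K * (\<integral>\<^sup>+x. ennreal ((exp (u x / 2) - 1)\<^sup>2 * e_star V x) \<partial>lborel)
          + ennreal K * (\<integral>\<^sup>+x. ennreal (exp (u x) * (norm (g x))\<^sup>2 * e_star V x) \<partial>lborel)"
    and poincare_ineq: "weak_gradient u g \<Longrightarrow> (\<integral>\<^sup>+x. ennreal (exp (u x) * e_star V x) \<partial>lborel) < \<infinity> \<Longrightarrow>
      \<exists>c. (\<integral>\<^sup>+x. ennreal ((exp (u x / 2) - c)\<^sup>2 * e_star V x) \<partial>lborel)
        \<le> ennreal K * (\<integral>\<^sup>+x. ennreal (exp (u x) * (norm (g x))\<^sup>2 * e_star V x) \<partial>lborel)"
begin

section \<open>The equilibrium measure and the functional inequalities in terms of the
  production\<close>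

lemma e_star_pos: "e_star V x > 0"
  by (simp add: e_star_def)

lemma e_star_measurable[measurable]: "e_star V \<in> borel_measurable borel"
  unfolding e_star_def[abs_def] by measurable

definition \<mu> :: "'a measure" where
  "\<mu> = density lborel (\<lambda>x. ennreal (e_star V x))"

lemma \<mu>_measurable: "borel_measurable \<mu> = borel_measurable borel"
  unfolding \<mu>_def by (simp cong: measurable_cong_sets)

lemma nn_integral_\<mu>:
  assumes [measurable]: "f \<in> borel_measurable borel" and "\<And>x. f x \<ge> 0"
  shows "(\<integral>\<^sup>+x. ennreal (f x) \<partial>\<mu>) = (\<integral>\<^sup>+x. ennreal (f x * e_star V x) \<partial>lborel)"
  unfolding \<mu>_def using assms(2) e_star_pos
  by (subst nn_integral_density) (auto intro!: nn_integral_cong simp: ennreal_mult less_imp_le mult.commute)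

lemma integral_\<mu>:
  assumes [measurable]: "f \<in> borel_measurable borel"
  shows "integrable \<mu> f \<longleftrightarrow> integrable lborel (\<lambda>x. e_star V x * f x)"
    "(LINT x|\<mu>. f x) = (LINT x|lborel. e_star V x * f x)"
  unfolding \<mu>_def
  using integrable_density[of f lborel "e_star V"] integral_density[of f lborel "e_star V"]
  by (simp_all add: less_imp_le[OF e_star_pos])

lemma \<mu>_mass: "finite_measure \<mu>" "measure \<mu> (space \<mu>) = 1"
proof -
  have "emeasure \<mu> (space \<mu>) = (\<integral>\<^sup>+x. ennreal 1 \<partial>\<mu>)" by simp
  also have "\<dots> = (\<integral>\<^sup>+x. ennreal (1 * e_star V x) \<partial>lborel)"
    by (rule nn_integral_\<mu>) auto
  also have "\<dots> = ennreal 1"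
    using e_star_integrable e_star_mass e_star_pos
    by (simp add: nn_integral_eq_integral less_imp_le)
  finally have 1: "emeasure \<mu> (space \<mu>) = ennreal 1" .
  then show "finite_measure \<mu>" by (intro finite_measureI) simp
  show "measure \<mu> (space \<mu>) = 1" using 1 by (simp add: measure_def)
qed

sublocale \<mu>: finite_measure \<mu>
  by (rule \<mu>_mass)

text \<open>The mean minimizes the squared deviation, so the unspecified constant of the Poincare
  inequality may be replaced by the mean.\<close>

lemma variance_le:
  assumes [measurable]: "f \<in> borel_measurable borel" and f2: "integrable \<mu> (\<lambda>x. (f x)\<^sup>2)"
  shows "ennreal (LINT x|\<mu>. (f x - (LINT y|\<mu>. f y))\<^sup>2) \<le> (\<integral>\<^sup>+x. ennreal ((f x - c)\<^sup>2 * e_star V x) \<partial>lborel)"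
proof -
  have m: "f \<in> borel_measurable \<mu>" unfolding \<mu>_measurable by fact
  have "(LINT x|\<mu>. (f x - (LINT y|\<mu>. f y))\<^sup>2) \<le> (LINT x|\<mu>. (f x - c)\<^sup>2)"
    using \<mu>.integral_square_deviation(2)[OF m f2 \<mu>_mass(2), of c] by simp
  then have "ennreal (LINT x|\<mu>. (f x - (LINT y|\<mu>. f y))\<^sup>2) \<le> ennreal (LINT x|\<mu>. (f x - c)\<^sup>2)"
    by (rule ennreal_leI)
  also have "\<dots> = (\<integral>\<^sup>+x. ennreal ((f x - c)\<^sup>2) \<partial>\<mu>)"
    using \<mu>.integral_square_deviation(1)[OF m f2 \<mu>_mass(2), of c]
    by (intro nn_integral_eq_integral[symmetric]) auto
  also have "\<dots> = (\<integral>\<^sup>+x. ennreal ((f x - c)\<^sup>2 * e_star V x) \<partial>lborel)"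
    by (rule nn_integral_\<mu>) auto
  finally show ?thesis .
qed

text \<open>The gradient terms have density \<open>f^2 * |g|^2 * e_star\<close> with
  \<open>f = exp (u / 2)\<close>; the pointwise domination trades \<open>f^2 * e_star\<close> for
  the weight that occurs in the production. In the applications this weight is the density itself
  for \<open>n\<close> and \<open>p\<close>, and \<open>N / 4\<close> for \<open>e\<close>.\<close>

lemma dirichlet_bounds:
  fixes f \<omega> u :: "'a \<Rightarrow> real"
  assumes [measurable]: "f \<in> borel_measurable borel" "\<omega> \<in> borel_measurable borel"
    and f2: "integrable \<mu> (\<lambda>x. (f x)\<^sup>2)"
    and f: "AE x in lborel. f x = exp (u x / 2)"
    and \<omega>: "AE x in lborel. (f x)\<^sup>2 * e_star V x \<le> \<kappa> * \<omega> x" and "\<kappa> > 0"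
  shows "ennreal (LINT x|\<mu>. (f x - (LINT y|\<mu>. f y))\<^sup>2) \<le> ennreal (K * \<kappa>) * dirichlet_integral \<omega> u"
    "(\<integral>\<^sup>+x. ennreal ((f x - 1)\<^sup>2 * e_star V x * q x) \<partial>lborel)
      \<le> ennreal K * (\<integral>\<^sup>+x. ennreal ((f x - 1)\<^sup>2 * e_star V x) \<partial>lborel)
        + ennreal (K * \<kappa>) * dirichlet_integral \<omega> u"
proof -
  have sq: "AE x in lborel. exp (u x) = (f x)\<^sup>2"
    using f by eventually_elim (simp add: power2_eq_square flip: exp_add)
  have fin: "(\<integral>\<^sup>+x. ennreal (exp (u x) * e_star V x) \<partial>lborel) < \<infinity>"
  proof -
    have "(\<integral>\<^sup>+x. ennreal (exp (u x) * e_star V x) \<partial>lborel) = (\<integral>\<^sup>+x. ennreal ((f x)\<^sup>2 * e_star V x) \<partial>lborel)"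
      using sq by (intro nn_integral_cong_AE) (auto elim!: eventually_mono)
    also have "\<dots> = (\<integral>\<^sup>+x. ennreal ((f x)\<^sup>2) \<partial>\<mu>)"
      by (rule nn_integral_\<mu>[symmetric]) auto
    also have "\<dots> < \<infinity>" using f2 by (simp add: nn_integral_eq_integral)
    finally show ?thesis .
  qed
  have grad: "ennreal K * (\<integral>\<^sup>+x. ennreal (exp (u x) * (norm (g x))\<^sup>2 * e_star V x) \<partial>lborel)
      \<le> ennreal (K * \<kappa>) * (\<integral>\<^sup>+x. ennreal (\<omega> x * (norm (g x))\<^sup>2) \<partial>lborel)"
    if g[measurable]: "g \<in> borel_measurable borel" for g :: "'a \<Rightarrow> 'a"
  proof -
    have "(\<integral>\<^sup>+x. ennreal (exp (u x) * (norm (g x))\<^sup>2 * e_star V x) \<partial>lborel)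
        \<le> (\<integral>\<^sup>+x. ennreal \<kappa> * ennreal (\<omega> x * (norm (g x))\<^sup>2) \<partial>lborel)"
    proof (rule nn_integral_mono_AE)
      show "AE x in lborel. ennreal (exp (u x) * (norm (g x))\<^sup>2 * e_star V x) \<le> ennreal \<kappa> * ennreal (\<omega> x * (norm (g x))\<^sup>2)"
        using sq \<omega>
      proof eventually_elim
        case (elim x)
        have "(norm (g x))\<^sup>2 * ((f x)\<^sup>2 * e_star V x) \<le> (norm (g x))\<^sup>2 * (\<kappa> * \<omega> x)"
          using elim(2) by (intro mult_left_mono) auto
        then show ?case
          unfolding elim(1) using \<open>\<kappa> > 0\<close>
          by (subst ennreal_mult'[symmetric]) (auto intro!: ennreal_leI simp: mult_ac)
      qed
    qed
    also have "\<dots> = ennreal \<kappa> * (\<integral>\<^sup>+x. ennreal (\<omega> x * (norm (g x))\<^sup>2) \<partial>lborel)"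
      using g by (intro nn_integral_cmult) measurable
    finally have "ennreal K * (\<integral>\<^sup>+x. ennreal (exp (u x) * (norm (g x))\<^sup>2 * e_star V x) \<partial>lborel)
        \<le> ennreal K * (ennreal \<kappa> * (\<integral>\<^sup>+x. ennreal (\<omega> x * (norm (g x))\<^sup>2) \<partial>lborel))"
      by (rule mult_left_mono) simp
    also have "\<dots> = ennreal (K * \<kappa>) * (\<integral>\<^sup>+x. ennreal (\<omega> x * (norm (g x))\<^sup>2) \<partial>lborel)"
      using K_pos \<open>\<kappa> > 0\<close> by (simp add: ennreal_mult mult.assoc)
    finally show ?thesis .
  qed
  have "K * \<kappa> > 0" using K_pos \<open>\<kappa> > 0\<close> by simp
  have "ennreal (LINT x|\<mu>. (f x - (LINT y|\<mu>. f y))\<^sup>2) \<le> 0 + ennreal (K * \<kappa>) * dirichlet_integral \<omega> u"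
    unfolding dirichlet_integral_def
  proof (rule le_affine_INF_ennreal[OF \<open>K * \<kappa> > 0\<close>])
    fix g assume "g \<in> {g. weak_gradient u g}"
    then have ug: "weak_gradient u g" by simp
    then have [measurable]: "g \<in> borel_measurable borel"
      unfolding weak_gradient_def by (auto intro: locally_integrable_measurable)
    obtain c where c: "(\<integral>\<^sup>+x. ennreal ((exp (u x / 2) - c)\<^sup>2 * e_star V x) \<partial>lborel)
        \<le> ennreal K * (\<integral>\<^sup>+x. ennreal (exp (u x) * (norm (g x))\<^sup>2 * e_star V x) \<partial>lborel)"
      using poincare_ineq[OF ug fin] by blast
    have "ennreal (LINT x|\<mu>. (f x - (LINT y|\<mu>. f y))\<^sup>2) \<le> (\<integral>\<^sup>+x. ennreal ((f x - c)\<^sup>2 * e_star V x) \<partial>lborel)"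
      by (rule variance_le) fact+
    also have "\<dots> = (\<integral>\<^sup>+x. ennreal ((exp (u x / 2) - c)\<^sup>2 * e_star V x) \<partial>lborel)"
      using f by (intro nn_integral_cong_AE) (auto elim!: eventually_mono)
    also note c
    also note grad[OF \<open>g \<in> borel_measurable borel\<close>]
    finally show "ennreal (LINT x|\<mu>. (f x - (LINT y|\<mu>. f y))\<^sup>2)
        \<le> 0 + ennreal (K * \<kappa>) * (\<integral>\<^sup>+x. ennreal (\<omega> x * (norm (g x))\<^sup>2) \<partial>lborel)" by simp
  qed
  then show "ennreal (LINT x|\<mu>. (f x - (LINT y|\<mu>. f y))\<^sup>2) \<le> ennreal (K * \<kappa>) * dirichlet_integral \<omega> u"
    by simp
  have f_eq: "(\<integral>\<^sup>+x. ennreal ((exp (u x / 2) - 1)\<^sup>2 * e_star V x * h x) \<partial>lborel)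
      = (\<integral>\<^sup>+x. ennreal ((f x - 1)\<^sup>2 * e_star V x * h x) \<partial>lborel)" for h
    using f by (intro nn_integral_cong_AE) (auto elim!: eventually_mono)
  show "(\<integral>\<^sup>+x. ennreal ((f x - 1)\<^sup>2 * e_star V x * q x) \<partial>lborel)
      \<le> ennreal K * (\<integral>\<^sup>+x. ennreal ((f x - 1)\<^sup>2 * e_star V x) \<partial>lborel)
        + ennreal (K * \<kappa>) * dirichlet_integral \<omega> u"
    unfolding dirichlet_integral_def
  proof (rule le_affine_INF_ennreal[OF \<open>K * \<kappa> > 0\<close>])
    fix g assume "g \<in> {g. weak_gradient u g}"
    then have ug: "weak_gradient u g" by simp
    then have [measurable]: "g \<in> borel_measurable borel"
      unfolding weak_gradient_def by (auto intro: locally_integrable_measurable)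
    have "(\<integral>\<^sup>+x. ennreal ((f x - 1)\<^sup>2 * e_star V x * q x) \<partial>lborel)
        \<le> ennreal K * (\<integral>\<^sup>+x. ennreal ((f x - 1)\<^sup>2 * e_star V x) \<partial>lborel)
          + ennreal K * (\<integral>\<^sup>+x. ennreal (exp (u x) * (norm (g x))\<^sup>2 * e_star V x) \<partial>lborel)"
      using moment_ineq[OF ug fin] f_eq[of q] f_eq[of "\<lambda>x. 1"] by simp
    also have "\<dots> \<le> ennreal K * (\<integral>\<^sup>+x. ennreal ((f x - 1)\<^sup>2 * e_star V x) \<partial>lborel)
        + ennreal (K * \<kappa>) * (\<integral>\<^sup>+x. ennreal (\<omega> x * (norm (g x))\<^sup>2) \<partial>lborel)"
      by (intro add_left_mono grad) fact
    finally show "(\<integral>\<^sup>+x. ennreal ((f x - 1)\<^sup>2 * e_star V x * q x) \<partial>lborel)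
        \<le> ennreal K * (\<integral>\<^sup>+x. ennreal ((f x - 1)\<^sup>2 * e_star V x) \<partial>lborel)
          + ennreal (K * \<kappa>) * (\<integral>\<^sup>+x. ennreal (\<omega> x * (norm (g x))\<^sup>2) \<partial>lborel)" .
  qed
qed

text \<open>As \<open>(\<alpha> x)^2 * e_star V x = \<nu> x / (C * \<sigma> x)\<close>, the lower
  bound \<open>s0\<close> makes \<open>\<nu>\<close> dominate. The growth of the logarithm splits
  the entropy into a distance term \<open>(\<alpha> - 1)^2\<close> and its moment in
  \<open>q\<close>; the moment inequality reduces the latter to the former plus production.\<close>

lemma species_bounds:
  fixes \<nu> \<sigma> \<alpha> wt :: "'a \<Rightarrow> real" and C s0 s1 M :: real
  defines "wt \<equiv> \<lambda>x. C * \<sigma> x * e_star V x"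
  defines "\<alpha> \<equiv> \<lambda>x. sqrt (\<nu> x / wt x)"
  defines "D \<equiv> dirichlet_integral \<nu> (\<lambda>x. ln (\<nu> x / wt x))"
  defines "L \<equiv> max 0 (ln (M / (C * s0)) + 2 * b)"
  assumes [measurable]: "\<nu> \<in> borel_measurable borel" "\<sigma> \<in> borel_measurable borel"
    and \<nu>_nonneg: "\<And>x. \<nu> x \<ge> 0" and \<nu>_pos: "AE x in lborel. \<nu> x > 0"
    and \<nu>_bound: "AE x in lborel. \<nu> x \<le> M" and "M > 0"
    and \<nu>_int: "integrable lborel \<nu>"
    and "C > 0" "s0 > 0" and \<sigma>: "\<And>x. s0 \<le> \<sigma> x" "\<And>x. \<sigma> x \<le> s1"
  shows "\<alpha> \<in> borel_measurable borel" "integrable \<mu> (\<lambda>x. (\<alpha> x)\<^sup>2)"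
    and "(LINT x|\<mu>. (\<alpha> x)\<^sup>2) \<le> (LINT x|lborel. \<nu> x) / (C * s0)"
    and "ennreal (LINT x|\<mu>. (\<alpha> x - (LINT y|\<mu>. \<alpha> y))\<^sup>2) \<le> ennreal (K / (C * s0)) * D"
    and "(\<integral>\<^sup>+x. ennreal (wt x * lambda_B (\<nu> x / wt x)) \<partial>lborel)
      \<le> ennreal (5 * C * s1 * (1 + L + 2 * K)) * (\<integral>\<^sup>+x. ennreal ((\<alpha> x - 1)\<^sup>2 * e_star V x) \<partial>lborel)
        + ennreal (10 * C * s1 * (K / (C * s0))) * D"
proof -
  have wt_pos: "wt x > 0" for x
    unfolding wt_def using \<open>C > 0\<close> less_le_trans[OF \<open>s0 > 0\<close> \<sigma>(1)[of x]] e_star_pos[of x]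
    by (intro mult_pos_pos)
  have \<sigma>_pos: "\<sigma> x > 0" for x using \<open>s0 > 0\<close> \<sigma>(1)[of x] by linarith
  then have "s1 > 0" using \<sigma>(2) by (meson less_le_trans)
  have Cs: "C * s0 > 0" using \<open>C > 0\<close> \<open>s0 > 0\<close> by simp
  have [measurable]: "wt \<in> borel_measurable borel" unfolding wt_def by measurable
  show \<alpha>_meas[measurable]: "\<alpha> \<in> borel_measurable borel" unfolding \<alpha>_def by measurable
  have \<alpha>2: "(\<alpha> x)\<^sup>2 = \<nu> x / wt x" for x
    unfolding \<alpha>_def using \<nu>_nonneg[of x] wt_pos[of x] by simp
  have \<alpha>_nonneg: "\<alpha> x \<ge> 0" for x
    unfolding \<alpha>_def using \<nu>_nonneg[of x] wt_pos[of x] by simp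
  have dom: "(\<alpha> x)\<^sup>2 * e_star V x \<le> 1 / (C * s0) * \<nu> x" for x
  proof -
    have "(\<alpha> x)\<^sup>2 * e_star V x = \<nu> x / (C * \<sigma> x)"
      unfolding \<alpha>2 wt_def using e_star_pos[of x] by simp
    also have "\<dots> \<le> \<nu> x / (C * s0)"
      using Cs \<sigma>(1)[of x] \<open>C > 0\<close> \<nu>_nonneg[of x] \<open>s0 > 0\<close> by (intro divide_left_mono mult_left_mono mult_pos_pos) auto
    finally show ?thesis by simp
  qed
  have int: "integrable lborel (\<lambda>x. e_star V x * (\<alpha> x)\<^sup>2)"
  proof (rule Bochner_Integration.integrable_bound)
    show "integrable lborel (\<lambda>x. 1 / (C * s0) * \<nu> x)" using \<nu>_int by simp
    show "AE x in lborel. norm (e_star V x * (\<alpha> x)\<^sup>2) \<le> norm (1 / (C * s0) * \<nu> x)"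
    proof (rule AE_I2)
      fix x :: 'a
      have "norm (e_star V x * (\<alpha> x)\<^sup>2) = (\<alpha> x)\<^sup>2 * e_star V x"
        using e_star_pos[of x] by (simp add: abs_mult mult.commute)
      also have "\<dots> \<le> norm (1 / (C * s0) * \<nu> x)" 
        unfolding real_norm_def by (rule order_trans[OF dom abs_ge_self])
      finally show "norm (e_star V x * (\<alpha> x)\<^sup>2) \<le> norm (1 / (C * s0) * \<nu> x)" .
    qed
  qed measurable
  show \<alpha>2_int: "integrable \<mu> (\<lambda>x. (\<alpha> x)\<^sup>2)"
    using int by (subst integral_\<mu>(1)) auto
  have "(LINT x|\<mu>. (\<alpha> x)\<^sup>2) = (LINT x|lborel. e_star V x * (\<alpha> x)\<^sup>2)"
    by (rule integral_\<mu>(2)) measurable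
  also have "\<dots> \<le> (LINT x|lborel. 1 / (C * s0) * \<nu> x)"
    using int \<nu>_int dom by (intro integral_mono) (auto simp: mult.commute)
  also have "\<dots> = (LINT x|lborel. \<nu> x) / (C * s0)" by simp
  finally show "(LINT x|\<mu>. (\<alpha> x)\<^sup>2) \<le> (LINT x|lborel. \<nu> x) / (C * s0)" .
  \<comment> \<open>Positivity matters: where \<open>\<nu>\<close> vanishes, \<open>\<alpha>\<close>
    is 0, but \<open>ln 0 = 0\<close> would make the right side 1.\<close>
  have \<alpha>_exp: "AE x in lborel. \<alpha> x = exp (ln (\<nu> x / wt x) / 2)"
    using \<nu>_pos
  proof eventually_elim
    case (elim x)
    then have "\<nu> x / wt x > 0" using wt_pos[of x] by simp
    then show ?case unfolding \<alpha>_def by (simp flip: ln_sqrt)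
  qed
  have \<kappa>: "1 / (C * s0) > 0" using Cs by simp
  have \<omega>: "AE x in lborel. (\<alpha> x)\<^sup>2 * e_star V x \<le> 1 / (C * s0) * \<nu> x" using dom by simp
  have \<nu>_meas: "\<nu> \<in> borel_measurable borel" by measurable
  note db = dirichlet_bounds[OF \<alpha>_meas \<nu>_meas \<alpha>2_int \<alpha>_exp \<omega> \<kappa>, folded D_def]
  show "ennreal (LINT x|\<mu>. (\<alpha> x - (LINT y|\<mu>. \<alpha> y))\<^sup>2) \<le> ennreal (K / (C * s0)) * D"
    using db(1) by simp
  define d where "d = (\<integral>\<^sup>+x. ennreal ((\<alpha> x - 1)\<^sup>2 * e_star V x) \<partial>lborel)"
  have "L \<ge> 0" by (simp add: L_def)
  have "(\<integral>\<^sup>+x. ennreal (wt x * lambda_B (\<nu> x / wt x)) \<partial>lborel)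
      \<le> (\<integral>\<^sup>+x. ennreal (5 * C * s1 * (1 + L)) * ennreal ((\<alpha> x - 1)\<^sup>2 * e_star V x)
          + ennreal (10 * C * s1) * ennreal ((\<alpha> x - 1)\<^sup>2 * e_star V x * q x) \<partial>lborel)"
  proof (rule nn_integral_mono_AE)
    show "AE x in lborel. ennreal (wt x * lambda_B (\<nu> x / wt x))
        \<le> ennreal (5 * C * s1 * (1 + L)) * ennreal ((\<alpha> x - 1)\<^sup>2 * e_star V x)
          + ennreal (10 * C * s1) * ennreal ((\<alpha> x - 1)\<^sup>2 * e_star V x * q x)"
      using \<nu>_pos \<nu>_bound
    proof eventually_elim
      case (elim x)
      \<comment> \<open>The bound \<open>M\<close> makes \<open>(\<alpha> x)^2\<close> at most
        \<open>M / (C * s0) * exp (2 * V x)\<close>; then \<open>V_le\<close> applies, with its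
        \<open>2 * b\<close> already contained in \<open>L\<close>.\<close>
      have "ln ((\<alpha> x)\<^sup>2) \<le> L + 2 * q x"
      proof -
        have "(\<alpha> x)\<^sup>2 * e_star V x \<le> M / (C * s0)"
          using dom[of x] elim(2) Cs by (simp add: field_simps)
        then have "(\<alpha> x)\<^sup>2 \<le> M / (C * s0) * exp (2 * V x)"
          unfolding e_star_def by (simp add: exp_minus field_simps)
        moreover have "(\<alpha> x)\<^sup>2 > 0" unfolding \<alpha>2 using elim(1) wt_pos[of x] by simp
        ultimately have "ln ((\<alpha> x)\<^sup>2) \<le> ln (M / (C * s0) * exp (2 * V x))"
          by (subst ln_le_cancel_iff) (use \<open>M > 0\<close> Cs in auto)
        also have "\<dots> = ln (M / (C * s0)) + 2 * V x"
          using \<open>M > 0\<close> Cs by (subst ln_mult) auto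
        also have "\<dots> \<le> L + 2 * q x" using V_le[of x] unfolding L_def by linarith
        finally show ?thesis .
      qed
      then have "1 + max 0 (ln ((\<alpha> x)\<^sup>2)) \<le> 1 + L + 2 * q x"
        using \<open>L \<ge> 0\<close> q_nonneg[of x] by simp
      then have "5 * (\<alpha> x - 1)\<^sup>2 * (1 + max 0 (ln ((\<alpha> x)\<^sup>2))) \<le> 5 * (\<alpha> x - 1)\<^sup>2 * (1 + L + 2 * q x)"
        by (intro mult_left_mono) auto
      then have "lambda_B (\<nu> x / wt x) \<le> 5 * (\<alpha> x - 1)\<^sup>2 * (1 + L + 2 * q x)"
        using lambda_B_square_le[OF \<alpha>_nonneg[of x]] unfolding \<alpha>2 by linarith
      then have "wt x * lambda_B (\<nu> x / wt x) \<le> wt x * (5 * (\<alpha> x - 1)\<^sup>2 * (1 + L + 2 * q x))"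
        using wt_pos[of x] by (intro mult_left_mono) auto
      also have "\<dots> \<le> (C * s1 * e_star V x) * (5 * (\<alpha> x - 1)\<^sup>2 * (1 + L + 2 * q x))"
        unfolding wt_def using \<open>C > 0\<close> \<sigma>(2)[of x] e_star_pos[of x] \<open>L \<ge> 0\<close> q_nonneg[of x]
        by (intro mult_right_mono mult_left_mono) auto
      also have "\<dots> = 5 * C * s1 * (1 + L) * ((\<alpha> x - 1)\<^sup>2 * e_star V x) + 10 * C * s1 * ((\<alpha> x - 1)\<^sup>2 * e_star V x * q x)"
        by (simp add: algebra_simps)
      finally have "ennreal (wt x * lambda_B (\<nu> x / wt x))
          \<le> ennreal (5 * C * s1 * (1 + L) * ((\<alpha> x - 1)\<^sup>2 * e_star V x) + 10 * C * s1 * ((\<alpha> x - 1)\<^sup>2 * e_star V x * q x))"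
        by (rule ennreal_leI)
      also have "\<dots> = ennreal (5 * C * s1 * (1 + L)) * ennreal ((\<alpha> x - 1)\<^sup>2 * e_star V x)
          + ennreal (10 * C * s1) * ennreal ((\<alpha> x - 1)\<^sup>2 * e_star V x * q x)"
      proof -
        have n: "0 \<le> 5 * C * s1 * (1 + L)" "0 \<le> 10 * C * s1" "0 \<le> (\<alpha> x - 1)\<^sup>2 * e_star V x" "0 \<le> (\<alpha> x - 1)\<^sup>2 * e_star V x * q x"
          using \<open>C > 0\<close> \<open>s1 > 0\<close> \<open>L \<ge> 0\<close> e_star_pos[of x] q_nonneg[of x] by auto
        show ?thesis
          by (simp only: ennreal_plus[OF mult_nonneg_nonneg[OF n(1) n(3)] mult_nonneg_nonneg[OF n(2) n(4)]]
              ennreal_mult[OF n(1) n(3)] ennreal_mult[OF n(2) n(4)])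
      qed
      finally show ?case .
    qed
  qed
  also have "\<dots> = ennreal (5 * C * s1 * (1 + L)) * d
      + ennreal (10 * C * s1) * (\<integral>\<^sup>+x. ennreal ((\<alpha> x - 1)\<^sup>2 * e_star V x * q x) \<partial>lborel)"
    unfolding d_def by (subst nn_integral_add, measurable, subst (1 2) nn_integral_cmult, measurable)
  also have "\<dots> \<le> ennreal (5 * C * s1 * (1 + L)) * d
      + ennreal (10 * C * s1) * (ennreal K * d + ennreal (K * (1 / (C * s0))) * D)"
    using db(2) unfolding d_def by (intro add_left_mono mult_left_mono) auto
  also have "\<dots> = (ennreal (5 * C * s1 * (1 + L)) + ennreal (10 * C * s1) * ennreal K) * d
      + ennreal (10 * C * s1) * ennreal (K * (1 / (C * s0))) * D"
    by (simp only: distrib_left distrib_right mult.assoc add.assoc)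
  also have "ennreal (5 * C * s1 * (1 + L)) + ennreal (10 * C * s1) * ennreal K = ennreal (5 * C * s1 * (1 + L + 2 * K))"
  proof -
    have n: "0 \<le> 5 * C * s1 * (1 + L)" "0 \<le> 10 * C * s1" "0 \<le> K"
      using \<open>C > 0\<close> \<open>s1 > 0\<close> \<open>L \<ge> 0\<close> K_pos by auto
    have "5 * C * s1 * (1 + L + 2 * K) = 5 * C * s1 * (1 + L) + 10 * C * s1 * K"
      by (simp add: algebra_simps)
    then show ?thesis
      by (simp only: ennreal_plus[OF n(1) mult_nonneg_nonneg[OF n(2) n(3)]] ennreal_mult[OF n(2) n(3)])
  qed
  also have "ennreal (10 * C * s1) * ennreal (K * (1 / (C * s0))) = ennreal (10 * C * s1 * (K / (C * s0)))"
    using \<open>C > 0\<close> \<open>s1 > 0\<close> K_pos Cs by (subst ennreal_mult[symmetric]) auto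
  finally show "(\<integral>\<^sup>+x. ennreal (wt x * lambda_B (\<nu> x / wt x)) \<partial>lborel)
      \<le> ennreal (5 * C * s1 * (1 + L + 2 * K)) * (\<integral>\<^sup>+x. ennreal ((\<alpha> x - 1)\<^sup>2 * e_star V x) \<partial>lborel)
        + ennreal (10 * C * s1 * (K / (C * s0))) * D"
    unfolding d_def .
qed

end

section \<open>Assembly of the entropy estimate\<close>

context equilibrium
begin

text \<open>The constant is fixed before \<open>k\<close>, \<open>n\<close>, \<open>p\<close>,
  \<open>e\<close> and from bounds alone, so that it can serve all times at once.\<close>

lemma entropy_le_production:
  fixes c Cn Cp k_lo e_lo e_hi M M1 :: real
  assumes pos: "c > 0" "Cn > 0" "Cp > 0" "k_lo > 0" "e_lo > 0" "M > 0"
  shows "\<exists>K'>0. \<forall>k n p e. n \<in> borel_measurable borel \<longrightarrow> p \<in> borel_measurable borel \<longrightarrow> e \<in> borel_measurable borel \<longrightarrow>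
    (\<forall>x. 0 \<le> n x) \<longrightarrow> (\<forall>x. 0 \<le> p x) \<longrightarrow> (\<forall>x. k_lo \<le> k x) \<longrightarrow>
    integrable lborel n \<longrightarrow> integrable lborel p \<longrightarrow>
    (LINT x|lborel. n x) \<le> M1 \<longrightarrow> (LINT x|lborel. p x) \<le> M1 \<longrightarrow>
    (AE x in lborel. n x \<le> M) \<longrightarrow> (AE x in lborel. p x \<le> M) \<longrightarrow>
    (\<forall>x. e_lo * e_star V x \<le> e x \<and> e x \<le> e_hi * e_star V x) \<longrightarrow>
    (LINT x|lborel. e x) = 1 \<longrightarrow> (LINT x|lborel. n x - p x) = Cn - Cp \<longrightarrow>
    rel_entropy V c Cn Cp n p e \<le> ennreal K' * entropy_production V c Cn Cp k n p e"
proof -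
  define s0 s1 where "s0 = sqrt e_lo" and "s1 = sqrt e_hi"
  have "s0 > 0" using pos by (simp add: s0_def)
  \<comment> \<open>A common bound for the second moments of \<open>\<alpha>\<close> and
    \<open>\<beta>\<close>.\<close>
  define A where "A = M1 / (Cn * s0) + M1 / (Cp * s0)"
  \<comment> \<open>Times the production, these bound the variances of \<open>\<alpha>\<close>,
    \<open>\<beta>\<close>, \<open>\<sigma>\<close> and the squared \<open>L^2\<close> norm of
    \<open>\<alpha> \<beta> - 1\<close>. In \<open>ks\<close> the quotient compares
    \<open>\<sigma>^2 * e_star\<close> with \<open>N / 4\<close>; in \<open>kr\<close> the 2 comes
    from \<open>reaction_dissipation_ge\<close> and the product from
    \<open>k * e >= k_lo * e_lo * e_star\<close>.\<close>
  define kn kp ks kr where "kn = K / (Cn * s0)" and "kp = K / (Cp * s0)"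
    and "ks = K * (4 * s1\<^sup>2 / (c * s0))" and "kr = 1 / (2 * (k_lo * e_lo))"
  define \<kappa> where "\<kappa> = kn + kp + ks + kr"
  have k_nonneg: "kn \<ge> 0" "kp \<ge> 0" "ks \<ge> 0" "kr \<ge> 0"
    using pos K_pos \<open>s0 > 0\<close> by (simp_all add: kn_def kp_def ks_def kr_def)
  define K0 where "K0 = (1 + sqrt A) + (Cn + Cp) * (2 * s1 * sqrt A + 2 * A) / Cn + (Cn + Cp) * (2 * s1 * sqrt A + 2 * A) / Cp"
  define En Ep Fn Fp where "En = 5 * Cn * s1 * (1 + max 0 (ln (M / (Cn * s0)) + 2 * b) + 2 * K)"
    and "Ep = 5 * Cp * s1 * (1 + max 0 (ln (M / (Cp * s0)) + 2 * b) + 2 * K)"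
    and "Fn = 10 * Cn * s1 * (K / (Cn * s0))" and "Fp = 10 * Cp * s1 * (K / (Cp * s0))"
  define H where "H = (En * ((1 + K0\<^sup>2) * \<kappa>) + Fn) + (Ep * ((1 + K0\<^sup>2) * \<kappa>) + Fp) + (c + Cn + Cp) / 2 * (2 * \<kappa>)"
  \<comment> \<open>\<open>K' > 0\<close> has to hold before any data are given, while the signs
    that enter \<open>H\<close>, such as \<open>s1 > 0\<close>, are derived from given data.\<close>
  define K' where "K' = \<bar>H\<bar> + 1"
  have main: "rel_entropy V c Cn Cp n p e \<le> ennreal K' * entropy_production V c Cn Cp k n p e"
    if [measurable]: "n \<in> borel_measurable borel" "p \<in> borel_measurable borel" "e \<in> borel_measurable borel"
      and nonneg: "\<forall>x. 0 \<le> n x" "\<forall>x. 0 \<le> p x" and k: "\<forall>x. k_lo \<le> k x"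
      and int: "integrable lborel n" "integrable lborel p"
      and mass: "(LINT x|lborel. n x) \<le> M1" "(LINT x|lborel. p x) \<le> M1"
      and bound: "AE x in lborel. n x \<le> M" "AE x in lborel. p x \<le> M"
      and e: "\<forall>x. e_lo * e_star V x \<le> e x \<and> e x \<le> e_hi * e_star V x"
      and e_mass: "(LINT x|lborel. e x) = 1" and charge: "(LINT x|lborel. n x - p x) = Cn - Cp"
    for k n p e
  proof (cases "entropy_production V c Cn Cp k n p e = \<infinity>")
    case True
    have "K' > 0" unfolding K'_def by simp
    then have "ennreal K' * entropy_production V c Cn Cp k n p e = \<infinity>" using True by (simp add: ennreal_mult_top)
    then show ?thesis by simp
  next
    case False
    define \<sigma> where "\<sigma> = (\<lambda>x. sqrt (e x / e_star V x))"
    have \<sigma>_meas[measurable]: "\<sigma> \<in> borel_measurable borel" unfolding \<sigma>_def by measurable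
    have \<sigma>: "s0 \<le> \<sigma> x" "\<sigma> x \<le> s1" for x
      unfolding \<sigma>_def s0_def s1_def using e e_star_pos[of x]
      by (auto intro!: real_sqrt_le_mono simp: pos_le_divide_eq pos_divide_le_eq)
    have \<sigma>_pos: "\<sigma> x > 0" for x using \<sigma>(1)[of x] \<open>s0 > 0\<close> by linarith
    have s1: "s1 > 0" using \<sigma>(2)[of undefined] \<sigma>_pos[of undefined] by linarith
    have e_pos: "e x > 0" for x
      using e e_star_pos[of x] pos by (meson less_le_trans mult_pos_pos)
    have e_eq: "e x = (\<sigma> x)\<^sup>2 * e_star V x" for x
      unfolding \<sigma>_def using e_pos[of x] e_star_pos[of x] by simp
    have sqrt_e_star: "sqrt (e_star V x) = exp (- V x)" for x
      by (rule real_sqrt_unique) (auto simp: e_star_def power2_eq_square simp flip: exp_add)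
    have sqrt_e: "sqrt (e x) = \<sigma> x * exp (- V x)" for x
      unfolding e_eq real_sqrt_mult sqrt_e_star using \<sigma>_pos[of x] by simp
    have e_star_sq: "exp (- V x) * exp (- V x) = e_star V x" for x
      by (simp add: e_star_def flip: exp_add)
    \<comment> \<open>As \<open>sqrt (e x) = \<sigma> x * exp (- V x)\<close>, the second factor
      \<open>exp (- V x)\<close> in \<open>w\<close> completes the weight to
      \<open>e_star\<close>.\<close>
    have w_eq: "w V C e = (\<lambda>x. C * \<sigma> x * e_star V x)" for C
      unfolding w_def sqrt_e by (simp add: mult.assoc e_star_sq)
    define wn wp where "wn = (\<lambda>x. Cn * \<sigma> x * e_star V x)" and "wp = (\<lambda>x. Cp * \<sigma> x * e_star V x)"
    have w_pos: "wn x > 0" "wp x > 0" for x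
      unfolding wn_def wp_def using pos \<sigma>_pos[of x] e_star_pos[of x] by auto
    have [measurable]: "wn \<in> borel_measurable borel" "wp \<in> borel_measurable borel"
      unfolding wn_def wp_def by measurable
    define D1 D2 where "D1 = dirichlet_integral n (\<lambda>x. ln (n x / wn x))" and "D2 = dirichlet_integral p (\<lambda>x. ln (p x / wp x))"
    define \<omega> where "\<omega> = (\<lambda>x. (n x + p x + c * sqrt (e x) * sqrt (e_star V x)) / 4)"
    have [measurable]: "\<omega> \<in> borel_measurable borel" unfolding \<omega>_def by measurable
    define D3 where "D3 = dirichlet_integral \<omega> (\<lambda>x. ln (e x / e_star V x))"
    define rr where "rr = (\<lambda>x. n x * p x / (wn x * wp x))"
    have [measurable]: "rr \<in> borel_measurable borel" unfolding rr_def by measurable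
    have rr_nonneg: "rr x \<ge> 0" for x unfolding rr_def using nonneg w_pos[of x] by simp
    define D4 where "D4 = (\<integral>\<^sup>+x. ennreal (k x * e x) * reaction_dissipation (rr x) \<partial>lborel)"
    have P_eq: "entropy_production V c Cn Cp k n p e = D1 + D2 + D3 + D4"
      unfolding entropy_production_def D1_def D2_def D3_def D4_def \<omega>_def rr_def w_eq wn_def wp_def ..
    define P where "P = enn2real (entropy_production V c Cn Cp k n p e)"
    have P: "entropy_production V c Cn Cp k n p e = ennreal P" "P \<ge> 0"
      unfolding P_def using False by (auto simp: less_top)
    have D_le: "D1 \<le> ennreal P" "D2 \<le> ennreal P" "D3 \<le> ennreal P" "D4 \<le> ennreal P"
    proof -
      have a: "D1 \<le> D1 + D2 + D3 + D4" "D2 \<le> D1 + D2 + D3 + D4" "D3 \<le> D1 + D2 + D3 + D4" "D4 \<le> D1 + D2 + D3 + D4"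
        by (simp_all add: add_increasing2 add_increasing)
      show "D1 \<le> ennreal P" "D2 \<le> ennreal P" "D3 \<le> ennreal P" "D4 \<le> ennreal P"
        using a unfolding P_eq[symmetric] P(1) .
    qed
    define \<delta> where "\<delta> = \<kappa> * P"
    have \<kappa>_ge: "kn \<le> \<kappa>" "kp \<le> \<kappa>" "ks \<le> \<kappa>" "kr \<le> \<kappa>" "\<kappa> \<ge> 0" unfolding \<kappa>_def using k_nonneg by auto
    have le_\<delta>: "x \<le> \<delta>" if "ennreal x \<le> ennreal a * D" "D \<le> ennreal P" "0 \<le> a" "a \<le> \<kappa>" for x a D
    proof -
      note that(1)
      also have "ennreal a * D \<le> ennreal a * ennreal P" using that(2) by (rule mult_left_mono) simp
      also have "\<dots> = ennreal (a * P)" using that P(2) by (simp add: ennreal_mult)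
      finally have "x \<le> a * P" using that P(2) by (subst (asm) ennreal_le_iff) auto
      also have "\<dots> \<le> \<delta>" unfolding \<delta>_def using that P(2) by (intro mult_right_mono) auto
      finally show ?thesis .
    qed

    have D4_ge: "ennreal (k_lo * e_lo * e_star V x) * reaction_dissipation (rr x) \<le> ennreal (k x * e x) * reaction_dissipation (rr x)" for x
    proof (intro mult_right_mono ennreal_leI)
      have "k_lo * (e_lo * e_star V x) \<le> k x * e x"
        using k e pos e_star_pos[of x] by (intro mult_mono) (auto intro: order_trans[OF less_imp_le])
      then show "k_lo * e_lo * e_star V x \<le> k x * e x" by (simp add: mult.assoc)
    qed simp
    have rd_meas[measurable]: "reaction_dissipation \<in> borel_measurable borel"
      unfolding reaction_dissipation_def[abs_def] by measurable
    \<comment> \<open>If \<open>n\<close> or \<open>p\<close> vanished on a set of positive measure,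
      the reaction term would be infinite. Finite production therefore makes the logarithms
      meaningful almost everywhere.\<close>
    have n_pos: "AE x in lborel. n x > 0" and p_pos: "AE x in lborel. p x > 0"
    proof -
      have "(\<integral>\<^sup>+x. ennreal (k_lo * e_lo * e_star V x) * reaction_dissipation (rr x) \<partial>lborel) \<le> D4"
        unfolding D4_def by (intro nn_integral_mono D4_ge)
      also have "\<dots> < \<infinity>" using D_le(4) by (rule le_less_trans) simp
      finally have "AE x in lborel. ennreal (k_lo * e_lo * e_star V x) * reaction_dissipation (rr x) \<noteq> \<infinity>"
        by (intro nn_integral_PInf_AE) auto
      then have rr_ne: "AE x in lborel. rr x \<noteq> 0"
      proof eventually_elim
        case (elim x)
        show ?case
        proof
          assume "rr x = 0"
          then have "ennreal (k_lo * e_lo * e_star V x) * reaction_dissipation (rr x) = \<infinity>"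
            using pos e_star_pos[of x] by (simp add: reaction_dissipation_def ennreal_mult_top)
          then show False using elim by simp
        qed
      qed
      show "AE x in lborel. n x > 0"
        using rr_ne by eventually_elim (use nonneg in \<open>auto simp: rr_def less_le\<close>)
      show "AE x in lborel. p x > 0"
        using rr_ne by eventually_elim (use nonneg in \<open>auto simp: rr_def less_le\<close>)
    qed

    define \<alpha> \<beta> where "\<alpha> = (\<lambda>x. sqrt (n x / wn x))" and "\<beta> = (\<lambda>x. sqrt (p x / wp x))"
    note sn = species_bounds[where \<nu> = n and \<sigma> = \<sigma> and C = Cn and ?s0.0 = s0 and ?s1.0 = s1 and M = M,
        folded En_def Fn_def kn_def, OF that(1) \<sigma>_meas nonneg(1)[rule_format] n_pos bound(1) pos(6) int(1) pos(2) \<open>s0 > 0\<close> \<sigma>]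
    note sp = species_bounds[where \<nu> = p and \<sigma> = \<sigma> and C = Cp and ?s0.0 = s0 and ?s1.0 = s1 and M = M,
        folded Ep_def Fp_def kp_def, OF that(2) \<sigma>_meas nonneg(2)[rule_format] p_pos bound(2) pos(6) int(2) pos(3) \<open>s0 > 0\<close> \<sigma>]
    have \<alpha>_meas[measurable]: "\<alpha> \<in> borel_measurable borel" and \<beta>_meas[measurable]: "\<beta> \<in> borel_measurable borel"
      unfolding \<alpha>_def \<beta>_def by measurable
    have \<alpha>2: "integrable \<mu> (\<lambda>x. (\<alpha> x)\<^sup>2)" "(LINT x|\<mu>. (\<alpha> x)\<^sup>2) \<le> (LINT x|lborel. n x) / (Cn * s0)"
      "ennreal (LINT x|\<mu>. (\<alpha> x - (LINT y|\<mu>. \<alpha> y))\<^sup>2) \<le> ennreal kn * D1"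
      "(\<integral>\<^sup>+x. ennreal (wn x * lambda_B (n x / wn x)) \<partial>lborel)
        \<le> ennreal En * (\<integral>\<^sup>+x. ennreal ((\<alpha> x - 1)\<^sup>2 * e_star V x) \<partial>lborel) + ennreal Fn * D1"
      unfolding \<alpha>_def D1_def wn_def by (rule sn(2-5))+
    have \<beta>2: "integrable \<mu> (\<lambda>x. (\<beta> x)\<^sup>2)" "(LINT x|\<mu>. (\<beta> x)\<^sup>2) \<le> (LINT x|lborel. p x) / (Cp * s0)"
      "ennreal (LINT x|\<mu>. (\<beta> x - (LINT y|\<mu>. \<beta> y))\<^sup>2) \<le> ennreal kp * D2"
      "(\<integral>\<^sup>+x. ennreal (wp x * lambda_B (p x / wp x)) \<partial>lborel)
        \<le> ennreal Ep * (\<integral>\<^sup>+x. ennreal ((\<beta> x - 1)\<^sup>2 * e_star V x) \<partial>lborel) + ennreal Fp * D2"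
      unfolding \<beta>_def D2_def wp_def by (rule sp(2-5))+
    have \<alpha>\<beta>_nonneg: "\<alpha> x \<ge> 0" "\<beta> x \<ge> 0" for x
      unfolding \<alpha>_def \<beta>_def using nonneg w_pos[of x] by auto
    have \<alpha>_sq: "wn x * (\<alpha> x)\<^sup>2 = n x" and \<beta>_sq: "wp x * (\<beta> x)\<^sup>2 = p x" for x
      unfolding \<alpha>_def \<beta>_def using nonneg w_pos[of x] by auto
    have "0 \<le> (LINT x|lborel. n x)" using nonneg by simp
    then have M1: "M1 \<ge> 0" using mass(1) by linarith
    have A: "(LINT x|\<mu>. (\<alpha> x)\<^sup>2) \<le> A" "(LINT x|\<mu>. (\<beta> x)\<^sup>2) \<le> A"
    proof -
      have "(LINT x|lborel. n x) / (Cn * s0) \<le> M1 / (Cn * s0)" "(LINT x|lborel. p x) / (Cp * s0) \<le> M1 / (Cp * s0)"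
        using mass pos \<open>s0 > 0\<close> by (auto intro!: divide_right_mono)
      moreover have "M1 / (Cn * s0) \<ge> 0" "M1 / (Cp * s0) \<ge> 0" using M1 pos \<open>s0 > 0\<close> by auto
      ultimately show "(LINT x|\<mu>. (\<alpha> x)\<^sup>2) \<le> A" "(LINT x|\<mu>. (\<beta> x)\<^sup>2) \<le> A"
        unfolding A_def using \<alpha>2(2) \<beta>2(2) by linarith+
    qed

    \<comment> \<open>A non-integrable function has integral 0 by convention, so the value 1 implies
      integrability.\<close>
    have e_int: "integrable lborel e"
      using e_mass not_integrable_integral_eq by fastforce
    have e_star_\<sigma>: "(\<lambda>x. e_star V x * (\<sigma> x)\<^sup>2) = e" using e_eq by (auto simp: mult.commute)
    have \<sigma>2: "integrable \<mu> (\<lambda>x. (\<sigma> x)\<^sup>2)" "(LINT x|\<mu>. (\<sigma> x)\<^sup>2) = 1"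
      using integral_\<mu>[of "\<lambda>x. (\<sigma> x)\<^sup>2"] e_int e_mass unfolding e_star_\<sigma> by auto
    have \<sigma>_exp: "AE x in lborel. \<sigma> x = exp (ln (e x / e_star V x) / 2)"
    proof (rule AE_I2)
      fix x :: 'a
      have "e x / e_star V x > 0" using e_pos e_star_pos by simp
      then show "\<sigma> x = exp (ln (e x / e_star V x) / 2)"
        unfolding \<sigma>_def by (simp flip: ln_sqrt)
    qed
    have "c * s0 > 0" using pos \<open>s0 > 0\<close> by simp
    \<comment> \<open>\<open>n\<close> and \<open>p\<close> have no lower bound here; the third
      summand of \<open>N\<close>, equal to \<open>c * \<sigma> x * e_star V x\<close>, alone keeps
      the weight above a multiple of \<open>e_star\<close>.\<close>
    have \<sigma>_\<omega>: "AE x in lborel. (\<sigma> x)\<^sup>2 * e_star V x \<le> 4 * s1\<^sup>2 / (c * s0) * \<omega> x"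
    proof (rule AE_I2)
      fix x :: 'a
      have "c * s0 * e_star V x \<le> c * \<sigma> x * e_star V x"
        using pos \<sigma>(1)[of x] e_star_pos[of x] by (intro mult_right_mono mult_left_mono) auto
      also have "c * \<sigma> x * e_star V x = c * sqrt (e x) * sqrt (e_star V x)"
        unfolding sqrt_e sqrt_e_star e_star_sq[symmetric] by (simp add: mult_ac)
      also have "\<dots> \<le> 4 * \<omega> x" unfolding \<omega>_def using nonneg by simp
      finally have "e_star V x \<le> 4 / (c * s0) * \<omega> x"
        using \<open>c * s0 > 0\<close> by (simp add: field_simps)
      moreover have "(\<sigma> x)\<^sup>2 \<le> s1\<^sup>2" using \<sigma>(2)[of x] \<sigma>_pos[of x] by (intro power_mono) auto
      ultimately have "(\<sigma> x)\<^sup>2 * e_star V x \<le> s1\<^sup>2 * (4 / (c * s0) * \<omega> x)"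
        using e_star_pos[of x] by (intro mult_mono) auto
      then show "(\<sigma> x)\<^sup>2 * e_star V x \<le> 4 * s1\<^sup>2 / (c * s0) * \<omega> x" by (simp add: mult_ac)
    qed
    have \<omega>_meas: "\<omega> \<in> borel_measurable borel" by measurable
    have "4 * s1\<^sup>2 / (c * s0) > 0" using \<open>c * s0 > 0\<close> s1 by simp
    note db = dirichlet_bounds(1)[OF \<sigma>_meas \<omega>_meas \<sigma>2(1) \<sigma>_exp \<sigma>_\<omega> this, folded D3_def ks_def]

    have prod_eq: "sqrt (rr x) = \<alpha> x * \<beta> x" for x
      unfolding rr_def \<alpha>_def \<beta>_def by (simp add: real_sqrt_mult real_sqrt_divide)
    have react: "(\<integral>\<^sup>+x. ennreal ((\<alpha> x * \<beta> x - 1)\<^sup>2) \<partial>\<mu>) \<le> ennreal kr * D4"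
    proof -
      have "(\<integral>\<^sup>+x. ennreal ((\<alpha> x * \<beta> x - 1)\<^sup>2) \<partial>\<mu>) = (\<integral>\<^sup>+x. ennreal ((\<alpha> x * \<beta> x - 1)\<^sup>2 * e_star V x) \<partial>lborel)"
        by (rule nn_integral_\<mu>) auto
      also have "\<dots> \<le> (\<integral>\<^sup>+x. ennreal kr * (ennreal (k_lo * e_lo * e_star V x) * reaction_dissipation (rr x)) \<partial>lborel)"
      proof (rule nn_integral_mono)
        fix x :: 'a
        have "ennreal ((\<alpha> x * \<beta> x - 1)\<^sup>2 * e_star V x)
            = ennreal kr * (ennreal (k_lo * e_lo * e_star V x) * ennreal (2 * (sqrt (rr x) - 1)\<^sup>2))"
        proof -
          have "(\<alpha> x * \<beta> x - 1)\<^sup>2 * e_star V x = kr * ((k_lo * e_lo * e_star V x) * (2 * (sqrt (rr x) - 1)\<^sup>2))"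
            unfolding prod_eq kr_def using pos by (simp add: field_simps)
          then show ?thesis
            using k_nonneg pos e_star_pos[of x] by (simp add: ennreal_mult[symmetric])
        qed
        also have "\<dots> \<le> ennreal kr * (ennreal (k_lo * e_lo * e_star V x) * reaction_dissipation (rr x))"
          by (intro mult_left_mono reaction_dissipation_ge rr_nonneg) auto
        finally show "ennreal ((\<alpha> x * \<beta> x - 1)\<^sup>2 * e_star V x) \<le> \<dots>" .
      qed
      also have "\<dots> = ennreal kr * (\<integral>\<^sup>+x. ennreal (k_lo * e_lo * e_star V x) * reaction_dissipation (rr x) \<partial>lborel)"
        by (rule nn_integral_cmult) measurable
      also have "\<dots> \<le> ennreal kr * D4"
        unfolding D4_def by (intro mult_left_mono nn_integral_mono D4_ge) auto
      finally show ?thesis .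
    qed
    have m_meas: "\<alpha> \<in> borel_measurable \<mu>" "\<beta> \<in> borel_measurable \<mu>" "\<sigma> \<in> borel_measurable \<mu>"
      unfolding \<mu>_measurable by measurable
    have react_int: "integrable \<mu> (\<lambda>x. (\<alpha> x * \<beta> x - 1)\<^sup>2)"
    proof (rule integrableI_bounded)
      show "(\<lambda>x. (\<alpha> x * \<beta> x - 1)\<^sup>2) \<in> borel_measurable \<mu>" using m_meas by measurable
      have "ennreal kr * D4 < \<infinity>" using D_le(4) by (auto simp: ennreal_mult_less_top intro: le_less_trans)
      then show "(\<integral>\<^sup>+x. ennreal (norm ((\<alpha> x * \<beta> x - 1)\<^sup>2)) \<partial>\<mu>) < \<infinity>"
        using react by (auto intro: le_less_trans)
    qed
    have react_le: "(LINT x|\<mu>. (\<alpha> x * \<beta> x - 1)\<^sup>2) \<le> \<delta>"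
    proof (rule le_\<delta>[OF _ D_le(4)])
      show "ennreal (LINT x|\<mu>. (\<alpha> x * \<beta> x - 1)\<^sup>2) \<le> ennreal kr * D4"
        using react react_int by (simp add: nn_integral_eq_integral)
    qed (use k_nonneg \<kappa>_ge in auto)
    \<comment> \<open>Since \<open>wn x * (\<alpha> x)^2 = n x\<close> and likewise for
      \<open>p\<close>, charge conservation becomes a moment identity with respect to
      \<open>\<mu>\<close>.\<close>
    have charge': "(LINT x|\<mu>. \<sigma> x * (Cn * (\<alpha> x)\<^sup>2 - Cp * (\<beta> x)\<^sup>2)) = Cn - Cp"
    proof -
      have "(LINT x|\<mu>. \<sigma> x * (Cn * (\<alpha> x)\<^sup>2 - Cp * (\<beta> x)\<^sup>2)) = (LINT x|lborel. e_star V x * (\<sigma> x * (Cn * (\<alpha> x)\<^sup>2 - Cp * (\<beta> x)\<^sup>2)))"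
        by (rule integral_\<mu>(2)) measurable
      also have "\<dots> = (LINT x|lborel. n x - p x)"
      proof (rule Bochner_Integration.integral_cong[OF refl])
        fix x
        have "e_star V x * (\<sigma> x * (Cn * (\<alpha> x)\<^sup>2 - Cp * (\<beta> x)\<^sup>2)) = wn x * (\<alpha> x)\<^sup>2 - wp x * (\<beta> x)\<^sup>2"
          unfolding wn_def wp_def by (simp add: algebra_simps)
        then show "e_star V x * (\<sigma> x * (Cn * (\<alpha> x)\<^sup>2 - Cp * (\<beta> x)\<^sup>2)) = n x - p x"
          unfolding \<alpha>_sq \<beta>_sq .
      qed
      finally show ?thesis using charge by simp
    qed
    note dist = \<mu>.square_distance_to_equilibrium[OF \<mu>_mass(2) m_meas \<alpha>\<beta>_nonneg less_imp_le[OF \<sigma>_pos] \<sigma>(2) pos(2,3)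
        \<alpha>2(1) \<beta>2(1) A \<sigma>2(2) charge' le_\<delta>[OF \<alpha>2(3) D_le(1) k_nonneg(1) \<kappa>_ge(1)]
        le_\<delta>[OF \<beta>2(3) D_le(2) k_nonneg(2) \<kappa>_ge(2)] le_\<delta>[OF db D_le(3) k_nonneg(3) \<kappa>_ge(3)] react_int react_le, folded K0_def]
    have nn_dist: "(\<integral>\<^sup>+x. ennreal ((f x - 1)\<^sup>2 * e_star V x) \<partial>lborel) \<le> ennreal d"
      if [measurable]: "f \<in> borel_measurable borel" and f2: "integrable \<mu> (\<lambda>x. (f x)\<^sup>2)" and le: "(LINT x|\<mu>. (f x - 1)\<^sup>2) \<le> d"
      for f d
    proof -
      have m: "f \<in> borel_measurable \<mu>" unfolding \<mu>_measurable by measurable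
      have "(\<integral>\<^sup>+x. ennreal ((f x - 1)\<^sup>2 * e_star V x) \<partial>lborel) = (\<integral>\<^sup>+x. ennreal ((f x - 1)\<^sup>2) \<partial>\<mu>)"
        by (rule nn_integral_\<mu>[symmetric]) auto
      also have "\<dots> = ennreal (LINT x|\<mu>. (f x - 1)\<^sup>2)"
        using \<mu>.integral_square_deviation(1)[OF m f2 \<mu>_mass(2), of 1] by (intro nn_integral_eq_integral) auto
      also have "\<dots> \<le> ennreal d" using le by (rule ennreal_leI)
      finally show ?thesis .
    qed
    have \<delta>: "\<delta> \<ge> 0" unfolding \<delta>_def using \<kappa>_ge P(2) by simp
    have EF: "En \<ge> 0" "Ep \<ge> 0" "Fn \<ge> 0" "Fp \<ge> 0"
      unfolding En_def Ep_def Fn_def Fp_def using pos s1 \<open>s0 > 0\<close> K_pos by (auto intro!: mult_nonneg_nonneg add_nonneg_nonneg)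
    have species: "ennreal E * I + ennreal F * D \<le> ennreal ((E * ((1 + K0\<^sup>2) * \<kappa>) + F) * P)"
      if "I \<le> ennreal ((1 + K0\<^sup>2) * \<delta>)" "D \<le> ennreal P" "E \<ge> 0" "F \<ge> 0" for E F I D
    proof -
      have "ennreal E * I + ennreal F * D \<le> ennreal E * ennreal ((1 + K0\<^sup>2) * \<delta>) + ennreal F * ennreal P"
        using that by (intro add_mono mult_left_mono) auto
      also have "\<dots> = ennreal (E * ((1 + K0\<^sup>2) * \<delta>)) + ennreal (F * P)"
        using that \<delta> P(2) by (simp add: ennreal_mult)
      also have "\<dots> = ennreal (E * ((1 + K0\<^sup>2) * \<delta>) + F * P)"
        using that \<delta> P(2) by (intro ennreal_plus[symmetric]) auto
      also have "E * ((1 + K0\<^sup>2) * \<delta>) + F * P = (E * ((1 + K0\<^sup>2) * \<kappa>) + F) * P"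
        unfolding \<delta>_def by (simp add: algebra_simps)
      finally show ?thesis .
    qed
    have energy: "ennreal ((c + Cn + Cp) / 2) * (\<integral>\<^sup>+x. ennreal ((sqrt (e x) - sqrt (e_star V x))\<^sup>2) \<partial>lborel)
        \<le> ennreal ((c + Cn + Cp) / 2 * (2 * \<kappa>) * P)"
    proof -
      have "(sqrt (e x) - sqrt (e_star V x))\<^sup>2 = (\<sigma> x - 1)\<^sup>2 * e_star V x" for x
        unfolding sqrt_e sqrt_e_star e_star_sq[symmetric] by (simp add: power2_eq_square algebra_simps)
      then have "(\<integral>\<^sup>+x. ennreal ((sqrt (e x) - sqrt (e_star V x))\<^sup>2) \<partial>lborel) \<le> ennreal (2 * \<delta>)"
        using nn_dist[OF \<sigma>_meas \<sigma>2(1) dist(3)] by simp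
      then have "ennreal ((c + Cn + Cp) / 2) * (\<integral>\<^sup>+x. ennreal ((sqrt (e x) - sqrt (e_star V x))\<^sup>2) \<partial>lborel)
          \<le> ennreal ((c + Cn + Cp) / 2) * ennreal (2 * \<delta>)"
        by (rule mult_left_mono) simp
      also have "\<dots> = ennreal ((c + Cn + Cp) / 2 * (2 * \<delta>))"
        using pos \<delta> by (intro ennreal_mult[symmetric]) auto
      finally show ?thesis unfolding \<delta>_def by (simp add: mult.assoc)
    qed
    have Hn: "(\<integral>\<^sup>+x. ennreal (wn x * lambda_B (n x / wn x)) \<partial>lborel) \<le> ennreal ((En * ((1 + K0\<^sup>2) * \<kappa>) + Fn) * P)"
      by (rule order_trans[OF \<alpha>2(4) species[OF nn_dist[OF \<alpha>_meas \<alpha>2(1) dist(1)] D_le(1) EF(1,3)]])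
    have Hp: "(\<integral>\<^sup>+x. ennreal (wp x * lambda_B (p x / wp x)) \<partial>lborel) \<le> ennreal ((Ep * ((1 + K0\<^sup>2) * \<kappa>) + Fp) * P)"
      by (rule order_trans[OF \<beta>2(4) species[OF nn_dist[OF \<beta>_meas \<beta>2(1) dist(2)] D_le(2) EF(2,4)]])
    have "rel_entropy V c Cn Cp n p e \<le> ennreal ((En * ((1 + K0\<^sup>2) * \<kappa>) + Fn) * P)
        + ennreal ((Ep * ((1 + K0\<^sup>2) * \<kappa>) + Fp) * P) + ennreal ((c + Cn + Cp) / 2 * (2 * \<kappa>) * P)"
      unfolding rel_entropy_def w_eq wn_def[symmetric] wp_def[symmetric]
      using Hn Hp energy by (intro add_mono) (auto simp: wn_def wp_def)
    also have "\<dots> = ennreal (H * P)"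
    proof -
      have n: "0 \<le> (En * ((1 + K0\<^sup>2) * \<kappa>) + Fn) * P" "0 \<le> (Ep * ((1 + K0\<^sup>2) * \<kappa>) + Fp) * P" "0 \<le> (c + Cn + Cp) / 2 * (2 * \<kappa>) * P"
        using EF \<kappa>_ge P(2) pos by auto
      have "H * P = (En * ((1 + K0\<^sup>2) * \<kappa>) + Fn) * P + (Ep * ((1 + K0\<^sup>2) * \<kappa>) + Fp) * P + (c + Cn + Cp) / 2 * (2 * \<kappa>) * P"
        unfolding H_def by (simp add: distrib_right)
      then show ?thesis
        by (simp only: ennreal_plus[OF add_nonneg_nonneg[OF n(1,2)] n(3)] ennreal_plus[OF n(1,2)])
    qed
    also have "\<dots> \<le> ennreal (K' * P)"
      unfolding K'_def using P(2) by (intro ennreal_leI mult_right_mono) auto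
    also have "\<dots> = ennreal K' * entropy_production V c Cn Cp k n p e"
      unfolding P(1) using P(2) by (intro ennreal_mult) (auto simp: K'_def)
    finally show ?thesis .
  qed
  have "K' > 0" unfolding K'_def by simp
  then show ?thesis
    by (intro exI[of _ K'] conjI allI impI) (assumption | rule main)+
qed

end

theorem proposition6p8:
  fixes V :: "real ^ 'd \<Rightarrow> real"
    and k n p e :: "real \<Rightarrow> real ^ 'd \<Rightarrow> real"
    and n0 p0 e0 :: "real ^ 'd \<Rightarrow> real"
    and c C0 Cn Cp k_lo k_hi e_lo e_hi :: real
  assumes dim: "CARD('d) \<le> 4"
    and V_C2: "C2 V"
    and V_convex: "bounded_perturbation_of_uniformly_convex V"
    and V_normalized: "integrable lborel (\<lambda>x. exp (- 2 * V x))"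
      "(LINT x|lborel. exp (- 2 * V x)) = 1"
    and k_bounds: "0 < k_lo" "\<And>t x. t > 0 \<Longrightarrow> k_lo \<le> k t x \<and> k t x \<le> k_hi"
    and k_measurable: "measurable_pos_time k"
    and c_pos: "c > 0"
    and Cn_Cp: "Cn > 0" "Cp > 0" "Cn * Cp = 1" "Cn - Cp = C0"
    and initial_nonneg: "\<And>x. n0 x \<ge> 0" "\<And>x. p0 x \<ge> 0" "\<And>x. e0 x \<ge> 0"
    and initial_integrable:
      "integrable lborel n0" "integrable lborel p0" "integrable lborel e0"
    and initial_data: "(LINT x|lborel. n0 x - p0 x) = C0" "(LINT x|lborel. e0 x) = 1"
    and sol: "solution V k n0 p0 e0 n p e"
    and nonneg: "\<And>t x. t > 0 \<Longrightarrow> n t x \<ge> 0 \<and> p t x \<ge> 0 \<and> e t x \<ge> 0"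
    and conserved: "\<And>t. t > 0 \<Longrightarrow> (LINT x|lborel. n t x - p t x) = C0"
      "\<And>t. t > 0 \<Longrightarrow> (LINT x|lborel. e t x) = 1"
    and e_bounds: "0 < e_lo" "e_lo \<le> e_hi"
      "\<And>t x. t > 0 \<Longrightarrow> e_lo * e_star V x \<le> e t x \<and> e t x \<le> e_hi * e_star V x"
  shows "\<exists>K::real. K > 0 \<and>
    (\<forall>t>0. rel_entropy V c Cn Cp (n t) (p t) (e t) \<le>
       ennreal K * entropy_production V c Cn Cp (k t) (n t) (p t) (e t))"
proof -
  have V_meas: "V \<in> borel_measurable borel"
  proof (rule borel_measurable_continuous_onI)
    have "V differentiable (at x)" for x
      using V_C2 unfolding C2_def C1_def by blast
    then show "continuous_on UNIV V"
      by (simp add: continuous_at_imp_continuous_on differentiable_imp_continuous_within)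
  qed
  have e_star: "integrable lborel (e_star V)" "(LINT x|lborel. e_star V x) = 1"
    using V_normalized by (simp_all add: e_star_def[abs_def])
  have "(\<integral>\<^sup>+x. ennreal (e_star V x) \<partial>lborel) < \<infinity>"
    using nn_integral_eq_integral[OF e_star(1)] by (simp add: e_star_def)
  from ratio_exp_inequalities[OF V_convex V_meas this]
  obtain q K b where q: "q \<in> borel_measurable borel" "\<forall>x. 0 \<le> q x" "\<forall>x. V x \<le> q x + b" and "K > 0"
    and ineq: "\<forall>u g. weak_gradient u g \<longrightarrow> (\<integral>\<^sup>+x. ennreal (exp (u x) * e_star V x) \<partial>lborel) < \<infinity> \<longrightarrow>
      (\<integral>\<^sup>+x. ennreal ((exp (u x / 2) - 1)\<^sup>2 * e_star V x * q x) \<partial>lborel)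
        \<le> ennreal K * (\<integral>\<^sup>+x. ennreal ((exp (u x / 2) - 1)\<^sup>2 * e_star V x) \<partial>lborel)
          + ennreal K * (\<integral>\<^sup>+x. ennreal (exp (u x) * (norm (g x))\<^sup>2 * e_star V x) \<partial>lborel) \<and>
      (\<exists>c. (\<integral>\<^sup>+x. ennreal ((exp (u x / 2) - c)\<^sup>2 * e_star V x) \<partial>lborel)
        \<le> ennreal K * (\<integral>\<^sup>+x. ennreal (exp (u x) * (norm (g x))\<^sup>2 * e_star V x) \<partial>lborel))"
    by (elim exE conjE) rule
  interpret equilibrium V q b K
    by unfold_locales (use V_meas e_star q \<open>K > 0\<close> ineq in simp_all)
  have L1: "Linfty_L1 n" "Linfty_L1 p" "Linfty_L1 e" and Linf: "Linfty n" "Linfty p"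
    using sol unfolding solution_def by auto
  obtain M1n where M1n: "\<And>t. t > 0 \<Longrightarrow> integrable lborel (n t) \<and> (LINT x|lborel. \<bar>n t x\<bar>) \<le> M1n"
    using L1(1) unfolding Linfty_L1_def by auto
  obtain M1p where M1p: "\<And>t. t > 0 \<Longrightarrow> integrable lborel (p t) \<and> (LINT x|lborel. \<bar>p t x\<bar>) \<le> M1p"
    using L1(2) unfolding Linfty_L1_def by auto
  obtain Mn where Mn: "\<And>t. t > 0 \<Longrightarrow> AE x in lborel. \<bar>n t x\<bar> \<le> Mn"
    using Linf(1) unfolding Linfty_def by auto
  obtain Mp where Mp: "\<And>t. t > 0 \<Longrightarrow> AE x in lborel. \<bar>p t x\<bar> \<le> Mp"
    using Linf(2) unfolding Linfty_def by auto
  \<comment> \<open>Both bounds hold for every positive time, which makes the final constant uniform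
    in time. The \<open>max 1\<close> gives \<open>M > 0\<close>, as the logarithm of
    \<open>M\<close> in the estimate requires.\<close>
  define M M1 where "M = max 1 (max Mn Mp)" and "M1 = max M1n M1p"
  have "M > 0" by (simp add: M_def)
  from entropy_le_production[OF c_pos Cn_Cp(1,2) k_bounds(1) e_bounds(1) this, of M1 e_hi]
  obtain K' where "K' > 0" and K': "\<forall>k n p e. n \<in> borel_measurable borel \<longrightarrow> p \<in> borel_measurable borel \<longrightarrow>
    e \<in> borel_measurable borel \<longrightarrow>
    (\<forall>x. 0 \<le> n x) \<longrightarrow> (\<forall>x. 0 \<le> p x) \<longrightarrow> (\<forall>x. k_lo \<le> k x) \<longrightarrow>
    integrable lborel n \<longrightarrow> integrable lborel p \<longrightarrow>
    (LINT x|lborel. n x) \<le> M1 \<longrightarrow> (LINT x|lborel. p x) \<le> M1 \<longrightarrow>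
    (AE x in lborel. n x \<le> M) \<longrightarrow> (AE x in lborel. p x \<le> M) \<longrightarrow>
    (\<forall>x. e_lo * e_star V x \<le> e x \<and> e x \<le> e_hi * e_star V x) \<longrightarrow>
    (LINT x|lborel. e x) = 1 \<longrightarrow> (LINT x|lborel. n x - p x) = Cn - Cp \<longrightarrow>
    rel_entropy V c Cn Cp n p e \<le> ennreal K' * entropy_production V c Cn Cp k n p e"
    by (elim exE conjE) rule
  have "rel_entropy V c Cn Cp (n t) (p t) (e t) \<le> ennreal K' * entropy_production V c Cn Cp (k t) (n t) (p t) (e t)"
    if t: "t > 0" for t
  proof (rule K'[rule_format])
    have e_int: "integrable lborel (e t)" using L1(3) t unfolding Linfty_L1_def by auto
    show "n t \<in> borel_measurable borel" "p t \<in> borel_measurable borel" "e t \<in> borel_measurable borel"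
      using M1n[OF t] M1p[OF t] e_int borel_measurable_integrable by force+
    show "0 \<le> n t x" "0 \<le> p t x" "k_lo \<le> k t x" "e_lo * e_star V x \<le> e t x \<and> e t x \<le> e_hi * e_star V x" for x
      using nonneg[OF t] k_bounds(2)[OF t] e_bounds(3)[OF t] by auto
    show "integrable lborel (n t)" "integrable lborel (p t)" using M1n[OF t] M1p[OF t] by auto
    have "(LINT x|lborel. \<bar>n t x\<bar>) = (LINT x|lborel. n t x)" "(LINT x|lborel. \<bar>p t x\<bar>) = (LINT x|lborel. p t x)"
      using nonneg[OF t] by simp_all
    then show "(LINT x|lborel. n t x) \<le> M1" "(LINT x|lborel. p t x) \<le> M1"
      using M1n[OF t] M1p[OF t] by (auto simp: M1_def)
    show "AE x in lborel. n t x \<le> M" using Mn[OF t] by eventually_elim (auto simp: M_def)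
    show "AE x in lborel. p t x \<le> M" using Mp[OF t] by eventually_elim (auto simp: M_def)
    show "(LINT x|lborel. e t x) = 1" "(LINT x|lborel. n t x - p t x) = Cn - Cp"
      using conserved[OF t] Cn_Cp(4) by simp_all
  qed
  then show ?thesis using \<open>K' > 0\<close> by blast
qed

end
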